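(* For every graph $H$ with at least one edge and every $\epsilon>0$, there exist $\delta>0$ and $c>0$ such that the following holds. Let $p\in(0,1]$, let $\beta\le c\,p^{d_2(H)+3}n$, and let $\Gamma$ be any $(p,\beta)$-jumbled graph on $n$ vertices. Then any $H$-free subgraph of $\Gamma$ with at least $\left(1-\frac{1}{\chi(H)-1}-\delta\right)p\binom n2$ edges may be made $(\chi(H)-1)$-partite by removing at most $\epsilon p n^2$ edges.
   Context: Graphs are finite and simple; $\chi(H)$ is the chromatic number, and a graph is $H$-free if it contains no (not necessarily induced) subgraph isomorphic to $H$. A graph $\Gamma$ on vertex set $V$ is $(p,\beta)$-jumbled if for all $X,Y\subseteq V$, $|e(X,Y)-p|X||Y||\le\beta\sqrt{|X||Y|}$, where $e(X,Y)$ is the number of pairs $(x,y)\in X\times Y$ such that $xy$ is an edge. 2-degeneracy $d_2(H)$: given an ordering $v_1,\dots,v_m$ of the vertices of $H$ and $i\le j$, let $N_{i-1}(j)$ be the number of neighbours $v_h$ of $v_j$ with $h\le i-1$. Then $d_2(H)$ is the minimum $d\ge 0$ for which there is an ordering $v_1,\dots,v_m$ of the vertices of $H$ such that $N_{i-1}(i)+N_{i-1}(j)\le 2d$ for every edge $v_iv_j$ with $i<j$. ($d_2(H)$ may be a half-integer.) *)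

theory Defs
  imports Complex_Main
begin

record 'a ugraph =
  vertices :: "'a set"
  edges :: "'a set set"

definition simple_graph :: "'a ugraph \<Rightarrow> bool" where
  "simple_graph G \<longleftrightarrow> finite (vertices G) \<and> (\<forall>e\<in>edges G. e \<subseteq> vertices G \<and> card e = 2)"

definition adjacent :: "'a ugraph \<Rightarrow> 'a \<Rightarrow> 'a \<Rightarrow> bool" where
  "adjacent G u v \<longleftrightarrow> {u, v} \<in> edges G"

definition is_subgraph :: "'a ugraph \<Rightarrow> 'a ugraph \<Rightarrow> bool" where
  "is_subgraph K G \<longleftrightarrow> simple_graph K \<and> vertices K \<subseteq> vertices G \<and> edges K \<subseteq> edges G"

definition isomorphic_graphs :: "'a ugraph \<Rightarrow> 'b ugraph \<Rightarrow> bool" where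
  "isomorphic_graphs H K \<longleftrightarrow> (\<exists>f. bij_betw f (vertices H) (vertices K) \<and>
     (\<forall>u\<in>vertices H. \<forall>v\<in>vertices H. adjacent H u v \<longleftrightarrow> adjacent K (f u) (f v)))"

definition free_of :: "'a ugraph \<Rightarrow> 'b ugraph \<Rightarrow> bool" where
  "free_of H G \<longleftrightarrow> \<not> (\<exists>K. is_subgraph K G \<and> isomorphic_graphs H K)"

text \<open>The \<open>r\<close> colour classes are the parts; parts may be empty.\<close>

definition r_partite :: "nat \<Rightarrow> 'a ugraph \<Rightarrow> bool" where
  "r_partite r G \<longleftrightarrow> (\<exists>f :: 'a \<Rightarrow> nat. (\<forall>v\<in>vertices G. f v < r) \<and>
     (\<forall>u\<in>vertices G. \<forall>v\<in>vertices G. adjacent G u v \<longrightarrow> f u \<noteq> f v))"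

definition chromatic_number :: "'a ugraph \<Rightarrow> nat" where
  "chromatic_number G = (LEAST r. r_partite r G)"

text \<open>Ordered pairs: an edge with both ends in \<open>X \<inter> Y\<close> is counted twice.\<close>

definition e_pairs :: "'a ugraph \<Rightarrow> 'a set \<Rightarrow> 'a set \<Rightarrow> nat" where
  "e_pairs G X Y = card {(x, y) \<in> X \<times> Y. adjacent G x y}"

definition jumbled :: "real \<Rightarrow> real \<Rightarrow> 'a ugraph \<Rightarrow> bool" where
  "jumbled p \<beta> G \<longleftrightarrow> (\<forall>X Y. X \<subseteq> vertices G \<longrightarrow> Y \<subseteq> vertices G \<longrightarrow>
     \<bar>real (e_pairs G X Y) - p * real (card X) * real (card Y)\<bar>
       \<le> \<beta> * sqrt (real (card X) * real (card Y)))"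

text \<open>
  An ordering \<open>v\<^sub>1, \<dots>, v\<^sub>m\<close> is a duplicate-free list whose entry \<open>vs ! i\<close> is \<open>v\<^sub>i\<^sub>+\<^sub>1\<close>.
  With these 0-based indices, \<open>earlier_nbrs H vs i j\<close> counts the neighbours of \<open>vs ! j\<close>
  that come strictly before \<open>vs ! i\<close>.
\<close>

definition vertex_ordering :: "'a ugraph \<Rightarrow> 'a list \<Rightarrow> bool" where
  "vertex_ordering H vs \<longleftrightarrow> distinct vs \<and> set vs = vertices H"

definition earlier_nbrs :: "'a ugraph \<Rightarrow> 'a list \<Rightarrow> nat \<Rightarrow> nat \<Rightarrow> nat" where
  "earlier_nbrs H vs i j = card {h. h < i \<and> adjacent H (vs ! h) (vs ! j)}"

definition ordering_2_bounded :: "'a ugraph \<Rightarrow> 'a list \<Rightarrow> real \<Rightarrow> bool" where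
  "ordering_2_bounded H vs d \<longleftrightarrow> (\<forall>i j. i < j \<longrightarrow> j < length vs \<longrightarrow> adjacent H (vs ! i) (vs ! j) \<longrightarrow>
     real (earlier_nbrs H vs i i + earlier_nbrs H vs i j) \<le> 2 * d)"

text \<open>
  A minimum over the reals, since half-integers occur; \<open>two_degeneracy_attained\<close>
  shows that it exists for every finite graph.
\<close>

definition two_degeneracy :: "'a ugraph \<Rightarrow> real" where
  "two_degeneracy H =
     (LEAST d. 0 \<le> d \<and> (\<exists>vs. vertex_ordering H vs \<and> ordering_2_bounded H vs d))"

lemma two_degeneracy_attained:
  assumes "simple_graph H"
  shows "0 \<le> two_degeneracy H"
    and "\<exists>vs. vertex_ordering H vs \<and> ordering_2_bounded H vs (two_degeneracy H)"
    and "\<And>d vs. 0 \<le> d \<Longrightarrow> vertex_ordering H vs \<Longrightarrow> ordering_2_bounded H vs d \<Longrightarrow>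
           two_degeneracy H \<le> d"
proof -
  let ?P = "\<lambda>d::real. 0 \<le> d \<and> (\<exists>vs. vertex_ordering H vs \<and> ordering_2_bounded H vs d)"
  let ?Q = "\<lambda>k::nat. ?P (real k / 2)"
  obtain ws where ws: "vertex_ordering H ws"
    using assms finite_distinct_list unfolding simple_graph_def vertex_ordering_def by metis
  have le: "earlier_nbrs H vs i j \<le> i" for vs :: "'a list" and i j
  proof -
    have "card {h. h < i \<and> adjacent H (vs ! h) (vs ! j)} \<le> card {..<i}"
      by (rule card_mono) auto
    then show ?thesis by (simp add: earlier_nbrs_def)
  qed
  have "ordering_2_bounded H ws (real (2 * length ws) / 2)"
    unfolding ordering_2_bounded_def
  proof (intro allI impI)
    fix i j assume "i < j" "j < length ws"
    with le[of ws i i] le[of ws i j]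
    have "earlier_nbrs H ws i i + earlier_nbrs H ws i j \<le> 2 * length ws" by linarith
    then show "real (earlier_nbrs H ws i i + earlier_nbrs H ws i j) \<le> 2 * (real (2 * length ws) / 2)"
      by simp
  qed
  with ws have ex: "?Q (2 * length ws)" by auto
  define k where "k = (LEAST k. ?Q k)"
  have k: "?Q k" unfolding k_def by (rule LeastI[of ?Q, OF ex])
  have min: "real k / 2 \<le> d" if "?P d" for d
  proof -
    from that obtain vs where vs: "vertex_ordering H vs" "ordering_2_bounded H vs d" and "0 \<le> d"
      by blast
    let ?m = "nat \<lfloor>2 * d\<rfloor>"
    have "ordering_2_bounded H vs (real ?m / 2)"
      using vs(2) unfolding ordering_2_bounded_def by (simp add: le_nat_floor del: of_nat_add)
    with vs(1) have "?Q ?m" by auto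
    then have "k \<le> ?m" unfolding k_def by (rule Least_le)
    then have "real k \<le> real ?m" by simp
    also have "\<dots> \<le> 2 * d" using \<open>0 \<le> d\<close> by (simp add: of_nat_nat)
    finally show ?thesis by simp
  qed
  have eq: "two_degeneracy H = real k / 2"
    unfolding two_degeneracy_def using k min by (rule Least_equality)
  show "0 \<le> two_degeneracy H"
    and "\<exists>vs. vertex_ordering H vs \<and> ordering_2_bounded H vs (two_degeneracy H)"
    using k unfolding eq by auto
  show "two_degeneracy H \<le> d"
    if "0 \<le> d" "vertex_ordering H vs" "ordering_2_bounded H vs d" for d vs
    using min that unfolding eq by blast
qed

definition remove_edges :: "'a ugraph \<Rightarrow> 'a set set \<Rightarrow> 'a ugraph" where
  "remove_edges G R = G\<lparr>edges := edges G - R\<rparr>"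

end

theory Submission
  imports Defs "HOL-Analysis.Convex"
begin

text \<open>
  A sparse regularity lemma, applied to \<open>G\<close>, yields the relation \<open>R\<close> joining two vertices whose
  cells are large and form a regular pair of relative density at least \<open>\<theta>\<close>. If \<open>R\<close>
  contained a clique on \<open>\<chi>(H)\<close> vertices, then \<open>H\<close> could be embedded into the corresponding cells vertex
  by vertex, in an ordering that realises \<open>d\<^sub>2(H)\<close>: after a vertex is mapped to \<open>z\<close>, the candidate sets
  of its neighbours shrink to neighbourhoods of \<open>z\<close>, and for most \<open>z\<close> regularity is inherited as long as
  \<open>\<beta> \<le> c p\<^sup>3 sqrt(|X||Y|)\<close> for the candidate sets \<open>X\<close>, \<open>Y\<close> of every edge not yet embedded. As these
  sets have sizes of order \<open>p\<^sup>a n\<close> and \<open>p\<^sup>b n\<close> with \<open>a + b \<le> 2 d\<^sub>2(H)\<close>, this is what the exponent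
  \<open>d\<^sub>2(H) + 3\<close> provides. So \<open>R\<close> has no such clique but almost as many edges as a Turan graph, and by
  Fueredi's argument it is almost \<open>(\<chi>(H) - 1)\<close>-partite. The jumbledness of \<open>\<Gamma>\<close> bounds the number of
  edges of \<open>G\<close> inside the colour classes.

  Inheritance is proved by applying the Cauchy--Schwarz inequality to \<open>\<Sum> \<Gamma>(x,z) |\<Sum> g(x,y) b(y,z)|\<close>,
  where \<open>g\<close> is the deviation of \<open>G\<close> from its density on \<open>X \<times> Y\<close> and \<open>b\<close> selects a worst subset for each
  \<open>z\<close>; after that the weight \<open>\<Gamma>\<close> may be replaced by \<open>p\<close>, and regularity of \<open>g\<close> against bounded
  weights suffices.
\<close>

section \<open>Jumbledness\<close>

text \<open>The exponent 3 is dictated by the inheritance step in which both cells shrink. The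
  deviation that may be tolerated there, summed over all \<open>z\<close>, is of order
  \<open>p^3 |X| |Y| |Z|\<close>: one factor \<open>p\<close> for the density and one for each
  neighbourhood. As \<open>\<Gamma>\<close> has about \<open>p |X| |Z|\<close> edges between
  \<open>X\<close> and \<open>Z\<close>, Cauchy-Schwarz asks for a weighted sum of squares that is
  small against \<open>p^5 |X| |Y|^2 |Z|\<close>. Replacing \<open>\<Gamma>\<close> by
  \<open>p\<close> in it costs about \<open>\<beta> p^2 |Y|^2 sqrt(|X| |Z|)\<close>, so
  \<open>\<beta>\<close> must be small against \<open>p^3 sqrt(|X| |Z|)\<close>. The obstacle is
  that the worst subsets vary with \<open>z\<close> and have size about \<open>p |Y|\<close>,
  whereas regularity controls only errors relative to all of \<open>|Y|\<close>. Squaring removes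
  this dependence: after summation over \<open>z\<close> only codegrees remain, typically at most
  \<open>4 p^2 |Z|\<close>, and dividing by this bound turns them into weights in [0,1]. A second
  Cauchy-Schwarz step, with these weights, is affordable. Partitions enter only through functions on
  vertices that are constant on cells. Hence cells of very different sizes are harmless, and the
  extremal argument runs on the vertex set itself instead of on a reduced graph.\<close>

lemma sum_weight_extreme:
  fixes c v :: "'a \<Rightarrow> real"
  assumes "finite Z" and v: "\<And>z. z \<in> Z \<Longrightarrow> 0 \<le> v z \<and> v z \<le> 1"
    and K: "\<And>B. B \<subseteq> {z \<in> Z. v z \<noteq> 0} \<Longrightarrow> \<bar>sum c B\<bar> \<le> K"
  shows "\<bar>\<Sum>z\<in>Z. c z * v z\<bar> \<le> K"
proof -
  \<comment> \<open>A linear function on a cube is largest at a vertex of the cube: deleting the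
    negative terms and raising the other weights to 1 only increases the sum. Indices of weight 0
    are left out, so that bounds may refer to the support of \<open>v\<close>.\<close>
  have upper: "(\<Sum>z\<in>Z. d z * v z) \<le> K" if d: "\<And>B. B \<subseteq> {z \<in> Z. v z \<noteq> 0} \<Longrightarrow> sum d B \<le> K"
    for d :: "'a \<Rightarrow> real"
  proof -
    let ?S = "{z \<in> Z. v z \<noteq> 0 \<and> 0 \<le> d z}"
    have "(\<Sum>z\<in>Z. d z * v z) \<le> (\<Sum>z\<in>Z. if v z \<noteq> 0 \<and> 0 \<le> d z then d z else 0)"
    proof (rule sum_mono)
      fix z assume "z \<in> Z"
      then show "d z * v z \<le> (if v z \<noteq> 0 \<and> 0 \<le> d z then d z else 0)"
        using v[of z] by (auto simp: mult_le_0_iff mult_left_le)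
    qed
    also have "\<dots> = sum d ?S"
      using \<open>finite Z\<close> by (simp add: sum.inter_filter)
    also have "\<dots> \<le> K" by (rule d) auto
    finally show ?thesis .
  qed
  have "(\<Sum>z\<in>Z. c z * v z) \<le> K"
    by (rule upper) (use K abs_le_D1 in blast)
  moreover have "(\<Sum>z\<in>Z. (- c z) * v z) \<le> K"
    by (rule upper) (simp only: sum_negf, use K abs_le_D2 in blast)
  ultimately show ?thesis by (simp add: sum_negf)
qed

lemma four_squares:
  fixes a b c d :: real
  shows "(a + b + c + d)\<^sup>2 \<le> 4 * (a\<^sup>2 + b\<^sup>2 + c\<^sup>2 + d\<^sup>2)"
proof -
  have "0 \<le> (a-b)\<^sup>2 + (a-c)\<^sup>2 + (a-d)\<^sup>2 + (b-c)\<^sup>2 + (b-d)\<^sup>2 + (c-d)\<^sup>2" by simp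
  then show ?thesis by (simp add: power2_eq_square algebra_simps)
qed

text \<open>\<open>ga\<close> and \<open>gr\<close> are the 0/1 indicators of
  \<open>\<Gamma>\<close> and of its subgraph \<open>G\<close>; being real functions, they can be
  mixed with \<open>p\<close> and with weights, and edges become sums over ordered pairs.
  \<open>beta_nonneg\<close> is stated separately because \<open>disc\<close> does not yield it when
  \<open>V\<close> is empty.\<close>

locale jumbled_subgraph =
  fixes V :: "'b set" and ga gr :: "'b \<Rightarrow> 'b \<Rightarrow> real" and p \<beta> :: real
  assumes finV: "finite V" and p_pos: "0 < p" and p_le: "p \<le> 1" and beta_nonneg: "0 \<le> \<beta>"
    and ga01: "\<And>x y. ga x y = 0 \<or> ga x y = 1" and ga_sym: "\<And>x y. ga x y = ga y x"
    and gr01: "\<And>x y. gr x y = 0 \<or> gr x y = 1" and gr_sym: "\<And>x y. gr x y = gr y x"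
    and gr_le_ga: "\<And>x y. gr x y \<le> ga x y"
    and disc: "\<And>X Y. X \<subseteq> V \<Longrightarrow> Y \<subseteq> V \<Longrightarrow>
      \<bar>\<Sum>x\<in>X. \<Sum>y\<in>Y. ga x y - p\<bar> \<le> \<beta> * sqrt (real (card X) * real (card Y))"
begin

lemma ga_bounds: "0 \<le> ga x y" "ga x y \<le> 1" and gr_bounds: "0 \<le> gr x y" "gr x y \<le> 1"
  using ga01[of x y] gr01[of x y] by auto

lemma fin: "X \<subseteq> V \<Longrightarrow> finite X"
  using finV finite_subset by blast

text \<open>The bound involves the support of \<open>v\<close> and not all of \<open>Z\<close>. In
  \<open>expand_error\<close> the supports are intersections of two sets, and their smallness
  provides powers of \<open>p\<close>.\<close>

lemma disc_weighted:
  assumes A: "A \<subseteq> V" and Z: "Z \<subseteq> V" and v: "\<And>z. z \<in> Z \<Longrightarrow> 0 \<le> v z \<and> v z \<le> 1"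
  shows "\<bar>\<Sum>x\<in>A. \<Sum>z\<in>Z. (ga x z - p) * v z\<bar>
    \<le> \<beta> * sqrt (real (card A) * real (card {z \<in> Z. v z \<noteq> 0}))"
proof -
  have "(\<Sum>x\<in>A. \<Sum>z\<in>Z. (ga x z - p) * v z) = (\<Sum>z\<in>Z. (\<Sum>x\<in>A. ga x z - p) * v z)"
    by (subst sum.swap) (simp add: sum_distrib_right)
  moreover have "\<bar>\<Sum>z\<in>Z. (\<Sum>x\<in>A. ga x z - p) * v z\<bar>
    \<le> \<beta> * sqrt (real (card A) * real (card {z \<in> Z. v z \<noteq> 0}))"
  proof (rule sum_weight_extreme)
    fix B assume B: "B \<subseteq> {z \<in> Z. v z \<noteq> 0}"
    have "\<bar>\<Sum>z\<in>B. \<Sum>x\<in>A. ga x z - p\<bar> = \<bar>\<Sum>x\<in>A. \<Sum>z\<in>B. ga x z - p\<bar>"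
      by (subst sum.swap) simp
    also have "\<dots> \<le> \<beta> * sqrt (real (card A) * real (card B))"
      using B Z A by (intro disc) auto
    also have "\<dots> \<le> \<beta> * sqrt (real (card A) * real (card {z \<in> Z. v z \<noteq> 0}))"
      using B fin[OF Z] beta_nonneg
      by (intro mult_left_mono real_sqrt_le_mono) (auto intro!: card_mono)
    finally show "\<bar>\<Sum>z\<in>B. \<Sum>x\<in>A. ga x z - p\<bar>
      \<le> \<beta> * sqrt (real (card A) * real (card {z \<in> Z. v z \<noteq> 0}))" .
  qed (use fin[OF Z] v in auto)
  ultimately show ?thesis by simp
qed

lemma sum_ga_minus: "(\<Sum>x\<in>X. \<Sum>y\<in>Y. ga x y - p) = (\<Sum>x\<in>X. \<Sum>y\<in>Y. ga x y) - p * real (card X) * real (card Y)"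
  by (simp add: sum_subtractf)

lemma edges_le:
  assumes "X \<subseteq> V" "Y \<subseteq> V"
  shows "(\<Sum>x\<in>X. \<Sum>y\<in>Y. ga x y) \<le> p * real (card X) * real (card Y) + \<beta> * sqrt (real (card X) * real (card Y))"
  using disc[OF assms] by (simp add: sum_ga_minus abs_le_iff)

lemma edges_le_twice:
  assumes "X \<subseteq> V" "Y \<subseteq> V" and "\<beta> \<le> p * sqrt (real (card X) * real (card Y))"
  shows "(\<Sum>x\<in>X. \<Sum>y\<in>Y. ga x y) \<le> 2 * p * real (card X) * real (card Y)"
proof -
  have "\<beta> * sqrt (real (card X) * real (card Y))
    \<le> (p * sqrt (real (card X) * real (card Y))) * sqrt (real (card X) * real (card Y))"
    by (rule mult_right_mono[OF assms(3)]) simp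
  also have "\<dots> = p * real (card X) * real (card Y)" by simp
  finally show ?thesis using edges_le[OF assms(1,2)] by simp
qed

text \<open>Jumbledness on \<open>X\<close> and \<open>Y\<close> gives
  \<open>t |X| \<le> \<beta> sqrt(|X| |Y|)\<close>; squaring and cancelling \<open>|X|\<close>
  leaves the claim. The excess \<open>t\<close> is free because the lemma serves degrees
  (\<open>t = p |Y|\<close>) as well as codegrees, where \<open>Y\<close> is itself a
  neighbourhood.\<close>

lemma excess_degree:
  assumes X: "X \<subseteq> V" and Y: "Y \<subseteq> V" and t: "0 \<le> t"
    and deg: "\<And>x. x \<in> X \<Longrightarrow> p * real (card Y) + t \<le> (\<Sum>y\<in>Y. ga x y)"
  shows "real (card X) * t\<^sup>2 \<le> \<beta>\<^sup>2 * real (card Y)"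
proof (cases "card X = 0")
  case False
  have "real (card X) * t = (\<Sum>x\<in>X. t)" by simp
  also have "\<dots> \<le> (\<Sum>x\<in>X. \<Sum>y\<in>Y. ga x y - p)"
    by (rule sum_mono) (use deg in \<open>fastforce simp: sum_subtractf mult.commute\<close>)
  also have "\<dots> \<le> \<beta> * sqrt (real (card X) * real (card Y))"
    using disc[OF X Y] by simp
  finally have "(real (card X) * t)\<^sup>2 \<le> (\<beta> * sqrt (real (card X) * real (card Y)))\<^sup>2"
    using t by (intro power_mono) auto
  then have "real (card X) * (real (card X) * t\<^sup>2) \<le> real (card X) * (\<beta>\<^sup>2 * real (card Y))"
    by (simp add: power_mult_distrib) (simp add: power2_eq_square algebra_simps)
  then show ?thesis using False by simp
qed auto

lemma high_degree_card:
  assumes X: "X \<subseteq> V" and Y: "Y \<subseteq> V"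
  shows "real (card {x \<in> X. 2 * p * real (card Y) < (\<Sum>y\<in>Y. ga x y)}) * (p\<^sup>2 * real (card Y)) \<le> \<beta>\<^sup>2"
proof (cases "card Y = 0")
  case False
  let ?B = "{x \<in> X. 2 * p * real (card Y) < (\<Sum>y\<in>Y. ga x y)}"
  have "real (card ?B) * (p * real (card Y))\<^sup>2 \<le> \<beta>\<^sup>2 * real (card Y)"
    using X p_pos by (intro excess_degree Y) auto
  then have "real (card Y) * (real (card ?B) * (p\<^sup>2 * real (card Y))) \<le> real (card Y) * \<beta>\<^sup>2"
    by (simp add: power2_eq_square algebra_simps)
  then show ?thesis using False by simp
qed auto

lemma deg_le_card: "(\<Sum>y\<in>Y. ga x y) \<le> real (card Y)" and deg_nonneg: "0 \<le> (\<Sum>y\<in>Y. ga x y)"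
  using sum_mono[of Y "ga x" "\<lambda>_. 1"] ga_bounds by (auto intro: sum_nonneg)

lemma beta_sq:
  assumes "\<beta> \<le> s * sqrt (a * b)" "0 \<le> a" "0 \<le> b"
  shows "\<beta>\<^sup>2 \<le> s\<^sup>2 * (a * b)"
proof -
  have "\<beta>\<^sup>2 \<le> (s * sqrt (a * b))\<^sup>2"
    using assms beta_nonneg by (intro power_mono) auto
  then show ?thesis using assms by (simp add: power_mult_distrib)
qed

text \<open>The count is at most \<open>\<beta>^2 / (p^2 |Y|)\<close>. For \<open>k = 2\<close> the
  exceptional fraction \<open>p^2\<close> makes up for the trivial degree bound \<open>|Y|\<close>
  in second moments; for \<open>k = 3\<close> it is \<open>p^4\<close>.\<close>

lemma high_degree_contribution:
  assumes X: "X \<subseteq> V" and Y: "Y \<subseteq> V" and b: "\<beta> \<le> s * p ^ k * sqrt (real (card X) * real (card Y))" and k: "2 \<le> k"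
  shows "real (card {x \<in> X. 2 * p * real (card Y) < (\<Sum>y\<in>Y. ga x y)}) \<le> s\<^sup>2 * p ^ (2 * k - 2) * real (card X)"
proof (cases "card Y = 0")
  case True
  then have e: "{x \<in> X. 2 * p * real (card Y) < (\<Sum>y\<in>Y. ga x y)} = {}"
    using fin[OF Y] by auto
  show ?thesis unfolding e using p_pos by simp
next
  case False
  let ?B = "{x \<in> X. 2 * p * real (card Y) < (\<Sum>y\<in>Y. ga x y)}"
  have "real (card ?B) * (p\<^sup>2 * real (card Y)) \<le> \<beta>\<^sup>2" by (rule high_degree_card[OF X Y])
  also have "\<dots> \<le> (s * p ^ k)\<^sup>2 * (real (card X) * real (card Y))"
    by (rule beta_sq[OF b]) auto
  also have "(s * p ^ k)\<^sup>2 = s\<^sup>2 * p ^ (2 * k - 2) * p\<^sup>2"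
    using le_Suc_ex[OF k] by (auto simp: power2_eq_square power_add mult_2 mult_2_right algebra_simps)
  finally have "(p\<^sup>2 * real (card Y)) * real (card ?B) \<le> (p\<^sup>2 * real (card Y)) * (s\<^sup>2 * p ^ (2 * k - 2) * real (card X))"
    by (simp add: algebra_simps)
  moreover have "0 < p\<^sup>2 * real (card Y)" using False p_pos by simp
  ultimately show ?thesis by (simp only: mult_le_cancel_left_pos)
qed

text \<open>Degrees up to \<open>2 p |Y|\<close> contribute the constant 4. The exceptional
  vertices, at most \<open>p^2 |X|\<close> many, have degree at most \<open>|Y|\<close> and
  contribute 1 more.\<close>

lemma sum_deg_sq:
  assumes X: "X \<subseteq> V" and Y: "Y \<subseteq> V" and b: "\<beta> \<le> p\<^sup>2 * sqrt (real (card X) * real (card Y))"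
  shows "(\<Sum>x\<in>X. (\<Sum>y\<in>Y. ga x y)\<^sup>2) \<le> 5 * p\<^sup>2 * real (card X) * (real (card Y))\<^sup>2"
proof -
  let ?B = "{x \<in> X. 2 * p * real (card Y) < (\<Sum>y\<in>Y. ga x y)}"
  have "(\<Sum>x\<in>X. (\<Sum>y\<in>Y. ga x y)\<^sup>2) \<le> (\<Sum>x\<in>X. (2 * p * real (card Y))\<^sup>2 + (if x \<in> ?B then (real (card Y))\<^sup>2 else 0))"
  proof (rule sum_mono)
    fix x assume "x \<in> X"
    show "(\<Sum>y\<in>Y. ga x y)\<^sup>2 \<le> (2 * p * real (card Y))\<^sup>2 + (if x \<in> ?B then (real (card Y))\<^sup>2 else 0)"
    proof (cases "x \<in> ?B")
      case True
      have "(\<Sum>y\<in>Y. ga x y)\<^sup>2 \<le> (real (card Y))\<^sup>2"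
        by (rule power_mono[OF deg_le_card deg_nonneg])
      then show ?thesis using True by (simp only: if_True add_increasing[OF zero_le_power2])
    next
      case False
      then have "(\<Sum>y\<in>Y. ga x y)\<^sup>2 \<le> (2 * p * real (card Y))\<^sup>2"
        using \<open>x \<in> X\<close> by (intro power_mono deg_nonneg) auto
      then show ?thesis using False by (simp only: if_False add_0_right)
    qed
  qed
  also have "\<dots> = 4 * p\<^sup>2 * real (card X) * (real (card Y))\<^sup>2 + real (card ?B) * (real (card Y))\<^sup>2"
    using fin[OF X] by (simp add: sum.distrib power_mult_distrib sum.If_cases Int_def conj_commute)
  also have "real (card ?B) \<le> 1\<^sup>2 * p ^ (2 * 2 - 2) * real (card X)"
    by (rule high_degree_contribution[OF X Y]) (use b in auto)
  then have "real (card ?B) * (real (card Y))\<^sup>2 \<le> (p\<^sup>2 * real (card X)) * (real (card Y))\<^sup>2"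
    by (intro mult_right_mono) auto
  finally show ?thesis by (simp add: algebra_simps)
qed

end

section \<open>Inheritance of regularity\<close>

text \<open>This is regularity in discrepancy (cut norm) form, with the error measured against the
  full sizes of \<open>X\<close> and \<open>Y\<close>; in this form it passes directly to weights in
  [0,1]. The relative density \<open>q\<close> is a parameter and not the actual density, so that a
  pair of neighbourhoods can inherit the same \<open>q\<close>.\<close>

definition disc_regular :: "('b \<Rightarrow> 'b \<Rightarrow> real) \<Rightarrow> real \<Rightarrow> real \<Rightarrow> real \<Rightarrow> 'b set \<Rightarrow> 'b set \<Rightarrow> bool" where
  "disc_regular w p \<epsilon> q X Y \<longleftrightarrow> (\<forall>A\<subseteq>X. \<forall>B\<subseteq>Y.
     \<bar>\<Sum>x\<in>A. \<Sum>y\<in>B. w x y - q * p\<bar> \<le> \<epsilon> * p * real (card X) * real (card Y))"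

lemma sum_swap3: "(\<Sum>z\<in>Z. \<Sum>y\<in>Y. \<Sum>w\<in>W. F z y w) = (\<Sum>y\<in>Y. \<Sum>w\<in>W. \<Sum>z\<in>Z. F z y w)"
  by (subst sum.swap, rule sum.cong[OF refl], rule sum.swap)

lemma sum_swap4: "(\<Sum>x\<in>X. \<Sum>z\<in>Z. \<Sum>y\<in>Y. \<Sum>w\<in>W. F x z y w) = (\<Sum>y\<in>Y. \<Sum>w\<in>W. \<Sum>x\<in>X. \<Sum>z\<in>Z. F x z y w)"
  by (subst sum_swap3[of _ W Y Z], rule sum_swap3)

lemma sum_01_mult:
  fixes u R :: "'a \<Rightarrow> real"
  assumes "finite X" and "\<And>x. x \<in> X \<Longrightarrow> u x = 0 \<or> u x = 1"
  shows "(\<Sum>x\<in>X. u x * R x) = (\<Sum>x\<in>{x \<in> X. u x = 1}. R x)"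
proof -
  have "(\<Sum>x\<in>X. u x * R x) = (\<Sum>x\<in>X. if u x = 1 then R x else 0)"
    using assms(2) by (intro sum.cong) auto
  then show ?thesis using assms(1) by (simp add: sum.inter_filter)
qed

lemma card_01:
  fixes u :: "'a \<Rightarrow> real"
  assumes "finite X" and "\<And>x. x \<in> X \<Longrightarrow> u x = 0 \<or> u x = 1"
  shows "real (card {x \<in> X. u x = 1}) = (\<Sum>x\<in>X. u x)"
  using sum_01_mult[where u = u and R = "\<lambda>_. 1", OF assms] by simp

context jumbled_subgraph
begin

lemma gr01_mult: "gr x y * gr x' y' = 0 \<or> gr x y * gr x' y' = 1"
  using gr01[of x y] gr01[of x' y'] by auto

lemma sum_gr_sq:
  assumes X: "X \<subseteq> V" and Y: "Y \<subseteq> V" and b: "\<beta> \<le> p\<^sup>2 * sqrt (real (card X) * real (card Y))"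
  shows "(\<Sum>y\<in>Y. \<Sum>y'\<in>Y. real (card {x \<in> X. gr x y * gr x y' = 1})) \<le> 5 * p\<^sup>2 * real (card X) * (real (card Y))\<^sup>2"
proof -
  have "(\<Sum>y\<in>Y. \<Sum>y'\<in>Y. real (card {x \<in> X. gr x y * gr x y' = 1})) = (\<Sum>y\<in>Y. \<Sum>y'\<in>Y. \<Sum>x\<in>X. gr x y * gr x y')"
    by (intro sum.cong refl card_01 fin[OF X] gr01_mult)
  also have "\<dots> = (\<Sum>x\<in>X. \<Sum>y\<in>Y. \<Sum>y'\<in>Y. gr x y * gr x y')"
    by (rule sum_swap3[symmetric])
  also have "\<dots> = (\<Sum>x\<in>X. (\<Sum>y\<in>Y. gr x y)\<^sup>2)"
    by (simp add: power2_eq_square sum_product)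
  also have "\<dots> \<le> (\<Sum>x\<in>X. (\<Sum>y\<in>Y. ga x y)\<^sup>2)"
    by (intro sum_mono power_mono gr_le_ga sum_nonneg gr_bounds)
  also have "\<dots> \<le> 5 * p\<^sup>2 * real (card X) * (real (card Y))\<^sup>2"
    by (rule sum_deg_sq[OF X Y b])
  finally show ?thesis .
qed

text \<open>
  For fixed \<open>y\<close>, \<open>y'\<close> the product of the two deviations is a combination of the indicators of
  \<open>N(y) \<inter> N(y')\<close>, \<open>N(y)\<close>, \<open>N(y')\<close> and \<open>X\<close>, so jumbledness applies with an error in terms of the sizes of
  these sets, which gains a factor \<open>p\<close> over the trivial bound.
\<close>

lemma expand_error:
  assumes X: "X \<subseteq> V" and Y: "Y \<subseteq> V" and Z: "Z \<subseteq> V" and q: "0 \<le> q" "q \<le> 2"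
    and b: "\<And>y z. y \<in> Y \<Longrightarrow> z \<in> Z \<Longrightarrow> 0 \<le> b y z \<and> b y z \<le> 1"
    and beta: "\<beta> \<le> p\<^sup>2 * sqrt (real (card X) * real (card Y))"
  shows "\<bar>\<Sum>x\<in>X. \<Sum>z\<in>Z. (ga x z - p) * (\<Sum>y\<in>Y. (gr x y - q * p) * b y z)\<^sup>2\<bar>
    \<le> \<beta> * (13 * p * real (card Y) * sqrt (real (card X)))
       * sqrt (\<Sum>y\<in>Y. \<Sum>y'\<in>Y. real (card {z \<in> Z. b y z * b y' z \<noteq> 0}))"
proof -
  note finX = fin[OF X] and finY = fin[OF Y] and finZ = fin[OF Z]
  define w where "w y y' = real (card {z \<in> Z. b y z * b y' z \<noteq> 0})" for y y'
  define I where "I y = {x \<in> X. gr x y = 1}" for y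
  define J where "J y y' = {x \<in> X. gr x y * gr x y' = 1}" for y y'
  define D where "D A y y' = (\<Sum>x\<in>A. \<Sum>z\<in>Z. (ga x z - p) * (b y z * b y' z))" for A y y'
  define E where "E y y' = D (J y y') y y' - q * p * D (I y) y y' - q * p * D (I y') y y' + (q * p)\<^sup>2 * D X y y'" for y y'
  define \<kappa> where "\<kappa> y y' = sqrt (real (card (J y y'))) + q * p * sqrt (real (card (I y)))
     + q * p * sqrt (real (card (I y'))) + (q * p)\<^sup>2 * sqrt (real (card X))" for y y'
  have D_le: "\<bar>D A y y'\<bar> \<le> \<beta> * sqrt (w y y') * sqrt (real (card A))"
    if "A \<subseteq> X" "y \<in> Y" "y' \<in> Y" for A y y'
  proof -
    have "\<bar>D A y y'\<bar> \<le> \<beta> * sqrt (real (card A) * w y y')"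
      unfolding D_def w_def using that X Z b by (intro disc_weighted) (auto intro: mult_le_one)
    then show ?thesis by (simp add: real_sqrt_mult ac_simps)
  qed
  have E_le: "\<bar>E y y'\<bar> \<le> \<beta> * (sqrt (w y y') * \<kappa> y y')" if "y \<in> Y" "y' \<in> Y" for y y'
  proof -
    let ?s = "\<beta> * sqrt (w y y')"
    have qp: "0 \<le> q * p" using q p_pos by simp
    have "\<bar>E y y'\<bar> \<le> \<bar>D (J y y') y y'\<bar> + \<bar>q * p * D (I y) y y'\<bar> + \<bar>q * p * D (I y') y y'\<bar> + \<bar>(q * p)\<^sup>2 * D X y y'\<bar>"
      unfolding E_def by linarith
    also have "\<dots> = \<bar>D (J y y') y y'\<bar> + q * p * \<bar>D (I y) y y'\<bar> + q * p * \<bar>D (I y') y y'\<bar> + (q * p)\<^sup>2 * \<bar>D X y y'\<bar>"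
      using qp q p_pos by (simp add: abs_mult)
    also have "\<dots> \<le> ?s * sqrt (real (card (J y y'))) + q * p * (?s * sqrt (real (card (I y))))
        + q * p * (?s * sqrt (real (card (I y')))) + (q * p)\<^sup>2 * (?s * sqrt (real (card X)))"
      using qp by (intro add_mono mult_left_mono D_le that) (auto simp: I_def J_def)
    also have "\<dots> = \<beta> * (sqrt (w y y') * \<kappa> y y')"
      by (simp add: \<kappa>_def algebra_simps)
    finally show ?thesis .
  qed
  have E_eq: "(\<Sum>x\<in>X. \<Sum>z\<in>Z. (ga x z - p) * ((gr x y - q * p) * b y z * ((gr x y' - q * p) * b y' z))) = E y y'"
    (is "?L = _") for y y'
  proof -
    define R where "R x = (\<Sum>z\<in>Z. (ga x z - p) * (b y z * b y' z))" for x
    have "?L = (\<Sum>x\<in>X. ((gr x y - q * p) * (gr x y' - q * p)) * R x)"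
      unfolding R_def sum_distrib_left by (simp add: mult_ac)
    also have "\<dots> = (\<Sum>x\<in>X. (gr x y * gr x y') * R x) - q * p * (\<Sum>x\<in>X. gr x y * R x)
        - q * p * (\<Sum>x\<in>X. gr x y' * R x) + (q * p)\<^sup>2 * (\<Sum>x\<in>X. R x)"
      unfolding sum_distrib_left sum_subtractf[symmetric] sum.distrib[symmetric]
      by (intro sum.cong refl) (simp add: power2_eq_square algebra_simps)
    also have "(\<Sum>x\<in>X. (gr x y * gr x y') * R x) = D (J y y') y y'"
      unfolding J_def D_def R_def[symmetric]
      by (rule sum_01_mult[OF finX gr01_mult])
    also have "(\<Sum>x\<in>X. gr x y * R x) = D (I y) y y'"
      unfolding I_def D_def R_def[symmetric] by (rule sum_01_mult[OF finX gr01])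
    also have "(\<Sum>x\<in>X. gr x y' * R x) = D (I y') y y'"
      unfolding I_def D_def R_def[symmetric] by (rule sum_01_mult[OF finX gr01])
    also have "(\<Sum>x\<in>X. R x) = D X y y'"
      by (simp add: D_def R_def)
    finally show ?thesis by (simp add: E_def)
  qed
  have "(\<Sum>x\<in>X. \<Sum>z\<in>Z. (ga x z - p) * (\<Sum>y\<in>Y. (gr x y - q * p) * b y z)\<^sup>2)
      = (\<Sum>y\<in>Y. \<Sum>y'\<in>Y. E y y')"
  proof -
    have "(\<Sum>x\<in>X. \<Sum>z\<in>Z. (ga x z - p) * (\<Sum>y\<in>Y. (gr x y - q * p) * b y z)\<^sup>2)
      = (\<Sum>x\<in>X. \<Sum>z\<in>Z. (ga x z - p) * (\<Sum>y\<in>Y. \<Sum>y'\<in>Y. (gr x y - q * p) * b y z * ((gr x y' - q * p) * b y' z)))"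
      by (simp only: power2_eq_square sum_product)
    then show ?thesis
      unfolding E_eq[symmetric] sum_distrib_left sum_swap4[of _ Y Y Z X] .
  qed
  then have "\<bar>\<Sum>x\<in>X. \<Sum>z\<in>Z. (ga x z - p) * (\<Sum>y\<in>Y. (gr x y - q * p) * b y z)\<^sup>2\<bar>
      \<le> (\<Sum>y\<in>Y. \<Sum>y'\<in>Y. \<bar>E y y'\<bar>)"
    by (auto intro!: order_trans[OF sum_abs] sum_mono)
  also have "\<dots> \<le> (\<Sum>y\<in>Y. \<Sum>y'\<in>Y. \<beta> * (sqrt (w y y') * \<kappa> y y'))"
    by (intro sum_mono E_le)
  also have "\<dots> = \<beta> * (\<Sum>u\<in>Y \<times> Y. sqrt (case_prod w u) * case_prod \<kappa> u)"
    by (simp add: sum.cartesian_product sum_distrib_left split_def)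
  \<comment> \<open>Cauchy-Schwarz over pairs \<open>(y,y')\<close> separates the supports of the
    weights from the neighbourhood sizes, so that each family can be summed on its own.\<close>
  also have "\<dots> \<le> \<beta> * sqrt ((\<Sum>u\<in>Y \<times> Y. (sqrt (case_prod w u))\<^sup>2) * (\<Sum>u\<in>Y \<times> Y. (case_prod \<kappa> u)\<^sup>2))"
    by (intro mult_left_mono beta_nonneg real_le_rsqrt Cauchy_Schwarz_ineq_sum)
  also have "(\<Sum>u\<in>Y \<times> Y. (sqrt (case_prod w u))\<^sup>2) = (\<Sum>y\<in>Y. \<Sum>y'\<in>Y. w y y')"
    by (simp add: sum.cartesian_product split_def w_def)
  also have "(\<Sum>u\<in>Y \<times> Y. (case_prod \<kappa> u)\<^sup>2) = (\<Sum>y\<in>Y. \<Sum>y'\<in>Y. (\<kappa> y y')\<^sup>2)"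
    by (simp add: sum.cartesian_product split_def)
  finally have main: "\<bar>\<Sum>x\<in>X. \<Sum>z\<in>Z. (ga x z - p) * (\<Sum>y\<in>Y. (gr x y - q * p) * b y z)\<^sup>2\<bar> \<le> \<beta> * sqrt ((\<Sum>y\<in>Y. \<Sum>y'\<in>Y. w y y') * (\<Sum>y\<in>Y. \<Sum>y'\<in>Y. (\<kappa> y y')\<^sup>2))" .
  have kappa: "(\<Sum>y\<in>Y. \<Sum>y'\<in>Y. (\<kappa> y y')\<^sup>2) \<le> 169 * p\<^sup>2 * real (card X) * (real (card Y))\<^sup>2"
  proof -
    have qp2: "(q * p)\<^sup>2 \<le> 4 * p\<^sup>2"
      using q power_mono[of q 2 2] unfolding power_mult_distrib by (intro mult_right_mono) auto
    have p2: "p\<^sup>2 \<le> 1" using p_pos p_le by (simp add: power_le_one)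
    have qp4: "((q * p)\<^sup>2)\<^sup>2 \<le> 16 * p\<^sup>2"
    proof -
      have "((q * p)\<^sup>2)\<^sup>2 \<le> (4 * p\<^sup>2)\<^sup>2" by (rule power_mono[OF qp2]) simp
      also have "\<dots> = 16 * p\<^sup>2 * p\<^sup>2" by (simp add: power2_eq_square)
      also have "\<dots> \<le> 16 * p\<^sup>2 * 1" using p2 by (intro mult_left_mono) auto
      finally show ?thesis by simp
    qed
    have "(\<Sum>y\<in>Y. \<Sum>y'\<in>Y. (\<kappa> y y')\<^sup>2) \<le> (\<Sum>y\<in>Y. \<Sum>y'\<in>Y. 4 * (real (card (J y y'))
        + 4 * p\<^sup>2 * real (card (I y)) + 4 * p\<^sup>2 * real (card (I y')) + 16 * p\<^sup>2 * real (card X)))"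
    proof (intro sum_mono)
      fix y y'
      have "(\<kappa> y y')\<^sup>2 \<le> 4 * (real (card (J y y')) + (q * p)\<^sup>2 * real (card (I y))
          + (q * p)\<^sup>2 * real (card (I y')) + ((q * p)\<^sup>2)\<^sup>2 * real (card X))"
        unfolding \<kappa>_def using four_squares[of "sqrt (real (card (J y y')))" "q * p * sqrt (real (card (I y)))"
          "q * p * sqrt (real (card (I y')))" "(q * p)\<^sup>2 * sqrt (real (card X))"]
        by (simp only: power_mult_distrib[of _ "sqrt _"] real_sqrt_pow2 of_nat_0_le_iff)
      also have "\<dots> \<le> 4 * (real (card (J y y')) + 4 * p\<^sup>2 * real (card (I y))
          + 4 * p\<^sup>2 * real (card (I y')) + 16 * p\<^sup>2 * real (card X))"
        using qp2 qp4 by (intro mult_left_mono add_mono mult_right_mono) auto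
      finally show "(\<kappa> y y')\<^sup>2 \<le> 4 * (real (card (J y y')) + 4 * p\<^sup>2 * real (card (I y))
          + 4 * p\<^sup>2 * real (card (I y')) + 16 * p\<^sup>2 * real (card X))" .
    qed
    also have "\<dots> = 4 * (\<Sum>y\<in>Y. \<Sum>y'\<in>Y. real (card (J y y'))) + 32 * p\<^sup>2 * real (card Y) * (\<Sum>y\<in>Y. real (card (I y)))
        + 64 * p\<^sup>2 * real (card X) * (real (card Y))\<^sup>2"
      by (simp add: sum.distrib algebra_simps power2_eq_square flip: sum_distrib_left sum_distrib_right)
    finally have "(\<Sum>y\<in>Y. \<Sum>y'\<in>Y. (\<kappa> y y')\<^sup>2) \<le> 4 * (\<Sum>y\<in>Y. \<Sum>y'\<in>Y. real (card (J y y'))) + 32 * p\<^sup>2 * real (card Y) * (\<Sum>y\<in>Y. real (card (I y)))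
        + 64 * p\<^sup>2 * real (card X) * (real (card Y))\<^sup>2" .
    moreover have "(\<Sum>y\<in>Y. \<Sum>y'\<in>Y. real (card (J y y'))) \<le> 5 * p\<^sup>2 * real (card X) * (real (card Y))\<^sup>2"
      unfolding J_def by (rule sum_gr_sq[OF X Y beta])
    moreover have "p\<^sup>2 * real (card Y) * (\<Sum>y\<in>Y. real (card (I y))) \<le> p\<^sup>2 * real (card Y) * (real (card X) * real (card Y))"
    proof (rule mult_left_mono)
      have "(\<Sum>y\<in>Y. real (card (I y))) \<le> (\<Sum>y\<in>Y. real (card X))"
        by (intro sum_mono) (auto simp: I_def intro!: card_mono finX)
      then show "(\<Sum>y\<in>Y. real (card (I y))) \<le> real (card X) * real (card Y)" by (simp add: mult.commute)
    qed simp
    \<comment> \<open>Here 116 is 4 * 5 + 32 + 64; it is then rounded up to 169, the square of 13,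
      to have an integer root.\<close>
    ultimately have "(\<Sum>y\<in>Y. \<Sum>y'\<in>Y. (\<kappa> y y')\<^sup>2) \<le> 116 * (p\<^sup>2 * real (card X) * (real (card Y))\<^sup>2)"
      by (simp add: power2_eq_square algebra_simps)
    also have "\<dots> \<le> 169 * (p\<^sup>2 * real (card X) * (real (card Y))\<^sup>2)"
      by (intro mult_right_mono) auto
    finally show ?thesis by simp
  qed
  have w_nonneg: "0 \<le> (\<Sum>y\<in>Y. \<Sum>y'\<in>Y. w y y')"
    by (intro sum_nonneg) (simp add: w_def)
  have "sqrt ((\<Sum>y\<in>Y. \<Sum>y'\<in>Y. w y y') * (\<Sum>y\<in>Y. \<Sum>y'\<in>Y. (\<kappa> y y')\<^sup>2))
     \<le> sqrt ((\<Sum>y\<in>Y. \<Sum>y'\<in>Y. w y y') * (169 * p\<^sup>2 * real (card X) * (real (card Y))\<^sup>2))"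
    by (intro real_sqrt_le_mono mult_left_mono kappa w_nonneg)
  also have "\<dots> = 13 * p * real (card Y) * sqrt (real (card X)) * sqrt (\<Sum>y\<in>Y. \<Sum>y'\<in>Y. w y y')"
  proof -
    have "sqrt 169 = 13" by (rule real_sqrt_unique) auto
    then show ?thesis using p_pos by (simp add: real_sqrt_mult)
  qed
  finally show ?thesis
    using main beta_nonneg unfolding w_def[symmetric]
    by (smt (verit) mult.assoc mult_left_mono)
qed

end

section \<open>Weighted deviation sums\<close>

lemma sum_if_mem:
  "finite X \<Longrightarrow> B \<subseteq> X \<Longrightarrow> (\<Sum>x\<in>X. if x \<in> B then c else 0) = real (card B) * c"
  by (simp add: sum.If_cases Int_absorb1)

context jumbled_subgraph
begin

lemma beta_weaken:
  assumes "\<beta> \<le> \<sigma> * p ^ 3 * sqrt a" "0 \<le> \<sigma>" "\<sigma> \<le> 1" "k \<le> 3" "0 \<le> a"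
  shows "\<beta> \<le> p ^ k * sqrt a"
proof -
  have "\<sigma> * p ^ 3 \<le> 1 * p ^ k"
    using assms p_pos p_le by (intro mult_mono power_decreasing) auto
  then have "\<sigma> * p ^ 3 * sqrt a \<le> 1 * p ^ k * sqrt a"
    using assms(5) by (intro mult_right_mono) auto
  then show ?thesis using assms(1) by simp
qed

text \<open>As \<open>ga\<close> is idempotent, it can be placed in both factors. The first factor
  is then the number of edges of \<open>\<Gamma>\<close>, which saves a power of \<open>p\<close>
  over unweighted Cauchy-Schwarz.\<close>

lemma Cauchy_ga:
  "(\<Sum>x\<in>X. \<Sum>z\<in>Z. ga x z * \<bar>T x z\<bar>)\<^sup>2 \<le> (\<Sum>x\<in>X. \<Sum>z\<in>Z. ga x z) * (\<Sum>x\<in>X. \<Sum>z\<in>Z. ga x z * (T x z)\<^sup>2)"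
proof -
  have sq: "ga x z * ga x z = ga x z" for x z using ga01[of x z] by auto
  have "(\<Sum>x\<in>X. \<Sum>z\<in>Z. ga x z * \<bar>T x z\<bar>)\<^sup>2 = (\<Sum>u\<in>X \<times> Z. case_prod ga u * (case_prod ga u * \<bar>case_prod T u\<bar>))\<^sup>2"
    by (simp add: sum.cartesian_product split_def sq flip: mult.assoc)
  also have "\<dots> \<le> (\<Sum>u\<in>X \<times> Z. (case_prod ga u)\<^sup>2) * (\<Sum>u\<in>X \<times> Z. (case_prod ga u * \<bar>case_prod T u\<bar>)\<^sup>2)"
    by (rule Cauchy_Schwarz_ineq_sum)
  also have "\<dots> = (\<Sum>x\<in>X. \<Sum>z\<in>Z. ga x z) * (\<Sum>x\<in>X. \<Sum>z\<in>Z. ga x z * (T x z)\<^sup>2)"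
    by (simp add: sum.cartesian_product split_def power_mult_distrib) (simp add: power2_eq_square sq)
  finally show ?thesis .
qed

lemma sum_ga_T_sq:
  fixes T :: "'b \<Rightarrow> 'b \<Rightarrow> real"
  shows "(\<Sum>x\<in>X. \<Sum>z\<in>Z. ga x z * (T x z)\<^sup>2)
    = p * (\<Sum>x\<in>X. \<Sum>z\<in>Z. (T x z)\<^sup>2) + (\<Sum>x\<in>X. \<Sum>z\<in>Z. (ga x z - p) * (T x z)\<^sup>2)"
  unfolding sum_distrib_left sum.distrib[symmetric] by (simp add: algebra_simps)

lemma dev_bounds:
  assumes q: "0 \<le> q" "q \<le> 2"
  shows "\<bar>gr x y - q * p\<bar> \<le> ga x y + 2 * p" "\<bar>gr x y - q * p\<bar> \<le> 2"
proof -
  have "0 \<le> q * p" using q p_pos by simp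
  moreover have "q * p \<le> 2 * p" using q p_pos by (intro mult_right_mono) auto
  ultimately show "\<bar>gr x y - q * p\<bar> \<le> ga x y + 2 * p" "\<bar>gr x y - q * p\<bar> \<le> 2"
    using gr_bounds[of x y] gr_le_ga[of x y] p_pos p_le by linarith+
qed

text \<open>For each \<open>z\<close>, split \<open>X\<close> by the sign of the inner sum and
  regard \<open>b\<close> as a weight on \<open>Y\<close>: regularity bounds each half, whence the
  factor 2. This is the only place where regularity of the pair is used up; the later sums are
  reduced to this one.\<close>

lemma weighted_dev_sum:
  assumes X: "X \<subseteq> V" and Y: "Y \<subseteq> V"
    and b: "\<And>y z. y \<in> Y \<Longrightarrow> z \<in> Z \<Longrightarrow> 0 \<le> b y z \<and> b y z \<le> 1"
    and reg: "disc_regular gr p \<epsilon> q X Y"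
  shows "(\<Sum>x\<in>X. \<Sum>z\<in>Z. \<bar>\<Sum>y\<in>Y. (gr x y - q * p) * b y z\<bar>) \<le> 2 * \<epsilon> * p * real (card X) * real (card Y) * real (card Z)"
proof -
  define T where "T x z = (\<Sum>y\<in>Y. (gr x y - q * p) * b y z)" for x z
  have half: "\<bar>\<Sum>x\<in>A. T x z\<bar> \<le> \<epsilon> * p * real (card X) * real (card Y)" if "A \<subseteq> X" "z \<in> Z" for A z
  proof -
    have "(\<Sum>x\<in>A. T x z) = (\<Sum>y\<in>Y. (\<Sum>x\<in>A. gr x y - q * p) * b y z)"
      unfolding T_def by (subst sum.swap) (simp add: sum_distrib_right)
    moreover have "\<bar>\<Sum>y\<in>Y. (\<Sum>x\<in>A. gr x y - q * p) * b y z\<bar> \<le> \<epsilon> * p * real (card X) * real (card Y)"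
    proof (rule sum_weight_extreme)
      fix B assume "B \<subseteq> {y \<in> Y. b y z \<noteq> 0}"
      then have "B \<subseteq> Y" by auto
      then show "\<bar>\<Sum>y\<in>B. \<Sum>x\<in>A. gr x y - q * p\<bar> \<le> \<epsilon> * p * real (card X) * real (card Y)"
        using reg that(1) unfolding disc_regular_def by (subst sum.swap) blast
    qed (use fin[OF Y] b that in auto)
    ultimately show ?thesis by simp
  qed
  have "(\<Sum>x\<in>X. \<bar>T x z\<bar>) \<le> 2 * (\<epsilon> * p * real (card X) * real (card Y))" if z: "z \<in> Z" for z
  proof -
    have "(\<Sum>x\<in>X. \<bar>T x z\<bar>) = (\<Sum>x\<in>X. if 0 \<le> T x z then T x z else 0) - (\<Sum>x\<in>X. if \<not> 0 \<le> T x z then T x z else 0)"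
      unfolding sum_subtractf[symmetric] by (intro sum.cong) auto
    also have "\<dots> = (\<Sum>x\<in>{x \<in> X. 0 \<le> T x z}. T x z) - (\<Sum>x\<in>{x \<in> X. \<not> 0 \<le> T x z}. T x z)"
      by (simp only: sum.inter_filter[OF fin[OF X]])
    finally show ?thesis
      using half[of "{x \<in> X. 0 \<le> T x z}" z] half[of "{x \<in> X. \<not> 0 \<le> T x z}" z] z by auto
  qed
  then have "(\<Sum>z\<in>Z. \<Sum>x\<in>X. \<bar>T x z\<bar>) \<le> (\<Sum>z\<in>Z. 2 * (\<epsilon> * p * real (card X) * real (card Y)))"
    by (rule sum_mono)
  then show ?thesis
    unfolding T_def[symmetric] by (subst sum.swap) (simp add: mult_ac)
qed

text \<open>By \<open>Cauchy_ga\<close> it suffices to bound the \<open>ga\<close>-weighted second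
  moment of the inner sum \<open>T\<close> by a small multiple of \<open>p^3 |X| |Y|^2 |Z|\<close>.
  Jumbledness replaces \<open>ga\<close> by \<open>p\<close>, and a bound on \<open>|T|\<close> of
  order \<open>p |Y|\<close>, valid for most \<open>x\<close>, reduces the second moment to the
  first.\<close>

lemma weighted_dev_ga_sum:
  assumes X: "X \<subseteq> V" and Y: "Y \<subseteq> V" and Z: "Z \<subseteq> V" and q: "0 \<le> q" "q \<le> 2"
    and b: "\<And>y z. y \<in> Y \<Longrightarrow> z \<in> Z \<Longrightarrow> 0 \<le> b y z \<and> b y z \<le> 1"
    and reg: "disc_regular gr p \<epsilon> q X Y" and eps: "0 \<le> \<epsilon>" and sg: "0 \<le> \<sigma>" "\<sigma> \<le> 1"
    and bXY: "\<beta> \<le> \<sigma> * p ^ 3 * sqrt (real (card X) * real (card Y))"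
    and bXZ: "\<beta> \<le> \<sigma> * p ^ 3 * sqrt (real (card X) * real (card Z))"
  shows "(\<Sum>x\<in>X. \<Sum>z\<in>Z. ga x z * \<bar>\<Sum>y\<in>Y. (gr x y - q * p) * b y z\<bar>)
    \<le> sqrt (16 * \<epsilon> + 34 * \<sigma>) * p\<^sup>2 * real (card X) * real (card Y) * real (card Z)"
proof -
  define T where "T x z = (\<Sum>y\<in>Y. (gr x y - q * p) * b y z)" for x z
  define cX where "cX = real (card X)"
  define cY where "cY = real (card Y)"
  define cZ where "cZ = real (card Z)"
  note c_defs = cX_def[symmetric] cY_def[symmetric] cZ_def[symmetric]
  have c0: "0 \<le> cX" "0 \<le> cY" "0 \<le> cZ" by (auto simp: cX_def cY_def cZ_def)
  note finX = fin[OF X] and finY = fin[OF Y] and finZ = fin[OF Z]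
  let ?B = "{x \<in> X. 2 * p * real (card Y) < (\<Sum>y\<in>Y. ga x y)}"
  have sg2: "\<sigma>\<^sup>2 \<le> \<sigma>" using sg by (simp add: power2_eq_square mult_left_le)
  have s1: "(\<Sum>x\<in>X. \<Sum>z\<in>Z. ga x z) \<le> 2 * p * cX * cZ"
    unfolding cX_def cZ_def using beta_weaken[OF bXZ sg, of 1] by (intro edges_le_twice X Z) simp
  have T_le: "\<bar>T x z\<bar> \<le> (\<Sum>y\<in>Y. \<bar>gr x y - q * p\<bar>)" if "z \<in> Z" for x z
    unfolding T_def using b that
    by (intro order_trans[OF sum_abs] sum_mono) (auto simp: abs_mult mult_left_le)
  \<comment> \<open>One factor of the square is estimated by \<open>4 p |Y|\<close>, the other is
    kept for \<open>weighted_dev_sum\<close>. The crude alternative \<open>4 |Y|^2\<close> is used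
    only on the rare \<open>x\<close> of high degree.\<close>
  have T_sq: "(T x z)\<^sup>2 \<le> 4 * p * cY * \<bar>T x z\<bar> + (if x \<in> ?B then 4 * cY\<^sup>2 else 0)" if "x \<in> X" "z \<in> Z" for x z
  proof (cases "x \<in> ?B")
    case True
    have "\<bar>T x z\<bar> \<le> (\<Sum>y\<in>Y. 2)"
      by (intro order_trans[OF T_le[OF that(2)]] sum_mono dev_bounds q)
    then have "\<bar>T x z\<bar>\<^sup>2 \<le> (2 * cY)\<^sup>2"
      by (intro power_mono) (auto simp: cY_def)
    then have "(T x z)\<^sup>2 \<le> 4 * cY\<^sup>2" by (simp add: power_mult_distrib)
    moreover have "0 \<le> 4 * p * cY * \<bar>T x z\<bar>" using p_pos c0 by simp
    ultimately show ?thesis using True by (simp only: if_True add_increasing)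
  next
    case False
    have "\<bar>T x z\<bar> \<le> (\<Sum>y\<in>Y. ga x y + 2 * p)"
      by (intro order_trans[OF T_le[OF that(2)]] sum_mono dev_bounds q)
    also have "\<dots> \<le> 4 * p * cY" using False that by (simp add: sum.distrib cY_def)
    finally have "\<bar>T x z\<bar> * \<bar>T x z\<bar> \<le> 4 * p * cY * \<bar>T x z\<bar>" by (rule mult_right_mono) simp
    then show ?thesis using False by (simp only: if_False) (simp add: power2_eq_square)
  qed
  have cardB: "real (card ?B) \<le> \<sigma> * p\<^sup>2 * cX"
  proof -
    have "real (card ?B) \<le> \<sigma>\<^sup>2 * p ^ (2 * 3 - 2) * real (card X)"
      by (rule high_degree_contribution[OF X Y bXY]) simp
    also have "\<dots> \<le> \<sigma> * p\<^sup>2 * real (card X)"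
      using sg2 sg p_pos p_le by (intro mult_right_mono mult_mono power_decreasing) auto
    finally show ?thesis by (simp add: cX_def)
  qed
  have "(\<Sum>x\<in>X. \<Sum>z\<in>Z. (T x z)\<^sup>2) \<le> (\<Sum>x\<in>X. \<Sum>z\<in>Z. 4 * p * cY * \<bar>T x z\<bar> + (if x \<in> ?B then 4 * cY\<^sup>2 else 0))"
    by (intro sum_mono T_sq)
  also have "\<dots> = 4 * p * cY * (\<Sum>x\<in>X. \<Sum>z\<in>Z. \<bar>T x z\<bar>) + real (card ?B) * (4 * cY\<^sup>2 * cZ)"
  proof -
    have "(\<Sum>x\<in>X. \<Sum>z\<in>Z. if x \<in> ?B then 4 * cY\<^sup>2 else 0) = (\<Sum>x\<in>X. if x \<in> ?B then 4 * cY\<^sup>2 * cZ else 0)"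
      by (intro sum.cong refl) (simp add: cZ_def)
    also have "\<dots> = real (card ?B) * (4 * cY\<^sup>2 * cZ)"
      by (rule sum_if_mem) (use finX in auto)
    finally show ?thesis by (simp only: sum.distrib sum_distrib_left)
  qed
  also have "\<dots> \<le> 4 * p * cY * (2 * \<epsilon> * p * cX * cY * cZ) + (\<sigma> * p\<^sup>2 * cX) * (4 * cY\<^sup>2 * cZ)"
    using weighted_dev_sum[where Z = Z and b = b, OF X Y b reg] cardB p_pos c0 unfolding T_def c_defs
    by (intro add_mono mult_left_mono mult_right_mono) auto
  also have "\<dots> = (8 * \<epsilon> + 4 * \<sigma>) * p\<^sup>2 * cX * cY\<^sup>2 * cZ"
    by (simp add: power2_eq_square algebra_simps)
  finally have "p * (\<Sum>x\<in>X. \<Sum>z\<in>Z. (T x z)\<^sup>2) \<le> p * ((8 * \<epsilon> + 4 * \<sigma>) * p\<^sup>2 * cX * cY\<^sup>2 * cZ)"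
    using p_pos by (intro mult_left_mono) auto
  then have s2: "p * (\<Sum>x\<in>X. \<Sum>z\<in>Z. (T x z)\<^sup>2) \<le> (8 * \<epsilon> + 4 * \<sigma>) * p ^ 3 * cX * cY\<^sup>2 * cZ"
    by (simp add: numeral_eq_Suc mult_ac)
  have s3: "(\<Sum>x\<in>X. \<Sum>z\<in>Z. (ga x z - p) * (T x z)\<^sup>2) \<le> 13 * \<sigma> * p ^ 3 * cX * cY\<^sup>2 * cZ"
  proof -
    \<comment> \<open>The trivial estimate of the supports suffices: the resulting error has order
      \<open>p^4\<close>, one power more than needed. In the two-sided version there is no such
      slack.\<close>
    have w: "(\<Sum>y\<in>Y. \<Sum>y'\<in>Y. real (card {z \<in> Z. b y z * b y' z \<noteq> 0})) \<le> cY\<^sup>2 * cZ"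
    proof -
      have "(\<Sum>y\<in>Y. \<Sum>y'\<in>Y. real (card {z \<in> Z. b y z * b y' z \<noteq> 0})) \<le> (\<Sum>y\<in>Y. \<Sum>y'\<in>Y. cZ)"
        unfolding cZ_def by (intro sum_mono) (auto intro!: card_mono finZ)
      then show ?thesis by (simp add: cY_def power2_eq_square)
    qed
    have "(\<Sum>x\<in>X. \<Sum>z\<in>Z. (ga x z - p) * (T x z)\<^sup>2) \<le> \<beta> * (13 * p * cY * sqrt cX)
       * sqrt (\<Sum>y\<in>Y. \<Sum>y'\<in>Y. real (card {z \<in> Z. b y z * b y' z \<noteq> 0}))"
      unfolding T_def cX_def cY_def
      using expand_error[OF X Y Z q b] beta_weaken[OF bXY sg, of 2] by (auto simp: abs_le_iff)
    also have "\<dots> \<le> \<beta> * (13 * p * cY * sqrt cX) * sqrt (cY\<^sup>2 * cZ)"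
      using p_pos beta_nonneg c0 w by (intro mult_left_mono real_sqrt_le_mono) auto
    also have "\<dots> = \<beta> * (13 * p * cY\<^sup>2 * sqrt (cX * cZ))"
      using c0 by (simp add: real_sqrt_mult power2_eq_square)
    also have "\<dots> \<le> (\<sigma> * p ^ 3 * sqrt (cX * cZ)) * (13 * p * cY\<^sup>2 * sqrt (cX * cZ))"
      using bXZ p_pos c0 unfolding c_defs by (intro mult_right_mono) auto
    also have "\<dots> = 13 * \<sigma> * p ^ 4 * cX * cY\<^sup>2 * cZ"
    proof -
      have "sqrt (cX * cZ) * sqrt (cX * cZ) = cX * cZ" using c0 by simp
      then show ?thesis by (simp add: power4_eq_xxxx power3_eq_cube mult_ac)
    qed
    also have "\<dots> \<le> 13 * \<sigma> * p ^ 3 * cX * cY\<^sup>2 * cZ"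
      using p_pos p_le c0 sg by (intro mult_right_mono mult_left_mono power_decreasing) auto
    finally show ?thesis .
  qed
  have s4: "(\<Sum>x\<in>X. \<Sum>z\<in>Z. ga x z * (T x z)\<^sup>2) \<le> (8 * \<epsilon> + 17 * \<sigma>) * p ^ 3 * cX * cY\<^sup>2 * cZ"
    unfolding sum_ga_T_sq using s2 s3 by (simp add: algebra_simps)
  have "(\<Sum>x\<in>X. \<Sum>z\<in>Z. ga x z * \<bar>T x z\<bar>)\<^sup>2 \<le> (\<Sum>x\<in>X. \<Sum>z\<in>Z. ga x z) * (\<Sum>x\<in>X. \<Sum>z\<in>Z. ga x z * (T x z)\<^sup>2)"
    by (rule Cauchy_ga)
  also have "\<dots> \<le> (2 * p * cX * cZ) * ((8 * \<epsilon> + 17 * \<sigma>) * p ^ 3 * cX * cY\<^sup>2 * cZ)"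
    using p_pos c0 by (intro mult_mono s1 s4) (auto intro!: sum_nonneg mult_nonneg_nonneg ga_bounds)
  also have "\<dots> = (16 * \<epsilon> + 34 * \<sigma>) * (p\<^sup>2 * cX * cY * cZ)\<^sup>2"
    by (simp add: power2_eq_square power3_eq_cube algebra_simps)
  finally have "(\<Sum>x\<in>X. \<Sum>z\<in>Z. ga x z * \<bar>T x z\<bar>) \<le> sqrt ((16 * \<epsilon> + 34 * \<sigma>) * (p\<^sup>2 * cX * cY * cZ)\<^sup>2)"
    by (rule real_le_rsqrt)
  also have "\<dots> = sqrt (16 * \<epsilon> + 34 * \<sigma>) * (p\<^sup>2 * cX * cY * cZ)"
    using c0 by (simp add: real_sqrt_mult)
  finally show ?thesis unfolding T_def c_defs by (simp add: mult_ac)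
qed


text \<open>\<open>excess_degree\<close> is applied to the neighbourhood of \<open>y\<close> in
  \<open>Z\<close>. It has at most \<open>2 p |Z|\<close> elements, so the expected codegree is at
  most \<open>2 p^2 |Z|\<close>, and a codegree above \<open>4 p^2 |Z|\<close> is an excess of at
  least \<open>2 p^2 |Z|\<close>.\<close>

lemma high_codegree_card:
  assumes Y: "Y \<subseteq> V" and Z: "Z \<subseteq> V"
    and bYZ: "\<beta> \<le> \<sigma> * p ^ 3 * sqrt (real (card Y) * real (card Z))"
    and deg: "(\<Sum>z\<in>Z. ga y z) \<le> 2 * p * real (card Z)"
  shows "2 * real (card {y' \<in> Y. 4 * p\<^sup>2 * real (card Z) < (\<Sum>z\<in>Z. ga y z * ga y' z)}) \<le> \<sigma>\<^sup>2 * p ^ 3 * real (card Y)"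
proof (cases "card Z = 0")
  case True
  then have e: "{y' \<in> Y. 4 * p\<^sup>2 * real (card Z) < (\<Sum>z\<in>Z. ga y z * ga y' z)} = {}"
    using fin[OF Z] by auto
  show ?thesis unfolding e using p_pos by simp
next
  case False
  let ?C = "{y' \<in> Y. 4 * p\<^sup>2 * real (card Z) < (\<Sum>z\<in>Z. ga y z * ga y' z)}"
  let ?N = "{z \<in> Z. ga y z = 1}"
  have N: "real (card ?N) \<le> 2 * p * real (card Z)"
    using card_01[where u = "ga y", OF fin[OF Z] ga01] deg by simp
  have "real (card ?C) * (2 * p\<^sup>2 * real (card Z))\<^sup>2 \<le> \<beta>\<^sup>2 * real (card ?N)"
  proof (rule excess_degree)
    fix y' assume "y' \<in> ?C"
    have "(\<Sum>z\<in>Z. ga y z * ga y' z) = (\<Sum>z\<in>?N. ga y' z)"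
      by (rule sum_01_mult[OF fin[OF Z] ga01])
    moreover have "p * real (card ?N) \<le> p * (2 * p * real (card Z))"
      using N p_pos by (intro mult_left_mono) auto
    ultimately show "p * real (card ?N) + 2 * p\<^sup>2 * real (card Z) \<le> (\<Sum>z\<in>?N. ga y' z)"
      using \<open>y' \<in> ?C\<close> by (simp add: power2_eq_square)
  qed (use Y Z p_pos in auto)
  also have "\<dots> \<le> \<beta>\<^sup>2 * (2 * p * real (card Z))"
    by (rule mult_left_mono[OF N]) simp
  also have "\<dots> \<le> ((\<sigma> * p ^ 3)\<^sup>2 * (real (card Y) * real (card Z))) * (2 * p * real (card Z))"
    using p_pos by (intro mult_right_mono beta_sq[OF bYZ]) auto
  finally have "(2 * p ^ 4 * (real (card Z))\<^sup>2) * (2 * real (card ?C)) \<le> (2 * p ^ 4 * (real (card Z))\<^sup>2) * (\<sigma>\<^sup>2 * p ^ 3 * real (card Y))"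
    by (simp add: power2_eq_square power3_eq_cube power4_eq_xxxx algebra_simps)
  moreover have "0 < 2 * p ^ 4 * (real (card Z))\<^sup>2" using p_pos False by simp
  ultimately show ?thesis by (simp only: mult_le_cancel_left_pos)
qed

text \<open>
  The weights \<open>W(y,y') = \<Sum> b(y,z) b(y',z)\<close> arising from the square are at most \<open>4 p\<^sup>2 |Z|\<close> except on few
  pairs. On the good pairs, \<open>W\<close> divided by this bound is an admissible weight for
  \<open>weighted_dev_ga_sum\<close>, with \<open>Y\<close> in the role of \<open>Z\<close>.
\<close>

lemma weighted_dev_ga_sum2:
  assumes X: "X \<subseteq> V" and Y: "Y \<subseteq> V" and Z: "Z \<subseteq> V" and q: "0 \<le> q" "q \<le> 2"
    and b01: "\<And>y z. b y z = 0 \<or> b y z = (1::real)" and b_le: "\<And>y z. b y z \<le> ga y z"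
    and reg: "disc_regular gr p \<epsilon> q X Y" and eps: "0 \<le> \<epsilon>" and sg: "0 \<le> \<sigma>" "\<sigma> \<le> 1"
    and bXY: "\<beta> \<le> \<sigma> * p ^ 3 * sqrt (real (card X) * real (card Y))"
    and bXZ: "\<beta> \<le> \<sigma> * p ^ 3 * sqrt (real (card X) * real (card Z))"
    and bYZ: "\<beta> \<le> \<sigma> * p ^ 3 * sqrt (real (card Y) * real (card Z))"
  shows "(\<Sum>x\<in>X. \<Sum>z\<in>Z. ga x z * \<bar>\<Sum>y\<in>Y. (gr x y - q * p) * b y z\<bar>)
    \<le> sqrt (8 * sqrt (16 * \<epsilon> + 34 * \<sigma>) + 32 * \<epsilon> + 110 * \<sigma>) * p ^ 3 * real (card X) * real (card Y) * real (card Z)"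
proof -
  define T where "T x z = (\<Sum>y\<in>Y. (gr x y - q * p) * b y z)" for x z
  define cX where "cX = real (card X)"
  define cY where "cY = real (card Y)"
  define cZ where "cZ = real (card Z)"
  note c_defs = cX_def[symmetric] cY_def[symmetric] cZ_def[symmetric]
  have c0: "0 \<le> cX" "0 \<le> cY" "0 \<le> cZ" by (auto simp: cX_def cY_def cZ_def)
  note finX = fin[OF X] and finY = fin[OF Y] and finZ = fin[OF Z]
  define \<eta> where "\<eta> = sqrt (16 * \<epsilon> + 34 * \<sigma>)"
  have eta0: "0 \<le> \<eta>" using eps sg by (simp add: \<eta>_def)
  have sg2: "\<sigma>\<^sup>2 \<le> \<sigma>" using sg by (simp add: power2_eq_square mult_left_le)
  have b0: "0 \<le> b y z" "b y z \<le> 1" for y z using b01[of y z] by auto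
  define D where "D y y' = (\<Sum>x\<in>X. (gr x y - q * p) * (gr x y' - q * p))" for y y'
  define W where "W y y' = (\<Sum>z\<in>Z. b y z * b y' z)" for y y'
  have W0: "0 \<le> W y y'" for y y' unfolding W_def by (intro sum_nonneg mult_nonneg_nonneg b0)
  have W_codeg: "W y y' \<le> (\<Sum>z\<in>Z. ga y z * ga y' z)" for y y'
    unfolding W_def by (intro sum_mono mult_mono b_le b0 ga_bounds)
  have W_deg: "W y y' \<le> (\<Sum>z\<in>Z. ga y z)" for y y'
    unfolding W_def using mult_mono[OF b_le b0(2) ga_bounds(1) b0(1)] by (intro sum_mono) auto
  have W_Z: "W y y' \<le> cZ" for y y'
    using W_deg[of y y'] deg_le_card[of y Z] by (simp add: cZ_def)
  have D_deg: "\<bar>D y y'\<bar> \<le> 2 * (\<Sum>x\<in>X. ga x y + 2 * p)" for y y'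
  proof -
    have "\<bar>D y y'\<bar> \<le> (\<Sum>x\<in>X. (ga x y + 2 * p) * 2)"
      unfolding D_def
      by (intro order_trans[OF sum_abs] sum_mono, simp only: abs_mult, intro mult_mono dev_bounds q)
         (use ga_bounds p_pos in \<open>auto intro: add_nonneg_nonneg\<close>)
    then show ?thesis by (simp add: sum_distrib_left mult_ac)
  qed
  have D_X: "\<bar>D y y'\<bar> \<le> 4 * cX" for y y'
  proof -
    have "\<bar>D y y'\<bar> \<le> (\<Sum>x\<in>X. 2 * 2)"
      unfolding D_def
      by (intro order_trans[OF sum_abs] sum_mono, simp only: abs_mult, intro mult_mono dev_bounds q) auto
    then show ?thesis by (simp add: cX_def)
  qed
  \<comment> \<open>\<open>B1\<close> and \<open>B2\<close> collect the \<open>y\<close> of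
    exceptional degree into \<open>Z\<close> and into \<open>X\<close>; \<open>C y\<close> collects
    the partners of exceptional codegree. The codegree bound is only available for \<open>y\<close>
    outside \<open>B1\<close>.\<close>
  define B1 where "B1 = {y \<in> Y. 2 * p * real (card Z) < (\<Sum>z\<in>Z. ga y z)}"
  define B2 where "B2 = {y \<in> Y. 2 * p * real (card X) < (\<Sum>x\<in>X. ga y x)}"
  define C where "C y = {y' \<in> Y. 4 * p\<^sup>2 * real (card Z) < (\<Sum>z\<in>Z. ga y z * ga y' z)}" for y
  define good where "good y y' \<longleftrightarrow> y \<notin> B1 \<and> y \<notin> B2 \<and> y' \<notin> C y" for y y'
  define W' where "W' y y' = (if good y y' then W y y' / (4 * p\<^sup>2 * cZ) else 0)" for y y'
  have W'_bounds: "0 \<le> W' y y' \<and> W' y y' \<le> 1" if "y \<in> Y" "y' \<in> Y" for y y'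
  proof (cases "good y y'")
    case True
    then have "W y y' \<le> 4 * p\<^sup>2 * cZ"
      using W_codeg[of y y'] that unfolding good_def C_def cZ_def by auto
    moreover have "0 \<le> 4 * p\<^sup>2 * cZ" using c0 by simp
    ultimately show ?thesis using W0[of y y'] True by (auto simp: W'_def divide_le_eq_1 less_le)
  qed (simp add: W'_def)
  \<comment> \<open>For empty \<open>Z\<close> the quotient in \<open>W'\<close> is a division by 0,
    hence 0, but then \<open>W\<close> vanishes too.\<close>
  have W'_eq: "4 * p\<^sup>2 * cZ * W' y y' = (if good y y' then W y y' else 0)" for y y'
  proof (cases "cZ = 0")
    case True
    then show ?thesis using W0[of y y'] W_Z[of y y'] by simp
  next
    case False
    then show ?thesis using p_pos by (simp add: W'_def)
  qed
  define U where "U x y' = (\<Sum>y\<in>Y. (gr x y - q * p) * W' y y')" for x y'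
  have good_part: "(\<Sum>y\<in>Y. \<Sum>y'\<in>Y. D y y' * (if good y y' then W y y' else 0)) \<le> 4 * p ^ 4 * cX * cY\<^sup>2 * cZ * (\<eta> + 4 * \<epsilon>)"
  proof -
    have "(\<Sum>y\<in>Y. \<Sum>y'\<in>Y. D y y' * (if good y y' then W y y' else 0))
        = 4 * p\<^sup>2 * cZ * (\<Sum>y\<in>Y. \<Sum>y'\<in>Y. \<Sum>x\<in>X. (gr x y - q * p) * (gr x y' - q * p) * W' y y')"
      unfolding W'_eq[symmetric] D_def by (simp add: sum_distrib_left sum_distrib_right mult_ac)
    also have "(\<Sum>y\<in>Y. \<Sum>y'\<in>Y. \<Sum>x\<in>X. (gr x y - q * p) * (gr x y' - q * p) * W' y y')
        = (\<Sum>x\<in>X. \<Sum>y'\<in>Y. (gr x y' - q * p) * U x y')"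
      unfolding U_def sum_distrib_left sum_swap3[of _ Y Y X, symmetric]
      by (rule sum.cong[OF refl], subst sum.swap) (simp add: mult_ac)
    \<comment> \<open>The remaining deviation is bounded by \<open>ga + 2 p\<close>. The
      \<open>ga\<close> part is again a sum of the type of \<open>weighted_dev_ga_sum\<close>, the
      constant part one of the type of \<open>weighted_dev_sum\<close>.\<close>
    also have "4 * p\<^sup>2 * cZ * \<dots> \<le> 4 * p\<^sup>2 * cZ * (\<Sum>x\<in>X. \<Sum>y'\<in>Y. (ga x y' + 2 * p) * \<bar>U x y'\<bar>)"
    proof (intro mult_left_mono sum_mono)
      fix x y'
      have "(gr x y' - q * p) * U x y' \<le> \<bar>gr x y' - q * p\<bar> * \<bar>U x y'\<bar>"
        by (metis abs_ge_self abs_mult)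
      also have "\<dots> \<le> (ga x y' + 2 * p) * \<bar>U x y'\<bar>"
        by (intro mult_right_mono dev_bounds q) auto
      finally show "(gr x y' - q * p) * U x y' \<le> (ga x y' + 2 * p) * \<bar>U x y'\<bar>" .
    qed (use c0 in auto)
    also have "\<dots> = 4 * p\<^sup>2 * cZ * ((\<Sum>x\<in>X. \<Sum>y'\<in>Y. ga x y' * \<bar>U x y'\<bar>) + 2 * p * (\<Sum>x\<in>X. \<Sum>y'\<in>Y. \<bar>U x y'\<bar>))"
      by (simp add: distrib_right sum.distrib sum_distrib_left)
    also have "\<dots> \<le> 4 * p\<^sup>2 * cZ * (\<eta> * p\<^sup>2 * cX * cY * cY + 2 * p * (2 * \<epsilon> * p * cX * cY * cY))"
      unfolding U_def \<eta>_def cX_def cY_def using p_pos c0 W'_bounds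
      by (intro mult_left_mono add_mono weighted_dev_ga_sum[OF X Y Y q _ reg eps sg bXY bXY] weighted_dev_sum[OF X Y _ reg]) auto
    also have "\<dots> = 4 * p ^ 4 * cX * cY\<^sup>2 * cZ * (\<eta> + 4 * \<epsilon>)"
      by (simp add: power2_eq_square power4_eq_xxxx algebra_simps)
    finally show ?thesis .
  qed
  have bYX: "\<beta> \<le> \<sigma> * p ^ 3 * sqrt (real (card Y) * real (card X))"
    using bXY by (simp add: mult.commute)
  have cardB1: "real (card B1) \<le> \<sigma>\<^sup>2 * p ^ 4 * cY"
    using high_degree_contribution[OF Y Z bYZ] by (simp add: B1_def cY_def)
  have cardB2: "real (card B2) \<le> \<sigma>\<^sup>2 * p ^ 4 * cY"
    using high_degree_contribution[OF Y X bYX] by (simp add: B2_def cY_def)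
  have bad_part: "(\<Sum>y\<in>Y. \<Sum>y'\<in>Y. D y y' * (if good y y' then 0 else W y y')) \<le> 16 * \<sigma>\<^sup>2 * p ^ 4 * cX * cY\<^sup>2 * cZ"
  proof -
    have XZ0: "0 \<le> cX * cZ" using c0 by simp
    \<comment> \<open>Every bad contribution has order at least \<open>p^4\<close>. Rows in
      \<open>B1\<close> or \<open>B2\<close> are bounded trivially but form a fraction
      \<open>p^4\<close>. In the other rows only \<open>C y\<close> is bad: a fraction
      \<open>p^3\<close>, with a factor \<open>p\<close> from each of \<open>D\<close> and
      \<open>W\<close>.\<close>
    have row: "(\<Sum>y'\<in>Y. D y y' * (if good y y' then 0 else W y y'))
       \<le> (if y \<in> B1 then 4 * cX * cZ * cY else 0) + (if y \<in> B2 then 4 * cX * cZ * cY else 0) + 8 * \<sigma>\<^sup>2 * p ^ 5 * cX * cZ * cY"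
      (is "?L \<le> ?a + ?b + ?c") if y: "y \<in> Y" for y
    proof -
      have nn: "0 \<le> ?a" "0 \<le> ?b" "0 \<le> ?c" using c0 p_pos by auto
      show ?thesis
      proof (cases "y \<in> B1 \<or> y \<in> B2")
        case True
        have "?L \<le> (\<Sum>y'\<in>Y. 4 * cX * cZ)"
        proof (rule sum_mono)
          fix y'
          have "D y y' * (if good y y' then 0 else W y y') \<le> \<bar>D y y'\<bar> * W y y'"
            using W0[of y y'] by (auto intro: mult_right_mono)
          also have "\<dots> \<le> (4 * cX) * cZ"
            by (intro mult_mono D_X W_Z W0) (use c0 in auto)
          finally show "D y y' * (if good y y' then 0 else W y y') \<le> 4 * cX * cZ" .
        qed
        also have "\<dots> = 4 * cX * cZ * cY" by (simp add: cY_def)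
        finally have L: "?L \<le> 4 * cX * cZ * cY" .
        have "4 * cX * cZ * cY \<le> ?a + ?b"
        proof (cases "y \<in> B1")
          case True
          then show ?thesis using nn(2) by (simp only: if_True le_add_same_cancel1)
        next
          case False
          then show ?thesis using True by (simp only: if_False if_True) simp
        qed
        then show ?thesis by (rule order_trans[OF L add_increasing2[OF nn(3)]])
      next
        case False
        then have degs: "(\<Sum>z\<in>Z. ga y z) \<le> 2 * p * cZ" "(\<Sum>x\<in>X. ga y x) \<le> 2 * p * cX"
          using y unfolding B1_def B2_def cX_def cZ_def by auto
        have "?L \<le> (\<Sum>y'\<in>Y. if y' \<in> C y then 8 * p * cX * (2 * p * cZ) else 0)"
        proof (rule sum_mono)
          fix y' assume "y' \<in> Y"
          show "D y y' * (if good y y' then 0 else W y y') \<le> (if y' \<in> C y then 8 * p * cX * (2 * p * cZ) else 0)"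
          proof (cases "y' \<in> C y")
            case True
            have "D y y' * (if good y y' then 0 else W y y') \<le> \<bar>D y y'\<bar> * W y y'"
              using W0[of y y'] by (auto intro: mult_right_mono)
            also have "\<dots> \<le> 8 * p * cX * (2 * p * cZ)"
            proof (intro mult_mono)
              have "2 * (\<Sum>x\<in>X. ga x y + 2 * p) = 2 * ((\<Sum>x\<in>X. ga y x) + 2 * p * cX)"
                by (simp add: sum.distrib cX_def ga_sym[of y])
              then show "\<bar>D y y'\<bar> \<le> 8 * p * cX" using D_deg[of y y'] degs(2) by simp
              show "W y y' \<le> 2 * p * cZ" using W_deg[of y y'] degs(1) by simp
            qed (use W0 c0 p_pos in auto)
            finally show ?thesis using True by simp
          next
            case F: False
            then have "good y y'" using False by (simp add: good_def)
            then show ?thesis using F by simp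
          qed
        qed
        also have "\<dots> = real (card (C y)) * (8 * p * cX * (2 * p * cZ))"
          by (rule sum_if_mem[OF finY]) (auto simp: C_def)
        also have "\<dots> = 2 * real (card (C y)) * (8 * p\<^sup>2 * (cX * cZ))"
          by (simp add: power2_eq_square)
        also have "\<dots> \<le> \<sigma>\<^sup>2 * p ^ 3 * cY * (8 * p\<^sup>2 * (cX * cZ))"
          unfolding C_def cY_def using degs(1) XZ0 p_pos
          by (intro mult_right_mono high_codegree_card[OF Y Z bYZ]) (auto simp: cZ_def)
        also have "\<dots> = ?c" by (simp add: numeral_eq_Suc mult_ac)
        finally show ?thesis using nn by simp
      qed
    qed
    have BY: "B1 \<subseteq> Y" "B2 \<subseteq> Y" by (auto simp: B1_def B2_def)
    have "(\<Sum>y\<in>Y. \<Sum>y'\<in>Y. D y y' * (if good y y' then 0 else W y y'))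
      \<le> (\<Sum>y\<in>Y. (if y \<in> B1 then 4 * cX * cZ * cY else 0) + (if y \<in> B2 then 4 * cX * cZ * cY else 0) + 8 * \<sigma>\<^sup>2 * p ^ 5 * cX * cZ * cY)"
      by (intro sum_mono row)
    also have "\<dots> = real (card B1) * (4 * cX * cZ * cY) + real (card B2) * (4 * cX * cZ * cY) + cY * (8 * \<sigma>\<^sup>2 * p ^ 5 * cX * cZ * cY)"
      using BY by (simp only: sum.distrib sum_if_mem[OF finY]) (simp add: cY_def)
    also have "\<dots> \<le> (\<sigma>\<^sup>2 * p ^ 4 * cY) * (4 * cX * cZ * cY) + (\<sigma>\<^sup>2 * p ^ 4 * cY) * (4 * cX * cZ * cY) + cY * (8 * \<sigma>\<^sup>2 * p ^ 4 * cX * cZ * cY)"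
      using c0 p_pos p_le by (intro add_mono mult_right_mono mult_left_mono cardB1 cardB2 power_decreasing) auto
    also have "\<dots> = 16 * \<sigma>\<^sup>2 * p ^ 4 * cX * cY\<^sup>2 * cZ"
      by (simp add: power2_eq_square)
    finally show ?thesis .
  qed
  have "(\<Sum>x\<in>X. \<Sum>z\<in>Z. (T x z)\<^sup>2) = (\<Sum>x\<in>X. \<Sum>z\<in>Z. \<Sum>y\<in>Y. \<Sum>y'\<in>Y. (gr x y - q * p) * b y z * ((gr x y' - q * p) * b y' z))"
    unfolding T_def power2_eq_square sum_product ..
  also have "\<dots> = (\<Sum>y\<in>Y. \<Sum>y'\<in>Y. \<Sum>x\<in>X. \<Sum>z\<in>Z. (gr x y - q * p) * b y z * ((gr x y' - q * p) * b y' z))"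
    by (rule sum_swap4)
  also have "\<dots> = (\<Sum>y\<in>Y. \<Sum>y'\<in>Y. D y y' * W y y')"
    unfolding D_def W_def sum_product by (simp add: mult_ac)
  also have "\<dots> = (\<Sum>y\<in>Y. \<Sum>y'\<in>Y. D y y' * (if good y y' then W y y' else 0)) + (\<Sum>y\<in>Y. \<Sum>y'\<in>Y. D y y' * (if good y y' then 0 else W y y'))"
    unfolding sum.distrib[symmetric] by (intro sum.cong refl) auto
  also have "\<dots> \<le> 4 * p ^ 4 * cX * cY\<^sup>2 * cZ * (\<eta> + 4 * \<epsilon>) + 16 * \<sigma>\<^sup>2 * p ^ 4 * cX * cY\<^sup>2 * cZ"
    by (rule add_mono[OF good_part bad_part])
  also have "\<dots> = (4 * \<eta> + 16 * \<epsilon> + 16 * \<sigma>\<^sup>2) * (p ^ 4 * cX * cY\<^sup>2 * cZ)"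
    by (simp add: algebra_simps)
  also have "\<dots> \<le> (4 * \<eta> + 16 * \<epsilon> + 16 * \<sigma>) * (p ^ 4 * cX * cY\<^sup>2 * cZ)"
    using sg2 c0 p_pos by (intro mult_right_mono) auto
  finally have "p * (\<Sum>x\<in>X. \<Sum>z\<in>Z. (T x z)\<^sup>2) \<le> p * ((4 * \<eta> + 16 * \<epsilon> + 16 * \<sigma>) * (p ^ 4 * cX * cY\<^sup>2 * cZ))"
    using p_pos by (intro mult_left_mono) auto
  then have s2: "p * (\<Sum>x\<in>X. \<Sum>z\<in>Z. (T x z)\<^sup>2) \<le> (4 * \<eta> + 16 * \<epsilon> + 16 * \<sigma>) * (p ^ 5 * cX * cY\<^sup>2 * cZ)"
    by (simp add: numeral_eq_Suc mult_ac)
  have s3: "(\<Sum>x\<in>X. \<Sum>z\<in>Z. (ga x z - p) * (T x z)\<^sup>2) \<le> 39 * \<sigma> * (p ^ 5 * cX * cY\<^sup>2 * cZ)"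
  proof -
    \<comment> \<open>Since \<open>b\<close> lies below \<open>ga\<close>, the supports are
      contained in common neighbourhoods, and their total size is a second moment of degrees. This
      saves \<open>p^2\<close> over the trivial count, hence a factor \<open>p\<close> after taking
      the root.\<close>
    have "(\<Sum>y\<in>Y. \<Sum>y'\<in>Y. real (card {z \<in> Z. b y z * b y' z \<noteq> 0})) = (\<Sum>y\<in>Y. \<Sum>y'\<in>Y. \<Sum>z\<in>Z. b y z * b y' z)"
    proof (intro sum.cong refl)
      fix y y'
      have "(b y z * b y' z \<noteq> 0) = (b y z * b y' z = 1)" for z using b01[of y z] b01[of y' z] by auto
      moreover have "b y z * b y' z = 0 \<or> b y z * b y' z = 1" for z using b01[of y z] b01[of y' z] by auto
      ultimately show "real (card {z \<in> Z. b y z * b y' z \<noteq> 0}) = (\<Sum>z\<in>Z. b y z * b y' z)"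
        using card_01[OF finZ, of "\<lambda>z. b y z * b y' z"] by (simp only:)
    qed
    also have "\<dots> = (\<Sum>z\<in>Z. (\<Sum>y\<in>Y. b y z)\<^sup>2)"
      by (subst sum_swap3[symmetric]) (simp add: power2_eq_square sum_product)
    also have "\<dots> \<le> (\<Sum>z\<in>Z. (\<Sum>y\<in>Y. ga z y)\<^sup>2)"
      by (intro sum_mono power_mono sum_nonneg b0) (subst ga_sym, rule b_le)
    also have "\<dots> \<le> 5 * p\<^sup>2 * real (card Z) * (real (card Y))\<^sup>2"
      using beta_weaken[OF bYZ sg, of 2] by (intro sum_deg_sq Z Y) (simp add: mult.commute)
    \<comment> \<open>Rounding 5 up to 9 makes the root 3, so that 13 becomes 39.\<close>
    also have "\<dots> \<le> 9 * p\<^sup>2 * real (card Z) * (real (card Y))\<^sup>2"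
      by (intro mult_right_mono) auto
    also have "\<dots> = 9 * p\<^sup>2 * cZ * cY\<^sup>2" by (simp add: cY_def cZ_def)
    finally have w: "(\<Sum>y\<in>Y. \<Sum>y'\<in>Y. real (card {z \<in> Z. b y z * b y' z \<noteq> 0})) \<le> 9 * p\<^sup>2 * cZ * cY\<^sup>2" .
    have "(\<Sum>x\<in>X. \<Sum>z\<in>Z. (ga x z - p) * (T x z)\<^sup>2) \<le> \<beta> * (13 * p * cY * sqrt cX)
       * sqrt (\<Sum>y\<in>Y. \<Sum>y'\<in>Y. real (card {z \<in> Z. b y z * b y' z \<noteq> 0}))"
      unfolding T_def cX_def cY_def
      using expand_error[where b = b, OF X Y Z q] b0 beta_weaken[OF bXY sg, of 2] by (auto simp: abs_le_iff)
    also have "\<dots> \<le> \<beta> * (13 * p * cY * sqrt cX) * sqrt (9 * p\<^sup>2 * cZ * cY\<^sup>2)"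
      using p_pos beta_nonneg c0 w by (intro mult_left_mono real_sqrt_le_mono) auto
    also have "\<dots> = \<beta> * (39 * p\<^sup>2 * cY\<^sup>2 * sqrt (cX * cZ))"
    proof -
      have "sqrt 9 = (3::real)" by (rule real_sqrt_unique) auto
      then show ?thesis using c0 p_pos by (simp add: real_sqrt_mult power2_eq_square)
    qed
    also have "\<dots> \<le> (\<sigma> * p ^ 3 * sqrt (cX * cZ)) * (39 * p\<^sup>2 * cY\<^sup>2 * sqrt (cX * cZ))"
      using bXZ p_pos c0 unfolding c_defs by (intro mult_right_mono) auto
    also have "\<dots> = 39 * \<sigma> * (p ^ 5 * cX * cY\<^sup>2 * cZ)"
    proof -
      have "sqrt (cX * cZ) * sqrt (cX * cZ) = cX * cZ" using c0 by simp
      then show ?thesis by (simp add: numeral_eq_Suc mult_ac)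
    qed
    finally show ?thesis .
  qed
  have s4: "(\<Sum>x\<in>X. \<Sum>z\<in>Z. ga x z * (T x z)\<^sup>2) \<le> (4 * \<eta> + 16 * \<epsilon> + 55 * \<sigma>) * (p ^ 5 * cX * cY\<^sup>2 * cZ)"
    unfolding sum_ga_T_sq using s2 s3 by (simp add: algebra_simps)
  have s1: "(\<Sum>x\<in>X. \<Sum>z\<in>Z. ga x z) \<le> 2 * p * cX * cZ"
    unfolding cX_def cZ_def using beta_weaken[OF bXZ sg, of 1] by (intro edges_le_twice X Z) simp
  have "(\<Sum>x\<in>X. \<Sum>z\<in>Z. ga x z * \<bar>T x z\<bar>)\<^sup>2 \<le> (\<Sum>x\<in>X. \<Sum>z\<in>Z. ga x z) * (\<Sum>x\<in>X. \<Sum>z\<in>Z. ga x z * (T x z)\<^sup>2)"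
    by (rule Cauchy_ga)
  also have "\<dots> \<le> (2 * p * cX * cZ) * ((4 * \<eta> + 16 * \<epsilon> + 55 * \<sigma>) * (p ^ 5 * cX * cY\<^sup>2 * cZ))"
    using p_pos c0 by (intro mult_mono s1 s4) (auto intro!: sum_nonneg mult_nonneg_nonneg ga_bounds)
  also have "\<dots> = (8 * \<eta> + 32 * \<epsilon> + 110 * \<sigma>) * (p ^ 3 * cX * cY * cZ)\<^sup>2"
    by (simp add: numeral_eq_Suc algebra_simps)
  finally have "(\<Sum>x\<in>X. \<Sum>z\<in>Z. ga x z * \<bar>T x z\<bar>) \<le> sqrt ((8 * \<eta> + 32 * \<epsilon> + 110 * \<sigma>) * (p ^ 3 * cX * cY * cZ)\<^sup>2)"
    by (rule real_le_rsqrt)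
  also have "\<dots> = sqrt (8 * \<eta> + 32 * \<epsilon> + 110 * \<sigma>) * (p ^ 3 * cX * cY * cZ)"
    using c0 p_pos by (simp add: real_sqrt_mult)
  finally show ?thesis unfolding T_def c_defs \<eta>_def by (simp add: mult_ac)
qed

end

section \<open>From weighted deviations to neighbourhoods\<close>

lemma disc_regular_sym:
  assumes "disc_regular w p \<epsilon> q X Y" and "\<And>x y. w x y = w y x"
  shows "disc_regular w p \<epsilon> q Y X"
  unfolding disc_regular_def
proof (intro allI impI)
  fix A B assume AB: "A \<subseteq> Y" "B \<subseteq> X"
  have "(\<Sum>x\<in>A. \<Sum>y\<in>B. w x y - q * p) = (\<Sum>y\<in>B. \<Sum>x\<in>A. w y x - q * p)"
    by (subst sum.swap) (simp add: assms(2))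
  then show "\<bar>\<Sum>x\<in>A. \<Sum>y\<in>B. w x y - q * p\<bar> \<le> \<epsilon> * p * real (card Y) * real (card X)"
    using assms(1) AB unfolding disc_regular_def by (simp add: mult_ac)
qed

lemma disc_regular_mono:
  assumes "disc_regular w p \<epsilon> q X Y" "\<epsilon> \<le> \<epsilon>'" "0 \<le> p"
  shows "disc_regular w p \<epsilon>' q X Y"
  unfolding disc_regular_def
proof (intro allI impI)
  fix A B assume "A \<subseteq> X" "B \<subseteq> Y"
  then have "\<bar>\<Sum>x\<in>A. \<Sum>y\<in>B. w x y - q * p\<bar> \<le> \<epsilon> * p * real (card X) * real (card Y)"
    using assms(1) unfolding disc_regular_def by blast
  also have "\<dots> \<le> \<epsilon>' * p * real (card X) * real (card Y)"
    using assms by (intro mult_right_mono) auto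
  finally show "\<bar>\<Sum>x\<in>A. \<Sum>y\<in>B. w x y - q * p\<bar> \<le> \<epsilon>' * p * real (card X) * real (card Y)" .
qed

context jumbled_subgraph
begin

definition nbrs :: "'b \<Rightarrow> 'b set \<Rightarrow> 'b set" where
  "nbrs z X = {x \<in> X. gr z x = 1}"

lemma nbrs_subset: "nbrs z X \<subseteq> X"
  by (auto simp: nbrs_def)

lemma card_nbrs: "X \<subseteq> V \<Longrightarrow> real (card (nbrs z X)) = (\<Sum>x\<in>X. gr z x)"
  unfolding nbrs_def by (rule card_01[OF fin gr01])

text \<open>Each such \<open>z\<close> misses at least \<open>\<alpha>/2 * p |X|\<close> of its
  expected neighbours. Regularity, tested on the set of these \<open>z\<close> against all of
  \<open>X\<close>, limits the total deficit.\<close>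

lemma low_degree_card:
  assumes X: "X \<subseteq> V" and Z: "Z \<subseteq> V" and reg: "disc_regular gr p \<epsilon> q Z X" and q: "\<alpha> \<le> q" and eps: "0 \<le> \<epsilon>"
  shows "real (card {z \<in> Z. real (card (nbrs z X)) < \<alpha> / 2 * p * real (card X)}) * \<alpha> \<le> 2 * \<epsilon> * real (card Z)"
proof (cases "card X = 0")
  case True
  then have e: "{z \<in> Z. real (card (nbrs z X)) < \<alpha> / 2 * p * real (card X)} = {}"
    by auto
  show ?thesis unfolding e using eps by simp
next
  case False
  let ?A = "{z \<in> Z. real (card (nbrs z X)) < \<alpha> / 2 * p * real (card X)}"
  have "real (card ?A) * (\<alpha> / 2 * p * real (card X)) = (\<Sum>z\<in>?A. \<alpha> / 2 * p * real (card X))" by simp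
  also have "\<dots> \<le> (\<Sum>z\<in>?A. - (\<Sum>x\<in>X. gr z x - q * p))"
  proof (rule sum_mono)
    fix z assume "z \<in> ?A"
    moreover have "\<alpha> * (p * real (card X)) \<le> q * (p * real (card X))"
      using q p_pos by (intro mult_right_mono) auto
    ultimately show "\<alpha> / 2 * p * real (card X) \<le> - (\<Sum>x\<in>X. gr z x - q * p)"
      by (simp add: sum_subtractf card_nbrs[OF X] algebra_simps)
  qed
  also have "\<dots> \<le> \<bar>\<Sum>z\<in>?A. \<Sum>x\<in>X. gr z x - q * p\<bar>"
    by (simp only: sum_negf abs_ge_minus_self)
  also have "\<dots> \<le> \<epsilon> * p * real (card Z) * real (card X)"
    using reg unfolding disc_regular_def by (auto simp del: sum_subtractf)
  finally have "(p * real (card X)) * (real (card ?A) * \<alpha>) \<le> (p * real (card X)) * (2 * \<epsilon> * real (card Z))"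
    by (simp add: algebra_simps)
  moreover have "0 < p * real (card X)" using False p_pos by simp
  ultimately show ?thesis by (simp only: mult_le_cancel_left_pos)
qed

text \<open>The weight \<open>b\<close> records a worst set \<open>B z\<close> for every bad
  \<open>z\<close>. The matching \<open>A z\<close> need not be recorded: it lies in the
  neighbourhood of \<open>z\<close>, where \<open>ga\<close> is 1, and the absolute values allow
  summation over all of \<open>X\<close>. The sets \<open>S z\<close> leave open whether the second
  cell shrinks as well.\<close>

lemma irregular_neighbourhood_card:
  assumes X: "X \<subseteq> V" and Y: "Y \<subseteq> V" and Z: "Z \<subseteq> V" and S: "\<And>z. S z \<subseteq> Y"
    and bound: "\<And>b. (\<And>y z. b y z = 0 \<or> b y z = (1::real)) \<Longrightarrow> (\<And>y z. b y z = 1 \<Longrightarrow> y \<in> S z) \<Longrightarrow>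
      (\<Sum>x\<in>X. \<Sum>z\<in>Z. ga x z * \<bar>\<Sum>y\<in>Y. (gr x y - q * p) * b y z\<bar>)
        \<le> \<eta> * p ^ k * real (card X) * real (card Y) * real (card Z)"
    and eta: "0 \<le> \<eta>"
  shows "real (card {z \<in> Z. \<not> (\<forall>A\<subseteq>nbrs z X. \<forall>B\<subseteq>S z. \<bar>\<Sum>x\<in>A. \<Sum>y\<in>B. gr x y - q * p\<bar>
     \<le> \<epsilon> * p ^ k * real (card X) * real (card Y))}) * \<epsilon> \<le> \<eta> * real (card Z)"
    (is "real (card ?bad) * \<epsilon> \<le> _")
proof (cases "card X = 0 \<or> card Y = 0")
  case True
  have "(\<Sum>x\<in>A. \<Sum>y\<in>B. gr x y - q * p) = 0" if "A \<subseteq> nbrs z X" "B \<subseteq> S z" for A B z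
  proof -
    have "A \<subseteq> X" "B \<subseteq> Y" using that nbrs_subset S by blast+
    then have "A = {} \<or> B = {}" using True fin[OF X] fin[OF Y] by auto
    then show ?thesis by auto
  qed
  then have e: "?bad = {}" using True by auto
  show ?thesis unfolding e using eta by simp
next
  case False
  define P where "P z A B \<longleftrightarrow> A \<subseteq> nbrs z X \<and> B \<subseteq> S z \<and>
      \<epsilon> * p ^ k * real (card X) * real (card Y) < \<bar>\<Sum>x\<in>A. \<Sum>y\<in>B. gr x y - q * p\<bar>" for z A B
  have "\<forall>z\<in>?bad. \<exists>A B. P z A B"
    unfolding P_def by (auto simp: not_le)
  from bchoice[OF this] obtain A where "\<forall>z\<in>?bad. \<exists>B. P z (A z) B" ..
  from bchoice[OF this] obtain B where AB': "\<forall>z\<in>?bad. P z (A z) (B z)" ..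
  have AB: "A z \<subseteq> nbrs z X \<and> B z \<subseteq> S z \<and>
      \<epsilon> * p ^ k * real (card X) * real (card Y) < \<bar>\<Sum>x\<in>A z. \<Sum>y\<in>B z. gr x y - q * p\<bar>" if "z \<in> ?bad" for z
    using bspec[OF AB' that] by (simp only: P_def)
  define b where "b y z = (if z \<in> ?bad \<and> y \<in> B z then 1 else 0 :: real)" for y z
  define T where "T x z = (\<Sum>y\<in>Y. (gr x y - q * p) * b y z)" for x z
  have finZ: "finite Z" by (rule fin[OF Z])
  have "real (card ?bad) * (\<epsilon> * p ^ k * real (card X) * real (card Y)) = (\<Sum>z\<in>?bad. \<epsilon> * p ^ k * real (card X) * real (card Y))"
    by simp
  also have "\<dots> \<le> (\<Sum>z\<in>?bad. \<Sum>x\<in>X. ga x z * \<bar>T x z\<bar>)"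
  proof (rule sum_mono)
    fix z assume z: "z \<in> ?bad"
    have BY: "B z \<subseteq> Y" using AB[OF z] S by blast
    have AX: "A z \<subseteq> X" using AB[OF z] nbrs_subset by blast
    have T: "T x z = (\<Sum>y\<in>B z. gr x y - q * p)" for x
    proof -
      have "T x z = (\<Sum>y\<in>Y. if y \<in> B z then gr x y - q * p else 0)"
        unfolding T_def b_def using z by (intro sum.cong) auto
      also have "\<dots> = (\<Sum>y\<in>B z. gr x y - q * p)"
        using fin[OF Y] BY by (simp add: sum.If_cases Int_absorb1)
      finally show ?thesis .
    qed
    have "\<epsilon> * p ^ k * real (card X) * real (card Y) \<le> \<bar>\<Sum>x\<in>A z. T x z\<bar>"
      using AB[OF z] unfolding T by simp
    also have "\<dots> \<le> (\<Sum>x\<in>A z. \<bar>T x z\<bar>)" by (rule sum_abs)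
    also have "\<dots> = (\<Sum>x\<in>A z. ga x z * \<bar>T x z\<bar>)"
    proof (intro sum.cong refl)
      fix x assume "x \<in> A z"
      then have "gr x z = 1" using AB[OF z] by (auto simp: nbrs_def gr_sym[of x])
      then have "ga x z = 1" using gr_le_ga[of x z] ga_bounds(2)[of x z] by simp
      then show "\<bar>T x z\<bar> = ga x z * \<bar>T x z\<bar>" by simp
    qed
    also have "\<dots> \<le> (\<Sum>x\<in>X. ga x z * \<bar>T x z\<bar>)"
      using AX fin[OF X] by (intro sum_mono2) (auto intro: mult_nonneg_nonneg ga_bounds)
    finally show "\<epsilon> * p ^ k * real (card X) * real (card Y) \<le> (\<Sum>x\<in>X. ga x z * \<bar>T x z\<bar>)" .
  qed
  also have "\<dots> \<le> (\<Sum>z\<in>Z. \<Sum>x\<in>X. ga x z * \<bar>T x z\<bar>)"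
    using finZ by (intro sum_mono2) (auto intro!: sum_nonneg mult_nonneg_nonneg ga_bounds)
  also have "\<dots> = (\<Sum>x\<in>X. \<Sum>z\<in>Z. ga x z * \<bar>T x z\<bar>)" by (rule sum.swap)
  also have "\<dots> \<le> \<eta> * p ^ k * real (card X) * real (card Y) * real (card Z)"
  proof -
    have "y \<in> S z" if "b y z = 1" for y z
    proof -
      have "z \<in> ?bad" "y \<in> B z" using that unfolding b_def by (metis zero_neq_one)+
      then show ?thesis using AB by blast
    qed
    moreover have "b y z = 0 \<or> b y z = 1" for y z by (simp add: b_def)
    ultimately show ?thesis unfolding T_def by (intro bound)
  qed
  finally have "(p ^ k * real (card X) * real (card Y)) * (real (card ?bad) * \<epsilon>)
      \<le> (p ^ k * real (card X) * real (card Y)) * (\<eta> * real (card Z))"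
    by (simp add: mult_ac)
  moreover have "0 < p ^ k * real (card X) * real (card Y)" using False p_pos by simp
  ultimately show ?thesis by (simp only: mult_le_cancel_left_pos)
qed

text \<open>On a neighbourhood of size at least \<open>\<alpha>/2 * p |X|\<close>,
  \<open>\<epsilon>'\<close>-regularity tolerates an error of at least
  \<open>\<epsilon>' * \<alpha>/2 * p^2 |X| |Y|\<close>. So its failure is the event counted by
  \<open>irregular_neighbourhood_card\<close> for exponent 2.\<close>

lemma inherit_one_side:
  assumes X: "X \<subseteq> V" and Y: "Y \<subseteq> V" and Z: "Z \<subseteq> V" and q: "0 \<le> q" "q \<le> 2"
    and reg: "disc_regular gr p \<epsilon> q X Y" and eps: "0 \<le> \<epsilon>" and sg: "0 \<le> \<sigma>" "\<sigma> \<le> 1"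
    and bXY: "\<beta> \<le> \<sigma> * p ^ 3 * sqrt (real (card X) * real (card Y))"
    and bXZ: "\<beta> \<le> \<sigma> * p ^ 3 * sqrt (real (card X) * real (card Z))"
    and al: "0 \<le> \<alpha>" and eps': "0 < \<epsilon>'"
  shows "real (card {z \<in> Z. \<alpha> / 2 * p * real (card X) \<le> real (card (nbrs z X)) \<and>
        \<not> disc_regular gr p \<epsilon>' q (nbrs z X) Y}) * (\<epsilon>' * (\<alpha> / 2)) \<le> sqrt (16 * \<epsilon> + 34 * \<sigma>) * real (card Z)"
    (is "real (card ?bad) * _ \<le> ?r")
proof -
  let ?bad' = "{z \<in> Z. \<not> (\<forall>A\<subseteq>nbrs z X. \<forall>B\<subseteq>Y. \<bar>\<Sum>x\<in>A. \<Sum>y\<in>B. gr x y - q * p\<bar>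
     \<le> (\<epsilon>' * (\<alpha> / 2)) * p\<^sup>2 * real (card X) * real (card Y))}"
  have "?bad \<subseteq> ?bad'"
  proof (rule subsetI, rule ccontr)
    fix z assume z: "z \<in> ?bad" "z \<notin> ?bad'"
    have "disc_regular gr p \<epsilon>' q (nbrs z X) Y"
      unfolding disc_regular_def
    proof (intro allI impI)
      fix A B assume "A \<subseteq> nbrs z X" "B \<subseteq> Y"
      then have "\<bar>\<Sum>x\<in>A. \<Sum>y\<in>B. gr x y - q * p\<bar> \<le> (\<epsilon>' * (\<alpha> / 2)) * p\<^sup>2 * real (card X) * real (card Y)"
        using z by blast
      also have "\<dots> = \<epsilon>' * p * (\<alpha> / 2 * p * real (card X)) * real (card Y)"
        by (simp add: power2_eq_square)
      also have "\<dots> \<le> \<epsilon>' * p * real (card (nbrs z X)) * real (card Y)"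
        using z eps' p_pos by (intro mult_right_mono mult_left_mono) auto
      finally show "\<bar>\<Sum>x\<in>A. \<Sum>y\<in>B. gr x y - q * p\<bar> \<le> \<epsilon>' * p * real (card (nbrs z X)) * real (card Y)" .
    qed
    then show False using z by simp
  qed
  then have "real (card ?bad) * (\<epsilon>' * (\<alpha> / 2)) \<le> real (card ?bad') * (\<epsilon>' * (\<alpha> / 2))"
    using fin[OF Z] eps' al by (intro mult_right_mono) (auto intro!: card_mono)
  also have "\<dots> \<le> ?r"
  proof (rule irregular_neighbourhood_card[where S = "\<lambda>_. Y", OF X Y Z])
    fix b :: "'b \<Rightarrow> 'b \<Rightarrow> real" assume "\<And>y z. b y z = 0 \<or> b y z = 1"
    then have "0 \<le> b y z \<and> b y z \<le> 1" for y z by (metis order_refl zero_le_one)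
    then show "(\<Sum>x\<in>X. \<Sum>z\<in>Z. ga x z * \<bar>\<Sum>y\<in>Y. (gr x y - q * p) * b y z\<bar>)
      \<le> sqrt (16 * \<epsilon> + 34 * \<sigma>) * p\<^sup>2 * real (card X) * real (card Y) * real (card Z)"
      by (intro weighted_dev_ga_sum[OF X Y Z q _ reg eps sg bXY bXZ])
  qed (use eps sg in auto)
  finally show ?thesis .
qed

text \<open>Both cells lose a factor \<open>p\<close>, so the exponent is 3. The recorded sets lie
  inside neighbourhoods of \<open>z\<close>, which gives the domination of \<open>b\<close> by
  \<open>ga\<close> that \<open>weighted_dev_ga_sum2\<close> requires.\<close>

lemma inherit_two_sides:
  assumes X: "X \<subseteq> V" and Y: "Y \<subseteq> V" and Z: "Z \<subseteq> V" and q: "0 \<le> q" "q \<le> 2"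
    and reg: "disc_regular gr p \<epsilon> q X Y" and eps: "0 \<le> \<epsilon>" and sg: "0 \<le> \<sigma>" "\<sigma> \<le> 1"
    and bXY: "\<beta> \<le> \<sigma> * p ^ 3 * sqrt (real (card X) * real (card Y))"
    and bXZ: "\<beta> \<le> \<sigma> * p ^ 3 * sqrt (real (card X) * real (card Z))"
    and bYZ: "\<beta> \<le> \<sigma> * p ^ 3 * sqrt (real (card Y) * real (card Z))"
    and al: "0 \<le> \<alpha>" and eps': "0 < \<epsilon>'"
  shows "real (card {z \<in> Z. \<alpha> / 2 * p * real (card X) \<le> real (card (nbrs z X)) \<and>
        \<alpha> / 2 * p * real (card Y) \<le> real (card (nbrs z Y)) \<and>
        \<not> disc_regular gr p \<epsilon>' q (nbrs z X) (nbrs z Y)}) * (\<epsilon>' * (\<alpha> / 2)\<^sup>2)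
     \<le> sqrt (8 * sqrt (16 * \<epsilon> + 34 * \<sigma>) + 32 * \<epsilon> + 110 * \<sigma>) * real (card Z)"
    (is "real (card ?bad) * _ \<le> ?r")
proof -
  let ?bad' = "{z \<in> Z. \<not> (\<forall>A\<subseteq>nbrs z X. \<forall>B\<subseteq>nbrs z Y. \<bar>\<Sum>x\<in>A. \<Sum>y\<in>B. gr x y - q * p\<bar>
     \<le> (\<epsilon>' * (\<alpha> / 2)\<^sup>2) * p ^ 3 * real (card X) * real (card Y))}"
  have "?bad \<subseteq> ?bad'"
  proof (rule subsetI, rule ccontr)
    fix z assume z: "z \<in> ?bad" "z \<notin> ?bad'"
    have "disc_regular gr p \<epsilon>' q (nbrs z X) (nbrs z Y)"
      unfolding disc_regular_def
    proof (intro allI impI)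
      fix A B assume "A \<subseteq> nbrs z X" "B \<subseteq> nbrs z Y"
      then have "\<bar>\<Sum>x\<in>A. \<Sum>y\<in>B. gr x y - q * p\<bar> \<le> (\<epsilon>' * (\<alpha> / 2)\<^sup>2) * p ^ 3 * real (card X) * real (card Y)"
        using z by blast
      also have "\<dots> = \<epsilon>' * p * ((\<alpha> / 2 * p * real (card X)) * (\<alpha> / 2 * p * real (card Y)))"
        by (simp add: power2_eq_square power3_eq_cube)
      also have "\<dots> \<le> \<epsilon>' * p * (real (card (nbrs z X)) * real (card (nbrs z Y)))"
        using z eps' p_pos al by (intro mult_mono mult_left_mono) auto
      finally show "\<bar>\<Sum>x\<in>A. \<Sum>y\<in>B. gr x y - q * p\<bar> \<le> \<epsilon>' * p * real (card (nbrs z X)) * real (card (nbrs z Y))"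
        by (simp add: mult.assoc)
    qed
    then show False using z by simp
  qed
  then have "real (card ?bad) * (\<epsilon>' * (\<alpha> / 2)\<^sup>2) \<le> real (card ?bad') * (\<epsilon>' * (\<alpha> / 2)\<^sup>2)"
    using fin[OF Z] eps' al by (intro mult_right_mono) (auto intro!: card_mono)
  also have "\<dots> \<le> ?r"
  proof (rule irregular_neighbourhood_card[where S = "\<lambda>z. nbrs z Y", OF X Y Z nbrs_subset])
    fix b :: "'b \<Rightarrow> 'b \<Rightarrow> real" assume b: "\<And>y z. b y z = 0 \<or> b y z = 1" "\<And>y z. b y z = 1 \<Longrightarrow> y \<in> nbrs z Y"
    have "b y z \<le> ga y z" for y z
      using b(1)[of y z] b(2)[of y z] gr_le_ga[of y z] ga_bounds(1)[of y z] gr_sym[of y z] by (auto simp: nbrs_def)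
    then show "(\<Sum>x\<in>X. \<Sum>z\<in>Z. ga x z * \<bar>\<Sum>y\<in>Y. (gr x y - q * p) * b y z\<bar>)
      \<le> sqrt (8 * sqrt (16 * \<epsilon> + 34 * \<sigma>) + 32 * \<epsilon> + 110 * \<sigma>) * p ^ 3 * real (card X) * real (card Y) * real (card Z)"
      using b(1) by (intro weighted_dev_ga_sum2[OF X Y Z q _ _ reg eps sg bXY bXZ bYZ])
  qed (use eps sg in auto)
  finally show ?thesis .
qed


section \<open>Embedding along an ordering\<close>

text \<open>A union bound. There are at most \<open>m\<close> degree events and \<open>m^2\<close>
  regularity events, each excluding a proportion \<open>\<rho>\<close> of \<open>W i\<close>; by the
  choice of \<open>\<rho>\<close> they exclude at most a quarter. The at most \<open>m\<close>
  forbidden vertices of \<open>F\<close> do not fill the rest, as \<open>W i\<close> has at least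
  \<open>4 (m + 1)\<close> elements.\<close>

lemma choose_vertex:
  fixes W :: "nat \<Rightarrow> 'b set" and E :: "nat \<Rightarrow> nat \<Rightarrow> bool"
  assumes E_sym: "\<And>j l. E j l \<Longrightarrow> E l j" and i: "i < m"
    and W: "\<And>j. j \<in> {i..<m} \<Longrightarrow> W j \<subseteq> V"
    and beta: "\<And>j l. j \<in> {i..<m} \<Longrightarrow> l \<in> {i..<m} \<Longrightarrow> E j l \<Longrightarrow>
      \<beta> \<le> s * p ^ 3 * sqrt (real (card (W j)) * real (card (W l)))"
    and reg: "\<And>j l. j \<in> {i..<m} \<Longrightarrow> l \<in> {i..<m} \<Longrightarrow> E j l \<Longrightarrow>
      \<exists>q. \<alpha> \<le> q \<and> q \<le> 2 \<and> disc_regular gr p s q (W j) (W l)"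
    and s: "0 < s" "s \<le> 1" "s \<le> \<epsilon>" and al: "0 < \<alpha>" and eps: "0 < \<epsilon>"
    and rho: "\<rho> = 1 / (4 * (real m + 1)\<^sup>2)"
    and s1: "2 * s \<le> \<rho> * \<alpha>" and s2: "sqrt (50 * s) \<le> \<rho> * (\<epsilon> * (\<alpha> / 2))"
    and s3: "sqrt (8 * sqrt (50 * s) + 142 * s) \<le> \<rho> * (\<epsilon> * (\<alpha> / 2)\<^sup>2)"
    and large: "4 * (real m + 1) \<le> real (card (W i))"
    and F: "finite F" "card F \<le> m"
  shows "\<exists>z\<in>W i - F. (\<forall>j\<in>{Suc i..<m}. E i j \<longrightarrow> \<alpha> / 2 * p * real (card (W j)) \<le> real (card (nbrs z (W j)))) \<and>
    (\<forall>j\<in>{Suc i..<m}. \<forall>l\<in>{Suc i..<m}. E j l \<longrightarrow> (\<exists>q. \<alpha> \<le> q \<and> q \<le> 2 \<and>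
       disc_regular gr p \<epsilon> q (if E i j then nbrs z (W j) else W j) (if E i l then nbrs z (W l) else W l)))"
proof -
  let ?J = "{Suc i..<m}"
  define W' where "W' z j = (if E i j then nbrs z (W j) else W j)" for z j
  define deg_ok where "deg_ok z j \<longleftrightarrow> (E i j \<longrightarrow> \<alpha> / 2 * p * real (card (W j)) \<le> real (card (nbrs z (W j))))" for z j
  define reg_ok where "reg_ok z j l \<longleftrightarrow> (\<exists>q. \<alpha> \<le> q \<and> q \<le> 2 \<and> disc_regular gr p \<epsilon> q (W' z j) (W' z l))" for z j l
  define L where "L j = {z \<in> W i. \<not> deg_ok z j}" for j
  \<comment> \<open>The inheritance lemmas speak only about vertices of sufficient degree into the
    cells that shrink; the others are already excluded by \<open>L\<close>.\<close>
  define B where "B j l = {z \<in> W i. E j l \<and> deg_ok z j \<and> deg_ok z l \<and> \<not> reg_ok z j l}" for j l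
  have i_in: "i \<in> {i..<m}" using i by simp
  have J_in: "j \<in> {i..<m}" if "j \<in> ?J" for j using that by simp
  note Wi = W[OF i_in]
  have finWi: "finite (W i)" by (rule fin[OF Wi])
  have s0: "0 \<le> s" using s by simp
  have fifty: "16 * s + 34 * s = 50 * s" "32 * s + 110 * s = 142 * s" by simp_all
  have rho0: "0 < \<rho>" unfolding rho by simp
  have L_le: "real (card (L j)) \<le> \<rho> * real (card (W i))" if j: "j \<in> ?J" for j
  proof (cases "E i j")
    case True
    obtain q where q: "\<alpha> \<le> q" "disc_regular gr p s q (W i) (W j)"
      using reg[OF i_in J_in[OF j] True] by blast
    have "real (card (L j)) * \<alpha> \<le> 2 * s * real (card (W i))"
      using low_degree_card[OF W[OF J_in[OF j]] Wi q(2,1) s0] True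
      by (simp add: L_def deg_ok_def not_le)
    also have "\<dots> \<le> \<rho> * \<alpha> * real (card (W i))" by (rule mult_right_mono[OF s1]) simp
    finally have "\<alpha> * real (card (L j)) \<le> \<alpha> * (\<rho> * real (card (W i)))" by (simp add: mult_ac)
    then show ?thesis using al by simp
  next
    case False
    then show ?thesis using rho0 by (simp add: L_def deg_ok_def)
  qed
  have one: "real (card {z \<in> W i. \<alpha> / 2 * p * real (card (W j)) \<le> real (card (nbrs z (W j))) \<and>
        \<not> disc_regular gr p \<epsilon> q (nbrs z (W j)) (W l)}) \<le> \<rho> * real (card (W i))" (is "real (card ?S) \<le> _")
    if j: "j \<in> ?J" and l: "l \<in> ?J" and E: "E j l" "E i j"
      and q: "\<alpha> \<le> q" "q \<le> 2" "disc_regular gr p s q (W j) (W l)" for j l q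
  proof -
    have "real (card ?S) * (\<epsilon> * (\<alpha> / 2)) \<le> sqrt (16 * s + 34 * s) * real (card (W i))"
      using q al eps by (intro inherit_one_side[OF W[OF J_in[OF j]] W[OF J_in[OF l]] Wi] s0 s(2)
        beta[OF J_in[OF j] J_in[OF l] E(1)] beta[OF J_in[OF j] i_in E_sym[OF E(2)]]) auto
    also have "\<dots> \<le> \<rho> * (\<epsilon> * (\<alpha> / 2)) * real (card (W i))"
      unfolding fifty by (rule mult_right_mono[OF s2]) simp
    finally have "(\<epsilon> * (\<alpha> / 2)) * real (card ?S) \<le> (\<epsilon> * (\<alpha> / 2)) * (\<rho> * real (card (W i)))" by (simp add: mult_ac)
    moreover have "0 < \<epsilon> * (\<alpha> / 2)" using eps al by simp
    ultimately show ?thesis by (simp only: mult_le_cancel_left_pos)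
  qed
  have two: "real (card {z \<in> W i. \<alpha> / 2 * p * real (card (W j)) \<le> real (card (nbrs z (W j))) \<and>
        \<alpha> / 2 * p * real (card (W l)) \<le> real (card (nbrs z (W l))) \<and>
        \<not> disc_regular gr p \<epsilon> q (nbrs z (W j)) (nbrs z (W l))}) \<le> \<rho> * real (card (W i))" (is "real (card ?S) \<le> _")
    if j: "j \<in> ?J" and l: "l \<in> ?J" and E: "E j l" "E i j" "E i l"
      and q: "\<alpha> \<le> q" "q \<le> 2" "disc_regular gr p s q (W j) (W l)" for j l q
  proof -
    have "real (card ?S) * (\<epsilon> * (\<alpha> / 2)\<^sup>2) \<le> sqrt (8 * sqrt (16 * s + 34 * s) + 32 * s + 110 * s) * real (card (W i))"
      using q al eps by (intro inherit_two_sides[OF W[OF J_in[OF j]] W[OF J_in[OF l]] Wi] s0 s(2)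
        beta[OF J_in[OF j] J_in[OF l] E(1)] beta[OF J_in[OF j] i_in E_sym[OF E(2)]] beta[OF J_in[OF l] i_in E_sym[OF E(3)]]) auto
    also have "\<dots> \<le> \<rho> * (\<epsilon> * (\<alpha> / 2)\<^sup>2) * real (card (W i))"
      using mult_right_mono[OF s3, of "real (card (W i))"] unfolding fifty add.assoc by simp
    finally have "(\<epsilon> * (\<alpha> / 2)\<^sup>2) * real (card ?S) \<le> (\<epsilon> * (\<alpha> / 2)\<^sup>2) * (\<rho> * real (card (W i)))" by (simp add: mult_ac)
    moreover have "0 < \<epsilon> * (\<alpha> / 2)\<^sup>2" using eps al by simp
    ultimately show ?thesis by (simp only: mult_le_cancel_left_pos)
  qed
  have B_le: "real (card (B j l)) \<le> \<rho> * real (card (W i))" if j: "j \<in> ?J" and l: "l \<in> ?J" for j l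
  proof (cases "E j l")
    case False
    then show ?thesis using rho0 by (simp add: B_def)
  next
    case E: True
    obtain q where q: "\<alpha> \<le> q" "q \<le> 2" "disc_regular gr p s q (W j) (W l)"
      using reg[OF J_in[OF j] J_in[OF l] E] by blast
    have q': "disc_regular gr p s q (W l) (W j)" by (rule disc_regular_sym[OF q(3) gr_sym])
    have sw: "disc_regular gr p \<epsilon> q X Y \<Longrightarrow> disc_regular gr p \<epsilon> q Y X" for X Y
      by (erule disc_regular_sym) (rule gr_sym)
    have mono: "real (card (B j l)) \<le> r" if "B j l \<subseteq> S" "S \<subseteq> W i" "real (card S) \<le> r" for S r
      using card_mono[OF finite_subset[OF that(2) finWi] that(1)] that(3) by linarith
    consider "E i j" "E i l" | "E i j" "\<not> E i l" | "\<not> E i j" "E i l" | "\<not> E i j" "\<not> E i l" by blast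
    then show ?thesis
    proof cases
      case 1
      show ?thesis
        by (rule mono[OF _ _ two[OF j l E 1 q]]) (use 1 q in \<open>auto simp: B_def deg_ok_def reg_ok_def W'_def\<close>)
    next
      case 2
      show ?thesis
        by (rule mono[OF _ _ one[OF j l E 2(1) q]]) (use 2 q in \<open>auto simp: B_def deg_ok_def reg_ok_def W'_def\<close>)
    next
      case 3
      show ?thesis
        by (rule mono[OF _ _ one[OF l j E_sym[OF E] 3(2) q(1,2) q']])
           (use 3 q sw in \<open>auto simp: B_def deg_ok_def reg_ok_def W'_def\<close>)
    next
      case 4
      have "disc_regular gr p \<epsilon> q (W j) (W l)"
        by (rule disc_regular_mono[OF q(3) s(3)]) (use p_pos in simp)
      then have "B j l = {}" using 4 q unfolding B_def reg_ok_def W'_def by auto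
      then show ?thesis using rho0 by simp
    qed
  qed
  define bad where "bad = (\<Union>j\<in>?J. L j) \<union> (\<Union>u\<in>?J \<times> ?J. B (fst u) (snd u))"
  have cJ: "real (card ?J) \<le> real m" by simp
  have "real (card bad) \<le> real (card (\<Union>j\<in>?J. L j)) + real (card (\<Union>u\<in>?J \<times> ?J. B (fst u) (snd u)))"
    unfolding bad_def using card_Un_le[of "\<Union>j\<in>?J. L j" "\<Union>u\<in>?J \<times> ?J. B (fst u) (snd u)"] by linarith
  also have "\<dots> \<le> (\<Sum>j\<in>?J. real (card (L j))) + (\<Sum>u\<in>?J \<times> ?J. real (card (B (fst u) (snd u))))"
    using card_UN_le[of ?J L] card_UN_le[of "?J \<times> ?J" "\<lambda>u. B (fst u) (snd u)"]
    unfolding of_nat_sum[symmetric] of_nat_add[symmetric] of_nat_le_iff by (intro add_mono) auto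
  also have "\<dots> \<le> (\<Sum>j\<in>?J. \<rho> * real (card (W i))) + (\<Sum>u\<in>?J \<times> ?J. \<rho> * real (card (W i)))"
    by (intro add_mono sum_mono) (auto intro!: L_le B_le simp del: atLeastLessThan_iff)
  also have "\<dots> = (real (card ?J) + real (card ?J) * real (card ?J)) * (\<rho> * real (card (W i)))"
    by (simp add: card_cartesian_product distrib_right)
  also have "\<dots> \<le> (real m + real m * real m) * (\<rho> * real (card (W i)))"
    using rho0 cJ by (intro mult_right_mono add_mono mult_mono) auto
  also have "\<dots> \<le> (real m + 1)\<^sup>2 * (\<rho> * real (card (W i)))"
    using rho0 by (intro mult_right_mono) (auto simp: power2_eq_square algebra_simps)
  also have "\<dots> = real (card (W i)) / 4"
    unfolding rho by (simp add: field_simps)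
  finally have bad: "real (card bad) \<le> real (card (W i)) / 4" .
  have fin_bad: "finite bad"
    unfolding bad_def L_def B_def using finWi by auto
  have "real (card (bad \<union> F)) \<le> real (card bad) + real m"
    using card_Un_le[of bad F] F(2) by linarith
  also have "\<dots> < real (card (W i))" using bad large by simp
  finally have "\<not> W i \<subseteq> bad \<union> F"
    using card_mono[of "bad \<union> F" "W i"] fin_bad F(1) by auto
  then obtain z where z: "z \<in> W i" "z \<notin> F" "z \<notin> bad" by blast
  have degs: "deg_ok z j" if "j \<in> ?J" for j
    using z(1,3) that unfolding bad_def L_def by blast
  have "reg_ok z j l" if "j \<in> ?J" "l \<in> ?J" "E j l" for j l
  proof (rule ccontr)
    assume "\<not> reg_ok z j l"
    then have "z \<in> B j l" using z(1) that degs unfolding B_def by blast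
    then show False using z(3) that unfolding bad_def by fastforce
  qed
  then show ?thesis
    using z(1,2) degs unfolding deg_ok_def reg_ok_def W'_def by blast
qed

end

lemma small_parameter:
  assumes "0 < (t::real)"
  shows "\<exists>s>0. s \<le> 1 \<and> s \<le> t \<and> sqrt (50 * s) \<le> t \<and> sqrt (8 * sqrt (50 * s) + 142 * s) \<le> t"
proof -
  \<comment> \<open>With \<open>s = u^2 / 50\<close> the inner root is exactly \<open>u\<close>, and
    \<open>8 u + 142 u^2 / 50\<close> is at most \<open>11 u\<close> because
    \<open>u \<le> 1\<close>; hence the divisor 11.\<close>
  define u where "u = min 1 (min t (t\<^sup>2 / 11))"
  have u: "0 < u" "u \<le> 1" "u \<le> t" "11 * u \<le> t\<^sup>2"
    using assms by (auto simp: u_def min_def)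
  define s where "s = u\<^sup>2 / 50"
  have uu: "u\<^sup>2 \<le> u" using u by (simp add: power2_eq_square mult_left_le)
  have sq: "sqrt (50 * s) = u" using u by (simp add: s_def)
  have "8 * sqrt (50 * s) + 142 * s \<le> t\<^sup>2" unfolding sq using u uu by (simp add: s_def)
  then have "sqrt (8 * sqrt (50 * s) + 142 * s) \<le> t"
    using assms by (intro real_le_lsqrt) auto
  moreover have "0 < s" "s \<le> 1" "s \<le> t" using u uu by (auto simp: s_def)
  ultimately show ?thesis using sq u by auto
qed

section \<open>Back degrees and the recursive embedding\<close>

lemma card_earlier_Suc:
  "card {h. h < Suc i \<and> P h} = card {h. h < i \<and> P h} + (if P i then 1 else 0)"
proof -
  have "{h. h < Suc i \<and> P h} = (if P i then insert i {h. h < i \<and> P h} else {h. h < i \<and> P h})"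
    by (auto simp: less_Suc_eq)
  then show ?thesis by simp
qed

lemma card_earlier_mono: "i \<le> j \<Longrightarrow> card {h::nat. h < i \<and> P h} \<le> card {h. h < j \<and> P h}"
  by (intro card_mono) auto

text \<open>Let \<open>g\<close> be the last neighbour of \<open>i\<close> before \<open>i\<close>.
  The 2-degeneracy condition on the edge \<open>g i\<close> bounds the neighbours of
  \<open>i\<close> before \<open>g\<close> by \<open>2 d\<close>, and only \<open>g\<close> itself
  is missing. This is the origin of the exponent \<open>2 d + 1\<close> in the size condition of
  \<open>completable\<close>.\<close>

lemma back_degree_le:
  fixes E :: "nat \<Rightarrow> nat \<Rightarrow> bool"
  assumes deg: "\<And>i j. i < j \<Longrightarrow> j < m \<Longrightarrow> E i j \<Longrightarrow>
      real (card {h. h < i \<and> E h i} + card {h. h < i \<and> E h j}) \<le> 2 * d"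
    and "0 \<le> d" "i < m"
  shows "real (card {h. h < i \<and> E h i}) \<le> 2 * d + 1"
proof (cases "{h. h < i \<and> E h i} = {}")
  case False
  define g where "g = Max {h. h < i \<and> E h i}"
  have "g \<in> {h. h < i \<and> E h i}" unfolding g_def using False by (intro Max_in) auto
  then have g: "g < i" "E g i" by auto
  have "{h. h < i \<and> E h i} \<subseteq> insert g {h. h < g \<and> E h i}"
  proof
    fix h assume h: "h \<in> {h. h < i \<and> E h i}"
    then have "h \<le> g" unfolding g_def by (intro Max_ge) auto
    then show "h \<in> insert g {h. h < g \<and> E h i}" using h by auto
  qed
  then have "card {h. h < i \<and> E h i} \<le> card (insert g {h. h < g \<and> E h i})"
    by (intro card_mono) auto
  also have "\<dots> \<le> Suc (card {h. h < g \<and> E h i})" by (rule card_insert_le_m1) auto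
  finally show ?thesis using deg[OF g(1) \<open>i < m\<close> g(2)] by simp
next
  case True
  then show ?thesis using \<open>0 \<le> d\<close> by (simp only: True card.empty)
qed

text \<open>
  The vertices before \<open>i\<close> are embedded already, with images in \<open>F\<close>, and \<open>W j\<close> is the set of
  candidates for \<open>j\<close>; these sets need not be disjoint. The first argument only fixes the type of the host
  graph's vertices.
\<close>

definition completable ::
  "'b itself \<Rightarrow> (nat \<Rightarrow> nat \<Rightarrow> bool) \<Rightarrow> nat \<Rightarrow> real \<Rightarrow> real \<Rightarrow> nat \<Rightarrow> real \<Rightarrow> real \<Rightarrow> real \<Rightarrow> bool" where
  "completable _ E m d \<alpha> i \<epsilon> \<kappa> \<sigma> \<longleftrightarrow> (\<forall>(V :: 'b set) ga gr p \<beta> W F.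
    jumbled_subgraph V ga gr p \<beta> \<longrightarrow>
    (\<forall>j\<in>{i..<m}. W j \<subseteq> V \<and> \<kappa> * p ^ card {h. h < i \<and> E h j} * real (card V) \<le> real (card (W j))) \<longrightarrow>
    (\<forall>j\<in>{i..<m}. \<forall>l\<in>{i..<m}. E j l \<longrightarrow> (\<exists>q. \<alpha> \<le> q \<and> q \<le> 2 \<and> disc_regular gr p \<epsilon> q (W j) (W l))) \<longrightarrow>
    \<beta> \<le> \<sigma> * p powr (d + 3) * real (card V) \<longrightarrow> 1 / \<sigma> \<le> real (card V) * p powr (2 * d + 1) \<longrightarrow>
    finite F \<longrightarrow> card F \<le> i \<longrightarrow>
    (\<exists>\<phi>. inj_on \<phi> {i..<m} \<and> (\<forall>j\<in>{i..<m}. \<phi> j \<in> W j - F) \<and>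
      (\<forall>j\<in>{i..<m}. \<forall>l\<in>{i..<m}. E j l \<longrightarrow> gr (\<phi> j) (\<phi> l) = 1)))"

text \<open>
  It is essential that \<open>\<epsilon>\<close> does not depend on \<open>\<kappa>\<close>: the size \<open>\<kappa>\<close> of the cells is known only after the
  regularity lemma has been applied with \<open>\<epsilon>\<close>.
\<close>

lemma embedding:
  fixes E :: "nat \<Rightarrow> nat \<Rightarrow> bool" and d \<alpha> :: real
  assumes E_sym: "\<And>j l. E j l \<Longrightarrow> E l j" and E_irrefl: "\<And>j. \<not> E j j"
    and deg: "\<And>i j. i < j \<Longrightarrow> j < m \<Longrightarrow> E i j \<Longrightarrow>
      real (card {h. h < i \<and> E h i} + card {h. h < i \<and> E h j}) \<le> 2 * d"
    and d: "0 \<le> d" and al: "0 < \<alpha>" "\<alpha> \<le> 1"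
  shows "k \<le> m \<Longrightarrow> \<exists>\<epsilon>>0. \<forall>\<kappa>>0. \<exists>\<sigma>>0. completable TYPE('b) E m d \<alpha> (m - k) \<epsilon> \<kappa> \<sigma>"
proof (induction k)
  case 0
  have "completable TYPE('b) E m d \<alpha> (m - 0) 1 \<kappa> 1" for \<kappa>
    unfolding completable_def by auto
  then show ?case using zero_less_one by blast
next
  case (Suc k)
  \<comment> \<open>\<open>k\<close> counts the vertices still to be embedded and \<open>i\<close>
    is the next one. The induction thus fixes the tolerance of the last vertices first and makes the
    tolerance at \<open>i\<close> small depending on it.\<close>
  define i where "i = m - Suc k"
  have i: "i < m" "m - k = Suc i" "m - Suc k = i" using Suc.prems by (auto simp: i_def)
  obtain \<epsilon>' where eps': "0 < \<epsilon>'" and IH0: "\<forall>\<kappa>>0. \<exists>\<sigma>>0. completable TYPE('b) E m d \<alpha> (Suc i) \<epsilon>' \<kappa> \<sigma>"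
    using Suc.IH Suc.prems(1) unfolding i(2) by auto
  define \<rho> where "\<rho> = 1 / (4 * (real m + 1)\<^sup>2)"
  have rho0: "0 < \<rho>" by (simp add: \<rho>_def)
  \<comment> \<open>The minimum collects the upper bounds on \<open>s\<close> and on the two roots
    that \<open>choose_vertex\<close> demands.\<close>
  define t where "t = min \<epsilon>' (min (\<rho> * \<alpha> / 2) (min (\<rho> * (\<epsilon>' * (\<alpha> / 2))) (\<rho> * (\<epsilon>' * (\<alpha> / 2)\<^sup>2))))"
  have "0 < t" unfolding t_def using eps' rho0 al by simp
  then obtain s where s: "0 < s" "s \<le> 1" "s \<le> t" "sqrt (50 * s) \<le> t" "sqrt (8 * sqrt (50 * s) + 142 * s) \<le> t"
    using small_parameter by blast
  show ?case
  proof (rule exI[of _ s], rule conjI[OF s(1)], intro allI impI)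
    fix \<kappa> :: real assume kappa: "0 < \<kappa>"
    \<comment> \<open>A cell adjacent to \<open>i\<close> shrinks by a factor
      \<open>\<alpha>/2 * p\<close>; the \<open>p\<close> is recorded in the exponent, the constant
      is absorbed here.\<close>
    define \<kappa>' where "\<kappa>' = \<kappa> * (\<alpha> / 2)"
    have kap: "0 < \<kappa>'" "\<kappa>' \<le> \<kappa>" using kappa al by (auto simp: \<kappa>'_def)
    obtain \<sigma>' where sg': "0 < \<sigma>'" and IH: "completable TYPE('b) E m d \<alpha> (Suc i) \<epsilon>' \<kappa>' \<sigma>'"
      using IH0[rule_format, OF kap(1)] by (elim exE conjE)
    \<comment> \<open>\<open>\<sigma>'\<close> serves the induction hypothesis,
      \<open>\<kappa> * s\<close> brings \<open>\<beta>\<close> below the threshold of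
      \<open>choose_vertex\<close>, and the last term makes \<open>W i\<close> large enough to avoid
      \<open>F\<close>.\<close>
    define \<sigma> where "\<sigma> = min \<sigma>' (min (\<kappa> * s) (\<kappa> / (4 * (real m + 1))))"
    have sg: "0 < \<sigma>" "\<sigma> \<le> \<sigma>'" "\<sigma> \<le> \<kappa> * s" "\<sigma> \<le> \<kappa> / (4 * (real m + 1))"
      unfolding \<sigma>_def using sg' kappa s by auto
    show "\<exists>\<sigma>>0. completable TYPE('b) E m d \<alpha> (m - Suc k) s \<kappa> \<sigma>"
    proof (rule exI[of _ \<sigma>], rule conjI[OF sg(1)], unfold i(3) completable_def, intro allI impI)
      fix V :: "'b set" and ga gr p \<beta> and W :: "nat \<Rightarrow> 'b set" and F :: "'b set"
      assume J: "jumbled_subgraph V ga gr p \<beta>"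
        and W: "\<forall>j\<in>{i..<m}. W j \<subseteq> V \<and> \<kappa> * p ^ card {h. h < i \<and> E h j} * real (card V) \<le> real (card (W j))"
        and reg: "\<forall>j\<in>{i..<m}. \<forall>l\<in>{i..<m}. E j l \<longrightarrow> (\<exists>q. \<alpha> \<le> q \<and> q \<le> 2 \<and> disc_regular gr p s q (W j) (W l))"
        and beta: "\<beta> \<le> \<sigma> * p powr (d + 3) * real (card V)"
        and large: "1 / \<sigma> \<le> real (card V) * p powr (2 * d + 1)"
        and F: "finite F" "card F \<le> i"
      interpret jumbled_subgraph V ga gr p \<beta> by (rule J)
      define n where "n = real (card V)"
      have n0: "0 \<le> n" by (simp add: n_def)
      \<comment> \<open>Here \<open>d + 3\<close> is used. For an edge \<open>j l\<close> with
        \<open>i \<le> j < l\<close>, the neighbours counted before \<open>i\<close> are among those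
        before \<open>j\<close>, so the two exponents add up to at most \<open>2 d\<close>. Only
        their sum is controlled, which is why the product of the cell sizes is compared with a
        square.\<close>
      have beta_ij: "\<beta> \<le> s * p ^ 3 * sqrt (real (card (W j)) * real (card (W l)))"
        if j: "j \<in> {i..<m}" and l: "l \<in> {i..<m}" and E: "E j l" and jl: "j < l" for j l
      proof -
        have "real (card {h. h < i \<and> E h j} + card {h. h < i \<and> E h l}) \<le> real (card {h. h < j \<and> E h j} + card {h. h < j \<and> E h l})"
          using j by (intro of_nat_mono add_mono card_earlier_mono) auto
        also have "\<dots> \<le> 2 * d" using l by (intro deg jl E) auto
        finally have e: "real (card {h. h < i \<and> E h j} + card {h. h < i \<and> E h l}) \<le> 2 * d" .
        have "(\<kappa> * p powr d * n)\<^sup>2 = \<kappa>\<^sup>2 * p powr (2 * d) * n\<^sup>2"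
        proof -
          have "(p powr d)\<^sup>2 = p powr (2 * d)" unfolding power2_eq_square mult_2 powr_add ..
          then show ?thesis by (simp add: power_mult_distrib)
        qed
        also have "\<dots> \<le> \<kappa>\<^sup>2 * p powr (real (card {h. h < i \<and> E h j} + card {h. h < i \<and> E h l})) * n\<^sup>2"
          using p_pos p_le by (intro mult_right_mono mult_left_mono powr_mono' e) auto
        also have "\<dots> = (\<kappa> * p ^ card {h. h < i \<and> E h j} * n) * (\<kappa> * p ^ card {h. h < i \<and> E h l} * n)"
          using p_pos by (simp only: powr_realpow power_add) (simp add: power2_eq_square mult_ac)
        also have "\<dots> \<le> real (card (W j)) * real (card (W l))"
          using W j l p_pos n0 kappa by (intro mult_mono) (auto simp: n_def)
        finally have "\<kappa> * p powr d * n \<le> sqrt (real (card (W j)) * real (card (W l)))"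
          by (rule real_le_rsqrt)
        then have "s * p ^ 3 * (\<kappa> * p powr d * n) \<le> s * p ^ 3 * sqrt (real (card (W j)) * real (card (W l)))"
          using s p_pos by (intro mult_left_mono) auto
        moreover have "\<beta> \<le> s * p ^ 3 * (\<kappa> * p powr d * n)"
        proof -
          have "p powr (d + 3) = p powr d * p ^ 3"
            using p_pos by (simp add: powr_add)
          moreover have "\<sigma> * p powr (d + 3) * n \<le> \<kappa> * s * p powr (d + 3) * n"
            using sg n0 by (intro mult_right_mono) auto
          ultimately show ?thesis using beta by (simp add: n_def mult_ac)
        qed
        ultimately show ?thesis by linarith
      qed
      have beta': "\<beta> \<le> s * p ^ 3 * sqrt (real (card (W j)) * real (card (W l)))"
        if j: "j \<in> {i..<m}" and l: "l \<in> {i..<m}" and E: "E j l" for j l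
      proof -
        consider "j < l" | "l < j" using E E_irrefl by (metis linorder_neqE_nat)
        then show ?thesis
          by cases (use beta_ij[OF j l E] beta_ij[OF l j E_sym[OF E]] in \<open>simp_all add: mult.commute[of "real (card (W l))"]\<close>)
      qed
      have Wi_large: "4 * (real m + 1) \<le> real (card (W i))"
      proof -
        have "4 * (real m + 1) \<le> \<kappa> / \<sigma>"
          using sg kappa by (simp add: field_simps)
        also have "\<kappa> / \<sigma> \<le> \<kappa> * (n * p powr (2 * d + 1))"
          using mult_left_mono[OF large, of \<kappa>] kappa by (simp add: n_def)
        also have "\<dots> \<le> \<kappa> * (n * p powr (real (card {h. h < i \<and> E h i})))"
          using p_pos p_le n0 kappa back_degree_le[OF deg d i(1)]
          by (intro mult_left_mono powr_mono') auto
        also have "\<dots> \<le> real (card (W i))"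
          using W i(1) p_pos by (auto simp: n_def powr_realpow mult_ac)
        finally show ?thesis .
      qed
      have "\<exists>z\<in>W i - F. (\<forall>j\<in>{Suc i..<m}. E i j \<longrightarrow> \<alpha> / 2 * p * real (card (W j)) \<le> real (card (nbrs z (W j)))) \<and>
        (\<forall>j\<in>{Suc i..<m}. \<forall>l\<in>{Suc i..<m}. E j l \<longrightarrow> (\<exists>q. \<alpha> \<le> q \<and> q \<le> 2 \<and>
         disc_regular gr p \<epsilon>' q (if E i j then nbrs z (W j) else W j) (if E i l then nbrs z (W l) else W l)))"
      proof (rule choose_vertex[where E = E and i = i and m = m and W = W and s = s and \<rho> = \<rho>])
        show "E l j" if "E j l" for j l using that by (rule E_sym)
        show "\<beta> \<le> s * p ^ 3 * sqrt (real (card (W j)) * real (card (W l)))"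
          if "j \<in> {i..<m}" "l \<in> {i..<m}" "E j l" for j l
          using that by (rule beta')
        show "2 * s \<le> \<rho> * \<alpha>" "sqrt (50 * s) \<le> \<rho> * (\<epsilon>' * (\<alpha> / 2))" "s \<le> \<epsilon>'"
          "sqrt (8 * sqrt (50 * s) + 142 * s) \<le> \<rho> * (\<epsilon>' * (\<alpha> / 2)\<^sup>2)"
          using s(3-5) by (auto simp: t_def)
      qed (use W reg F i s(1,2) al(1) eps' \<rho>_def Wi_large in auto)
      then obtain z where z: "z \<in> W i" "z \<notin> F"
        and degz: "\<And>j. j \<in> {Suc i..<m} \<Longrightarrow> E i j \<Longrightarrow> \<alpha> / 2 * p * real (card (W j)) \<le> real (card (nbrs z (W j)))"
        and regz: "\<forall>j\<in>{Suc i..<m}. \<forall>l\<in>{Suc i..<m}. E j l \<longrightarrow> (\<exists>q. \<alpha> \<le> q \<and> q \<le> 2 \<and>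
         disc_regular gr p \<epsilon>' q (if E i j then nbrs z (W j) else W j) (if E i l then nbrs z (W l) else W l))"
        by blast
      define W' where "W' j = (if E i j then nbrs z (W j) else W j)" for j
      have "W' j \<subseteq> V \<and> \<kappa>' * p ^ card {h. h < Suc i \<and> E h j} * n \<le> real (card (W' j))" if j: "j \<in> {Suc i..<m}" for j
      proof -
        have Wj: "W j \<subseteq> V" "\<kappa> * p ^ card {h. h < i \<and> E h j} * n \<le> real (card (W j))"
          using W j by (auto simp: n_def)
        show ?thesis
        proof (cases "E i j")
          case True
          have "\<kappa>' * p ^ card {h. h < Suc i \<and> E h j} * n = \<alpha> / 2 * p * (\<kappa> * p ^ card {h. h < i \<and> E h j} * n)"
            using True by (simp add: card_earlier_Suc \<kappa>'_def)
          also have "\<dots> \<le> \<alpha> / 2 * p * real (card (W j))"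
            using al p_pos by (intro mult_left_mono Wj) auto
          also have "\<dots> \<le> real (card (nbrs z (W j)))" by (rule degz[OF j True])
          finally show ?thesis using True Wj nbrs_subset[of z "W j"] by (auto simp: W'_def)
        next
          case False
          have "\<kappa>' * p ^ card {h. h < Suc i \<and> E h j} * n \<le> \<kappa> * p ^ card {h. h < i \<and> E h j} * n"
            using False kap p_pos n0 by (simp add: card_earlier_Suc mult_right_mono)
          then show ?thesis using False Wj by (auto simp: W'_def)
        qed
      qed
      moreover have "\<beta> \<le> \<sigma>' * p powr (d + 3) * n"
        using beta mult_right_mono[OF sg(2), of "p powr (d + 3) * n"] n0 by (simp add: n_def mult.assoc)
      moreover have "1 / \<sigma>' \<le> n * p powr (2 * d + 1)"
        using large frac_le[of 1 1 \<sigma> \<sigma>'] sg by (simp add: n_def)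
      moreover have "card (insert z F) \<le> Suc i"
        using F z by simp
      ultimately obtain \<phi> where inj: "inj_on \<phi> {Suc i..<m}" and phi: "\<And>j. j \<in> {Suc i..<m} \<Longrightarrow> \<phi> j \<in> W' j - insert z F"
        and edge: "\<And>j l. j \<in> {Suc i..<m} \<Longrightarrow> l \<in> {Suc i..<m} \<Longrightarrow> E j l \<Longrightarrow> gr (\<phi> j) (\<phi> l) = 1"
        using IH[unfolded completable_def, rule_format, of V ga gr p \<beta> W' "insert z F", OF J] regz F(1) unfolding n_def W'_def[symmetric] by blast
      have ins: "{i..<m} = insert i {Suc i..<m}" using i(1) by auto
      let ?\<phi> = "\<phi>(i := z)"
      have "\<forall>j\<in>{Suc i..<m}. \<phi> j \<noteq> z \<and> z \<noteq> \<phi> j" using phi by blast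
      then have "inj_on ?\<phi> {i..<m}"
        unfolding ins using inj by (auto simp: inj_on_def)
      moreover have "\<forall>j\<in>{i..<m}. ?\<phi> j \<in> W j - F"
        using z phi nbrs_subset unfolding ins W'_def by (fastforce split: if_splits)
      moreover have "?\<phi> l \<in> nbrs z (W l)" if "l \<in> {Suc i..<m}" "E i l" for l
        using phi[OF that(1)] that by (auto simp: W'_def)
      then have zl: "gr z (\<phi> l) = 1" if "l \<in> {Suc i..<m}" "E i l" for l
        using that by (force simp: nbrs_def)
      have "\<forall>j\<in>{i..<m}. \<forall>l\<in>{i..<m}. E j l \<longrightarrow> gr (?\<phi> j) (?\<phi> l) = 1"
      proof (intro ballI impI)
        fix j l assume jl: "j \<in> {i..<m}" "l \<in> {i..<m}" "E j l"
        then consider "j = i" "l \<in> {Suc i..<m}" | "l = i" "j \<in> {Suc i..<m}" | "j \<in> {Suc i..<m}" "l \<in> {Suc i..<m}"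
          using E_irrefl unfolding ins by blast
        then show "gr (?\<phi> j) (?\<phi> l) = 1"
        proof cases
          case 1
          then show ?thesis using zl jl by auto
        next
          case 2
          then show ?thesis using zl[of j] E_sym[OF jl(3)] gr_sym[of z] by auto
        next
          case 3
          then show ?thesis using edge jl by auto
        qed
      qed
      ultimately show "\<exists>\<phi>. inj_on \<phi> {i..<m} \<and> (\<forall>j\<in>{i..<m}. \<phi> j \<in> W j - F) \<and>
        (\<forall>j\<in>{i..<m}. \<forall>l\<in>{i..<m}. E j l \<longrightarrow> gr (\<phi> j) (\<phi> l) = 1)" by blast
    qed
  qed
qed

section \<open>Sparse regularity\<close>

text \<open>Partitions are generated by a family \<open>S\<close> of sets: the cells are the atoms
  of its Boolean algebra, and refining the partition means enlarging \<open>S\<close>. A cell is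
  addressed by a vertex in it, so that cell-wise quantities become functions of vertices.\<close>

definition atom :: "'b set \<Rightarrow> 'b set set \<Rightarrow> 'b \<Rightarrow> 'b set" where
  "atom V S x = {y \<in> V. \<forall>A\<in>S. x \<in> A \<longleftrightarrow> y \<in> A}"

definition dens :: "('b \<Rightarrow> 'b \<Rightarrow> real) \<Rightarrow> 'b set \<Rightarrow> 'b set \<Rightarrow> real" where
  "dens w A B = (\<Sum>x\<in>A. \<Sum>y\<in>B. w x y) / (real (card A) * real (card B))"

text \<open>Conditional expectation of \<open>h\<close> with respect to the partition.\<close>

definition avg :: "'b set \<Rightarrow> 'b set set \<Rightarrow> ('b \<Rightarrow> real) \<Rightarrow> 'b \<Rightarrow> real" where
  "avg V S h x = (\<Sum>u\<in>atom V S x. h u) / real (card (atom V S x))"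

lemma atom_self: "x \<in> V \<Longrightarrow> x \<in> atom V S x"
  and atom_subset: "atom V S x \<subseteq> V"
  and atom_eq: "y \<in> atom V S x \<Longrightarrow> atom V S y = atom V S x"
  and atom_sym: "x \<in> V \<Longrightarrow> y \<in> atom V S x \<Longrightarrow> x \<in> atom V S y"
  by (auto simp: atom_def)

lemma atom_mono: "S \<subseteq> S' \<Longrightarrow> atom V S' x \<subseteq> atom V S x"
  by (auto simp: atom_def)

lemma atom_fibre: "A \<in> atom V S ` V \<Longrightarrow> {x. x \<in> V \<and> atom V S x = A} = A"
  using atom_self[of _ V S] atom_subset[of V S] atom_eq[of _ V S] by blast

lemma finite_atom: "finite V \<Longrightarrow> finite (atom V S x)"
  by (rule finite_subset[OF atom_subset])

lemma card_atom_pos: "finite V \<Longrightarrow> x \<in> V \<Longrightarrow> 0 < card (atom V S x)"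
  using finite_atom atom_self by (metis card_gt_0_iff empty_iff)

lemma card_atoms_le:
  assumes "finite S"
  shows "card (atom V S ` V) \<le> 2 ^ card S"
proof -
  have "atom V S x = (\<lambda>T. {y \<in> V. {A \<in> S. y \<in> A} = T}) {A \<in> S. x \<in> A}" for x
    by (auto simp: atom_def)
  then have "atom V S ` V \<subseteq> (\<lambda>T. {y \<in> V. {A \<in> S. y \<in> A} = T}) ` Pow S"
    by blast
  then have "card (atom V S ` V) \<le> card (Pow S)"
    using assms by (intro surj_card_le) auto
  then show ?thesis using assms by (simp add: card_Pow)
qed

text \<open>Conditional expectation is self-adjoint: its kernel, the indicator of a common atom
  divided by the size of that atom, is symmetric in the two vertices.\<close>

lemma avg_adjoint:
  assumes fin: "finite V" and inv: "\<And>x u. x \<in> V \<Longrightarrow> u \<in> atom V S x \<Longrightarrow> k u = k x"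
  shows "(\<Sum>x\<in>V. avg V S h x * k x) = (\<Sum>x\<in>V. h x * k x)"
proof -
  let ?c = "\<lambda>x. real (card (atom V S x))"
  have "(\<Sum>x\<in>V. avg V S h x * k x) = (\<Sum>x\<in>V. \<Sum>u\<in>V. if u \<in> atom V S x then h u * k x / ?c x else 0)"
  proof (rule sum.cong[OF refl])
    fix x assume "x \<in> V"
    have "(\<Sum>u\<in>V. if u \<in> atom V S x then h u * k x / ?c x else 0) = (\<Sum>u\<in>atom V S x. h u * k x / ?c x)"
      using fin atom_subset[of V S x] by (simp add: sum.If_cases Int_absorb1)
    then show "avg V S h x * k x = (\<Sum>u\<in>V. if u \<in> atom V S x then h u * k x / ?c x else 0)"
      by (simp add: avg_def sum_distrib_right sum_divide_distrib)
  qed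
  also have "\<dots> = (\<Sum>u\<in>V. \<Sum>x\<in>V. if x \<in> atom V S u then h u * k u / ?c u else 0)"
  proof (subst sum.swap, intro sum.cong refl)
    fix x u assume xu: "u \<in> V" "x \<in> V"
    show "(if u \<in> atom V S x then h u * k x / ?c x else 0) = (if x \<in> atom V S u then h u * k u / ?c u else 0)"
    proof (cases "u \<in> atom V S x")
      case True
      then show ?thesis using atom_sym[OF xu(2) True] inv[OF xu(2) True] atom_eq[OF True] by simp
    next
      case False
      then show ?thesis using atom_sym[OF xu(1), of x S] by auto
    qed
  qed
  also have "\<dots> = (\<Sum>u\<in>V. h u * k u)"
  proof (rule sum.cong[OF refl])
    fix u assume "u \<in> V"
    then show "(\<Sum>x\<in>V. if x \<in> atom V S u then h u * k u / ?c u else 0) = h u * k u"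
      using fin atom_subset[of V S u] card_atom_pos[OF fin, of u S] by (simp add: sum.If_cases Int_absorb1)
  qed
  finally show ?thesis .
qed

lemma dens_eq_avg: "dens w (atom V S x) (atom V S y) = avg V S (\<lambda>u. avg V S (w u) y) x"
  by (simp add: dens_def avg_def sum_divide_distrib sum_distrib_right mult.commute)

text \<open>\<open>avg_adjoint\<close> in each variable in turn. Replacing \<open>w\<close> by its
  cell densities is an orthogonal projection, so it is invisible to kernels constant on pairs of
  atoms. Such kernels will be coarser densities, indicators of witness sets and indicators of sparse
  pairs.\<close>

lemma dens_adjoint:
  assumes fin: "finite V"
    and inv1: "\<And>x u y. x \<in> V \<Longrightarrow> u \<in> atom V S x \<Longrightarrow> K u y = K x y"
    and inv2: "\<And>x y v. y \<in> V \<Longrightarrow> v \<in> atom V S y \<Longrightarrow> K x v = K x y"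
  shows "(\<Sum>x\<in>V. \<Sum>y\<in>V. dens w (atom V S x) (atom V S y) * K x y) = (\<Sum>x\<in>V. \<Sum>y\<in>V. w x y * K x y)"
proof -
  have "(\<Sum>x\<in>V. \<Sum>y\<in>V. dens w (atom V S x) (atom V S y) * K x y)
      = (\<Sum>y\<in>V. \<Sum>x\<in>V. avg V S (\<lambda>u. avg V S (w u) y) x * K x y)"
    unfolding dens_eq_avg by (rule sum.swap)
  also have "\<dots> = (\<Sum>y\<in>V. \<Sum>x\<in>V. avg V S (w x) y * K x y)"
    by (intro sum.cong refl avg_adjoint[OF fin] inv1)
  also have "\<dots> = (\<Sum>x\<in>V. \<Sum>y\<in>V. avg V S (w x) y * K x y)"
    by (rule sum.swap)
  also have "\<dots> = (\<Sum>x\<in>V. \<Sum>y\<in>V. w x y * K x y)"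
    by (intro sum.cong refl avg_adjoint[OF fin] inv2)
  finally show ?thesis .
qed

lemma sum_atoms:
  assumes "finite V"
  shows "(\<Sum>x\<in>V. h x) = (\<Sum>A\<in>atom V S ` V. \<Sum>x\<in>A. h x)"
  unfolding sum.image_gen[OF assms, of h "atom V S"] by (intro sum.cong refl) (simp add: atom_fibre)

lemma sum_atoms2:
  assumes "finite V"
  shows "(\<Sum>x\<in>V. \<Sum>y\<in>V. g x y) = (\<Sum>A\<in>atom V S ` V. \<Sum>B\<in>atom V S ` V. \<Sum>x\<in>A. \<Sum>y\<in>B. g x y)"
proof -
  have "(\<Sum>x\<in>V. \<Sum>y\<in>V. g x y) = (\<Sum>A\<in>atom V S ` V. \<Sum>x\<in>A. \<Sum>B\<in>atom V S ` V. \<Sum>y\<in>B. g x y)"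
    unfolding sum_atoms[OF assms, symmetric] ..
  also have "\<dots> = (\<Sum>A\<in>atom V S ` V. \<Sum>B\<in>atom V S ` V. \<Sum>x\<in>A. \<Sum>y\<in>B. g x y)"
    by (intro sum.cong[OF refl] sum.swap)
  finally show ?thesis .
qed

lemma sum_inverse_card_atom:
  assumes "finite V"
  shows "(\<Sum>x\<in>V. 1 / real (card (atom V S x))) = real (card (atom V S ` V))"
proof -
  have "(\<Sum>x\<in>V. 1 / real (card (atom V S x))) = (\<Sum>A\<in>atom V S ` V. \<Sum>x\<in>A. 1 / real (card (atom V S x)))"
    by (rule sum_atoms[OF assms])
  also have "\<dots> = (\<Sum>A\<in>atom V S ` V. 1)"
  proof (rule sum.cong[OF refl])
    fix A assume "A \<in> atom V S ` V"
    then obtain a where a: "a \<in> V" "A = atom V S a" by auto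
    have "(\<Sum>x\<in>A. 1 / real (card (atom V S x))) = (\<Sum>x\<in>A. 1 / real (card A))"
      using a atom_eq[of _ V S a] by (intro sum.cong) auto
    then show "(\<Sum>x\<in>A. 1 / real (card (atom V S x))) = 1"
      using card_atom_pos[OF assms a(1), of S] a by simp
  qed
  finally show ?thesis by simp
qed

lemma square_sum_le: "(a + b)\<^sup>2 \<le> 2 * a\<^sup>2 + 2 * (b::real)\<^sup>2"
  using zero_le_power2[of "a - b"] by (simp add: power2_eq_square algebra_simps)

text \<open>The index of the classical regularity argument. Summing over vertices supplies the
  weights \<open>|A| |B|\<close> of the pairs of cells; there is no normalisation, so the natural
  scale is \<open>p^2 |V|^2\<close>.\<close>

definition energy :: "'b set \<Rightarrow> ('b \<Rightarrow> 'b \<Rightarrow> real) \<Rightarrow> 'b set set \<Rightarrow> real" where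
  "energy V w S = (\<Sum>x\<in>V. \<Sum>y\<in>V. (dens w (atom V S x) (atom V S y))\<^sup>2)"

text \<open>Pythagoras: the densities of the coarser partition are the projection of those of the
  finer one, so the mixed term equals the energy of the coarser partition.\<close>

lemma energy_diff:
  assumes fin: "finite V" and SS: "S \<subseteq> S'"
  shows "(\<Sum>x\<in>V. \<Sum>y\<in>V. (dens w (atom V S' x) (atom V S' y) - dens w (atom V S x) (atom V S y))\<^sup>2)
    = energy V w S' - energy V w S"
proof -
  define f where "f x y = dens w (atom V S x) (atom V S y)" for x y
  define f' where "f' x y = dens w (atom V S' x) (atom V S' y)" for x y
  have inv: "atom V S u = atom V S x" if "u \<in> atom V S' x" for u x
    using atom_eq[of u V S x] atom_mono[OF SS] that by blast
  have "(\<Sum>x\<in>V. \<Sum>y\<in>V. f' x y * f x y) = (\<Sum>x\<in>V. \<Sum>y\<in>V. w x y * f x y)"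
    unfolding f'_def by (rule dens_adjoint[OF fin]) (simp_all add: f_def inv)
  also have "\<dots> = (\<Sum>x\<in>V. \<Sum>y\<in>V. f x y * f x y)"
  proof -
    have "(\<Sum>x\<in>V. \<Sum>y\<in>V. dens w (atom V S x) (atom V S y) * f x y) = (\<Sum>x\<in>V. \<Sum>y\<in>V. w x y * f x y)"
      by (rule dens_adjoint[OF fin]) (simp_all add: f_def atom_eq)
    then show ?thesis by (simp only: f_def)
  qed
  finally have cross: "(\<Sum>x\<in>V. \<Sum>y\<in>V. f' x y * f x y) = (\<Sum>x\<in>V. \<Sum>y\<in>V. f x y * f x y)" .
  have "(\<Sum>x\<in>V. \<Sum>y\<in>V. (f' x y - f x y)\<^sup>2)
     = (\<Sum>x\<in>V. \<Sum>y\<in>V. (f' x y)\<^sup>2) - 2 * (\<Sum>x\<in>V. \<Sum>y\<in>V. f' x y * f x y) + (\<Sum>x\<in>V. \<Sum>y\<in>V. f x y * f x y)"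
    unfolding sum_distrib_left sum_subtractf[symmetric] sum.distrib[symmetric]
    by (intro sum.cong refl) (simp add: power2_eq_square algebra_simps)
  also have "\<dots> = energy V w S' - energy V w S"
    unfolding cross by (simp add: energy_def f_def f'_def power2_eq_square)
  finally show ?thesis by (simp add: f_def f'_def)
qed

context jumbled_subgraph
begin

text \<open>
  Small atoms, on which the density may exceed \<open>2 p\<close>, do no harm, because
  \<open>\<Sum> 1 / (|A(x)| |A(y)|)\<close> is the square of the number of atoms.
\<close>

lemma energy_le:
  assumes S: "finite S" and beta: "\<beta> * 2 ^ card S \<le> p * real (card V)"
  shows "energy V gr S \<le> 4 * p\<^sup>2 * (real (card V))\<^sup>2"
proof -
  let ?a = "\<lambda>x. real (card (atom V S x))"
  have a_pos: "0 < ?a x" if "x \<in> V" for x using card_atom_pos[OF finV that] by simp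
  have "energy V gr S \<le> (\<Sum>x\<in>V. \<Sum>y\<in>V. 2 * p\<^sup>2 + 2 * \<beta>\<^sup>2 * (1 / ?a x * (1 / ?a y)))"
    unfolding energy_def
  proof (intro sum_mono)
    fix x y assume xy: "x \<in> V" "y \<in> V"
    have "(\<Sum>u\<in>atom V S x. \<Sum>v\<in>atom V S y. gr u v) \<le> (\<Sum>u\<in>atom V S x. \<Sum>v\<in>atom V S y. ga u v)"
      by (intro sum_mono gr_le_ga)
    also have "\<dots> \<le> p * ?a x * ?a y + \<beta> * sqrt (?a x * ?a y)"
      by (rule edges_le[OF atom_subset atom_subset])
    finally have "dens gr (atom V S x) (atom V S y) \<le> (p * ?a x * ?a y + \<beta> * sqrt (?a x * ?a y)) / (?a x * ?a y)"
      unfolding dens_def by (rule divide_right_mono) simp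
    also have "\<dots> = p + \<beta> * (sqrt (?a x * ?a y) / (?a x * ?a y))"
      using a_pos[OF xy(1)] a_pos[OF xy(2)] by (simp add: add_divide_distrib)
    finally have le: "dens gr (atom V S x) (atom V S y) \<le> p + \<beta> * (sqrt (?a x * ?a y) / (?a x * ?a y))" .
    have "0 \<le> dens gr (atom V S x) (atom V S y)"
      unfolding dens_def by (intro divide_nonneg_nonneg sum_nonneg gr_bounds) simp
    then have "(dens gr (atom V S x) (atom V S y))\<^sup>2 \<le> (p + \<beta> * (sqrt (?a x * ?a y) / (?a x * ?a y)))\<^sup>2"
      by (rule power_mono[OF le])
    also have "\<dots> \<le> 2 * p\<^sup>2 + 2 * (\<beta> * (sqrt (?a x * ?a y) / (?a x * ?a y)))\<^sup>2"
      by (rule square_sum_le)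
    also have "(\<beta> * (sqrt (?a x * ?a y) / (?a x * ?a y)))\<^sup>2 = \<beta>\<^sup>2 * (1 / ?a x * (1 / ?a y))"
      using a_pos[OF xy(1)] a_pos[OF xy(2)] by (simp add: power_mult_distrib power_divide) (simp add: power2_eq_square)
    finally show "(dens gr (atom V S x) (atom V S y))\<^sup>2 \<le> 2 * p\<^sup>2 + 2 * \<beta>\<^sup>2 * (1 / ?a x * (1 / ?a y))"
      by simp
  qed
  also have "\<dots> = 2 * p\<^sup>2 * (real (card V))\<^sup>2 + 2 * \<beta>\<^sup>2 * ((\<Sum>x\<in>V. 1 / ?a x) * (\<Sum>y\<in>V. 1 / ?a y))"
  proof -
    have pr: "(\<Sum>x\<in>V. 1 / ?a x) * (\<Sum>y\<in>V. 1 / ?a y) = (\<Sum>x\<in>V. \<Sum>y\<in>V. 1 / ?a x * (1 / ?a y))"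
      by (rule sum_product)
    have const: "(\<Sum>x\<in>V. \<Sum>y\<in>V. 2 * p\<^sup>2) = 2 * p\<^sup>2 * (real (card V))\<^sup>2"
      by (simp add: power2_eq_square)
    show ?thesis unfolding pr unfolding sum.distrib const sum_distrib_left ..
  qed
  also have "\<dots> = 2 * p\<^sup>2 * (real (card V))\<^sup>2 + 2 * (\<beta> * real (card (atom V S ` V)))\<^sup>2"
    by (simp add: sum_inverse_card_atom[OF finV] power_mult_distrib) (simp add: power2_eq_square)
  also have "\<dots> \<le> 2 * p\<^sup>2 * (real (card V))\<^sup>2 + 2 * (p * real (card V))\<^sup>2"
  proof -
    have "real (card (atom V S ` V)) \<le> 2 ^ card S"
      using card_atoms_le[OF S, of V] of_nat_mono by fastforce
    then have "\<beta> * real (card (atom V S ` V)) \<le> \<beta> * 2 ^ card S"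
      by (rule mult_left_mono[OF _ beta_nonneg])
    with beta have "\<beta> * real (card (atom V S ` V)) \<le> p * real (card V)" by linarith
    then show ?thesis using beta_nonneg by (intro add_left_mono mult_left_mono power_mono) auto
  qed
  finally show ?thesis by (simp add: power_mult_distrib)
qed

definition irregular :: "real \<Rightarrow> 'b set \<Rightarrow> 'b set \<Rightarrow> bool" where
  "irregular \<epsilon> A B \<longleftrightarrow> \<not> disc_regular gr p \<epsilon> (dens gr A B / p) A B"

lemma irregular_witness:
  assumes "irregular \<epsilon> A B"
  shows "\<exists>A' B'. A' \<subseteq> A \<and> B' \<subseteq> B \<and>
    \<epsilon> * p * real (card A) * real (card B) < \<bar>\<Sum>x\<in>A'. \<Sum>y\<in>B'. gr x y - dens gr A B\<bar>"
  using assms p_pos unfolding irregular_def disc_regular_def by (auto simp: not_le)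

text \<open>The witness sets of all irregular pairs are added to \<open>S\<close>, two for each pair
  of atoms. On an irregular pair Cauchy-Schwarz gives a gain of at least
  \<open>\<epsilon>^2 p^2 |A| |B|\<close>; irregular pairs cover a proportion above
  \<open>\<epsilon>\<close> of all vertex pairs, so the total gain has the factor
  \<open>\<epsilon>^3\<close>.\<close>

lemma energy_increment:
  assumes S: "finite S" and eps: "0 \<le> \<epsilon>"
    and irr: "\<epsilon> * (real (card V))\<^sup>2 < (\<Sum>x\<in>V. \<Sum>y\<in>V. if irregular \<epsilon> (atom V S x) (atom V S y) then 1 else 0)"
  shows "\<exists>S'. finite S' \<and> card S' \<le> card S + 2 * (2 ^ card S)\<^sup>2 \<and>
    energy V gr S + \<epsilon> ^ 3 * p\<^sup>2 * (real (card V))\<^sup>2 \<le> energy V gr S'"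
proof -
  let ?AT = "atom V S ` V"
  have fin_AT: "finite ?AT" using finV by simp
  have finA: "finite A" if "A \<in> ?AT" for A using that finite_atom[OF finV] by auto
  define Q where "Q u w \<longleftrightarrow> irregular \<epsilon> (fst u) (snd u) \<longrightarrow> (fst w \<subseteq> fst u \<and> snd w \<subseteq> snd u \<and>
    \<epsilon> * p * real (card (fst u)) * real (card (snd u)) < \<bar>\<Sum>x\<in>fst w. \<Sum>y\<in>snd w. gr x y - dens gr (fst u) (snd u)\<bar>)"
    for u w :: "'b set \<times> 'b set"
  have "\<exists>w. Q u w" for u unfolding Q_def using irregular_witness[of \<epsilon> "fst u" "snd u"] by auto
  then obtain w where w: "\<And>u. Q u (w u)" by metis
  define S' where "S' = S \<union> (fst \<circ> w) ` (?AT \<times> ?AT) \<union> (snd \<circ> w) ` (?AT \<times> ?AT)"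
  have SS: "S \<subseteq> S'" by (auto simp: S'_def)
  have finS': "finite S'" unfolding S'_def using S fin_AT by auto
  have "card S' \<le> card S + card ((fst \<circ> w) ` (?AT \<times> ?AT)) + card ((snd \<circ> w) ` (?AT \<times> ?AT))"
    unfolding S'_def by (meson add_le_mono1 card_Un_le order_trans)
  also have "\<dots> \<le> card S + card (?AT \<times> ?AT) + card (?AT \<times> ?AT)"
    using fin_AT by (intro add_mono card_image_le) auto
  also have "\<dots> = card S + 2 * (card ?AT)\<^sup>2" by (simp add: power2_eq_square card_cartesian_product)
  also have "\<dots> \<le> card S + 2 * (2 ^ card S)\<^sup>2"
    by (intro add_left_mono mult_left_mono power_mono card_atoms_le S) auto
  finally have cardS': "card S' \<le> card S + 2 * (2 ^ card S)\<^sup>2" .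
  define f where "f x y = dens gr (atom V S x) (atom V S y)" for x y
  define f' where "f' x y = dens gr (atom V S' x) (atom V S' y)" for x y
  have block: "(\<Sum>x\<in>A. \<Sum>y\<in>B. \<epsilon>\<^sup>2 * p\<^sup>2 * (if irregular \<epsilon> (atom V S x) (atom V S y) then 1 else 0))
      \<le> (\<Sum>x\<in>A. \<Sum>y\<in>B. (f' x y - f x y)\<^sup>2)" if AB: "A \<in> ?AT" "B \<in> ?AT" for A B
  proof -
    have at: "atom V S x = A" if "x \<in> A" for x using atom_fibre[OF AB(1)] that by blast
    have bt: "atom V S y = B" if "y \<in> B" for y using atom_fibre[OF AB(2)] that by blast
    have AV: "A \<subseteq> V" "B \<subseteq> V" using AB by (auto simp: atom_def)
    show ?thesis
    proof (cases "irregular \<epsilon> A B")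
      case False
      then have "(\<Sum>x\<in>A. \<Sum>y\<in>B. \<epsilon>\<^sup>2 * p\<^sup>2 * (if irregular \<epsilon> (atom V S x) (atom V S y) then 1 else 0)) = 0"
        by (intro sum.neutral ballI) (simp add: at bt)
      then show ?thesis by (simp add: sum_nonneg)
    next
      case True
      define A' where "A' = fst (w (A, B))"
      define B' where "B' = snd (w (A, B))"
      have wit: "A' \<subseteq> A" "B' \<subseteq> B" "\<epsilon> * p * real (card A) * real (card B) < \<bar>\<Sum>x\<in>A'. \<Sum>y\<in>B'. gr x y - dens gr A B\<bar>"
        using w[of "(A, B)"] True unfolding Q_def A'_def B'_def by auto
      have AB': "A' \<in> S'" "B' \<in> S'" unfolding S'_def A'_def B'_def using AB by force+
      have AV': "A' \<subseteq> V" "B' \<subseteq> V" using wit AV by auto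
      have restrict: "(\<Sum>x\<in>V. \<Sum>y\<in>V. h x y * (if x \<in> A' \<and> y \<in> B' then 1 else 0)) = (\<Sum>x\<in>A'. \<Sum>y\<in>B'. h x y)" for h :: "'b \<Rightarrow> 'b \<Rightarrow> real"
      proof -
        have "(\<Sum>x\<in>V. \<Sum>y\<in>V. h x y * (if x \<in> A' \<and> y \<in> B' then 1 else 0)) = (\<Sum>x\<in>V. if x \<in> A' then \<Sum>y\<in>V. (if y \<in> B' then h x y else 0) else 0)"
          by (intro sum.cong refl) (auto intro!: sum.cong)
        also have "\<dots> = (\<Sum>x\<in>A'. \<Sum>y\<in>B'. h x y)"
          using finV AV' by (simp add: sum.If_cases Int_absorb1)
        finally show ?thesis .
      qed
      \<comment> \<open>\<open>A'\<close> and \<open>B'\<close> belong to the new family, so they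
        are unions of new atoms, and averaging over new atoms preserves the sum over
        \<open>A' \<times> B'\<close>.\<close>
      have "(\<Sum>x\<in>A'. \<Sum>y\<in>B'. f' x y) = (\<Sum>x\<in>A'. \<Sum>y\<in>B'. gr x y)"
        unfolding restrict[symmetric] f'_def using AB' by (intro dens_adjoint[OF finV]) (auto simp: atom_def)
      moreover have "(\<Sum>x\<in>A'. \<Sum>y\<in>B'. f x y) = (\<Sum>x\<in>A'. \<Sum>y\<in>B'. dens gr A B)"
      proof (intro sum.cong refl)
        fix x y assume "x \<in> A'" "y \<in> B'"
        then have "atom V S x = A" "atom V S y = B" using at bt wit by blast+
        then show "f x y = dens gr A B" by (simp add: f_def)
      qed
      ultimately have dev: "(\<Sum>x\<in>A'. \<Sum>y\<in>B'. f' x y - f x y) = (\<Sum>x\<in>A'. \<Sum>y\<in>B'. gr x y - dens gr A B)"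
        by (simp only: sum_subtractf)
      define r where "r = real (card A) * real (card B)"
      have r: "0 < r" using card_atom_pos[OF finV] AB by (auto simp: r_def)
      have "(\<epsilon> * p * r)\<^sup>2 \<le> \<bar>\<Sum>x\<in>A'. \<Sum>y\<in>B'. f' x y - f x y\<bar>\<^sup>2"
        using wit(3) eps p_pos r unfolding dev r_def by (intro power_mono) (auto simp: mult.assoc)
      also have "\<dots> = (\<Sum>u\<in>A' \<times> B'. 1 * (case u of (x, y) \<Rightarrow> f' x y - f x y))\<^sup>2"
        by (simp add: sum.cartesian_product)
      also have "\<dots> \<le> (\<Sum>u\<in>A' \<times> B'. 1\<^sup>2) * (\<Sum>u\<in>A' \<times> B'. (case u of (x, y) \<Rightarrow> f' x y - f x y)\<^sup>2)"
        by (rule Cauchy_Schwarz_ineq_sum)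
      also have "\<dots> \<le> r * (\<Sum>u\<in>A \<times> B. (case u of (x, y) \<Rightarrow> f' x y - f x y)\<^sup>2)"
      proof (intro mult_mono sum_mono2)
        have "card (A' \<times> B') \<le> card (A \<times> B)"
          using wit finA AB by (intro card_mono) auto
        then show "(\<Sum>u\<in>A' \<times> B'. 1\<^sup>2) \<le> r"
          unfolding r_def by (simp add: card_cartesian_product flip: of_nat_mult)
      qed (use wit finA AB r in \<open>auto intro: sum_nonneg\<close>)
      also have "\<dots> = r * (\<Sum>x\<in>A. \<Sum>y\<in>B. (f' x y - f x y)\<^sup>2)"
        by (simp add: sum.cartesian_product split_def)
      finally have "r * (\<epsilon>\<^sup>2 * p\<^sup>2 * r) \<le> r * (\<Sum>x\<in>A. \<Sum>y\<in>B. (f' x y - f x y)\<^sup>2)"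
        by (simp add: power2_eq_square mult_ac)
      then have "\<epsilon>\<^sup>2 * p\<^sup>2 * r \<le> (\<Sum>x\<in>A. \<Sum>y\<in>B. (f' x y - f x y)\<^sup>2)"
        using r by (simp only: mult_le_cancel_left_pos)
      moreover have "(\<Sum>x\<in>A. \<Sum>y\<in>B. \<epsilon>\<^sup>2 * p\<^sup>2 * (if irregular \<epsilon> (atom V S x) (atom V S y) then 1 else 0)) = \<epsilon>\<^sup>2 * p\<^sup>2 * r"
      proof -
        have "(\<Sum>x\<in>A. \<Sum>y\<in>B. \<epsilon>\<^sup>2 * p\<^sup>2 * (if irregular \<epsilon> (atom V S x) (atom V S y) then 1 else 0)) = (\<Sum>x\<in>A. \<Sum>y\<in>B. \<epsilon>\<^sup>2 * p\<^sup>2)"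
          using True by (intro sum.cong refl) (simp add: at bt)
        then show ?thesis by (simp add: r_def)
      qed
      ultimately show ?thesis by simp
    qed
  qed
  have "\<epsilon>\<^sup>2 * p\<^sup>2 * (\<epsilon> * (real (card V))\<^sup>2) \<le> \<epsilon>\<^sup>2 * p\<^sup>2 * (\<Sum>x\<in>V. \<Sum>y\<in>V. if irregular \<epsilon> (atom V S x) (atom V S y) then 1 else 0)"
    using irr by (intro mult_left_mono) auto
  also have "\<dots> = (\<Sum>A\<in>?AT. \<Sum>B\<in>?AT. \<Sum>x\<in>A. \<Sum>y\<in>B. \<epsilon>\<^sup>2 * p\<^sup>2 * (if irregular \<epsilon> (atom V S x) (atom V S y) then 1 else 0))"
    unfolding sum_distrib_left by (rule sum_atoms2[OF finV])
  also have "\<dots> \<le> (\<Sum>A\<in>?AT. \<Sum>B\<in>?AT. \<Sum>x\<in>A. \<Sum>y\<in>B. (f' x y - f x y)\<^sup>2)"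
    by (intro sum_mono block)
  also have "\<dots> = (\<Sum>x\<in>V. \<Sum>y\<in>V. (f' x y - f x y)\<^sup>2)"
    by (rule sum_atoms2[OF finV, symmetric])
  also have "\<dots> = energy V gr S' - energy V gr S"
    unfolding f_def f'_def by (rule energy_diff[OF finV SS])
  finally have "energy V gr S + \<epsilon> ^ 3 * p\<^sup>2 * (real (card V))\<^sup>2 \<le> energy V gr S'"
    by (simp add: power2_eq_square power3_eq_cube mult_ac)
  then show ?thesis using finS' cardS' by blast
qed

end

fun family_bound :: "nat \<Rightarrow> nat" where
  "family_bound 0 = 0"
| "family_bound (Suc t) = family_bound t + 2 * (2 ^ family_bound t)\<^sup>2"

lemma family_bound_mono:
  assumes "a \<le> family_bound t"
  shows "a + 2 * (2 ^ a)\<^sup>2 \<le> family_bound (Suc t)"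
  using assms by (simp add: add_mono power_mono power_increasing)

lemma sparse_regularity:
  assumes eps: "0 < \<epsilon>"
  shows "\<exists>N::nat. \<exists>c>0. \<forall>(V :: 'b set) ga gr p \<beta>. jumbled_subgraph V ga gr p \<beta> \<longrightarrow> \<beta> \<le> c * p * real (card V) \<longrightarrow>
    (\<exists>S. card (atom V S ` V) \<le> N \<and>
      (\<Sum>x\<in>V. \<Sum>y\<in>V. if jumbled_subgraph.irregular gr p \<epsilon> (atom V S x) (atom V S y) then 1 else 0) \<le> \<epsilon> * (real (card V))\<^sup>2)"
proof -
  \<comment> \<open>After \<open>T\<close> increments the energy would be at least
    \<open>5 p^2 |V|^2\<close>, above the bound \<open>4 p^2 |V|^2\<close> of
    \<open>energy_le\<close>.\<close>
  define T where "T = nat \<lceil>5 / \<epsilon> ^ 3\<rceil>"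
  have "5 / \<epsilon> ^ 3 \<le> real T" unfolding T_def by (rule real_nat_ceiling_ge)
  then have T: "5 \<le> real T * \<epsilon> ^ 3" using eps by (simp add: divide_le_eq)
  define M where "M = family_bound T"
  show ?thesis
  \<comment> \<open>At most \<open>M\<close> sets have at most \<open>2 ^ M\<close> atoms, and
    \<open>c = 1 / 2 ^ M\<close> makes \<open>energy_le\<close> applicable to every family met on
    the way.\<close>
  proof (rule exI[of _ "2 ^ M"], rule exI[of _ "1 / 2 ^ M"], intro conjI allI impI)
    fix V :: "'b set" and ga gr p \<beta>
    assume J: "jumbled_subgraph V ga gr p \<beta>" and beta: "\<beta> \<le> 1 / 2 ^ M * p * real (card V)"
    interpret jumbled_subgraph V ga gr p \<beta> by (rule J)
    let ?irr = "\<lambda>S. (\<Sum>x\<in>V. \<Sum>y\<in>V. if irregular \<epsilon> (atom V S x) (atom V S y) then 1 else 0) :: real"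
    let ?n = "real (card V)"
    have step: "\<exists>S. finite S \<and> card S \<le> M \<and> ?irr S \<le> \<epsilon> * ?n\<^sup>2 \<or>
        finite S \<and> card S \<le> family_bound t \<and> real t * (\<epsilon> ^ 3 * p\<^sup>2 * ?n\<^sup>2) \<le> energy V gr S" if "t \<le> T" for t
      using that
    proof (induction t)
      case 0
      then show ?case by (intro exI[of _ "{}"]) (simp add: energy_def sum_nonneg)
    next
      case (Suc t)
      then obtain S where "finite S \<and> card S \<le> M \<and> ?irr S \<le> \<epsilon> * ?n\<^sup>2 \<or>
        finite S \<and> card S \<le> family_bound t \<and> real t * (\<epsilon> ^ 3 * p\<^sup>2 * ?n\<^sup>2) \<le> energy V gr S" by auto
      then consider "finite S \<and> card S \<le> M \<and> ?irr S \<le> \<epsilon> * ?n\<^sup>2"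
        | "\<not> ?irr S \<le> \<epsilon> * ?n\<^sup>2" "finite S" "card S \<le> family_bound t" "real t * (\<epsilon> ^ 3 * p\<^sup>2 * ?n\<^sup>2) \<le> energy V gr S"
        | "?irr S \<le> \<epsilon> * ?n\<^sup>2" "finite S" "card S \<le> family_bound t" by blast
      then show ?case
      proof cases
        case 1
        then show ?thesis by blast
      next
        case 2
        then obtain S' where S': "finite S'" "card S' \<le> card S + 2 * (2 ^ card S)\<^sup>2"
          "energy V gr S + \<epsilon> ^ 3 * p\<^sup>2 * ?n\<^sup>2 \<le> energy V gr S'"
          using energy_increment[of S \<epsilon>] eps by (auto simp: not_le)
        have "real (Suc t) * (\<epsilon> ^ 3 * p\<^sup>2 * ?n\<^sup>2) \<le> energy V gr S'"
          using S'(3) 2(4) by (simp add: distrib_right)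
        then show ?thesis using S'(1) order_trans[OF S'(2) family_bound_mono[OF 2(3)]] by blast
      next
        case 3
        have "family_bound t \<le> M"
          unfolding M_def by (rule lift_Suc_mono_le[of family_bound]) (use Suc.prems in simp_all)
        then have "card S \<le> M" using 3(3) by linarith
        then show ?thesis using 3(1,2) by blast
      qed
    qed
    obtain S where S: "finite S" "card S \<le> M"
      and alt: "?irr S \<le> \<epsilon> * ?n\<^sup>2 \<or> real T * (\<epsilon> ^ 3 * p\<^sup>2 * ?n\<^sup>2) \<le> energy V gr S"
      using step[of T] unfolding M_def by blast
    have "?irr S \<le> \<epsilon> * ?n\<^sup>2"
    proof (cases "V = {}")
      case False
      have "\<beta> * 2 ^ card S \<le> \<beta> * 2 ^ M"
        using S beta_nonneg by (intro mult_left_mono power_increasing) auto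
      also have "\<dots> \<le> p * ?n" using beta by (simp add: field_simps)
      finally have "energy V gr S \<le> 4 * (p\<^sup>2 * ?n\<^sup>2)"
        using energy_le[OF S(1)] by simp
      moreover have "0 < p\<^sup>2 * ?n\<^sup>2" using False finV p_pos by simp
      moreover have "5 * (p\<^sup>2 * ?n\<^sup>2) \<le> real T * \<epsilon> ^ 3 * (p\<^sup>2 * ?n\<^sup>2)"
        using T by (rule mult_right_mono) simp
      ultimately show ?thesis using alt by (simp add: mult.assoc)
    qed simp
    moreover have "card (atom V S ` V) \<le> 2 ^ M"
      by (rule order_trans[OF card_atoms_le[OF S(1)] power_increasing[OF S(2)]]) simp
    ultimately show "\<exists>S. card (atom V S ` V) \<le> 2 ^ M \<and> ?irr S \<le> \<epsilon> * ?n\<^sup>2" by blast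
  qed simp
qed

section \<open>Stability\<close>

text \<open>After multiplication by \<open>t (t + 1)\<close> the difference of the two sides is
  \<open>(t a - b)^2\<close>. Equality means that the new class of size \<open>a\<close> equals the
  average of \<open>t\<close> classes with total size \<open>b\<close>.\<close>

lemma turan_step:
  fixes t a b :: real
  assumes "1 \<le> t"
  shows "(1 - 1 / t) * b\<^sup>2 + 2 * (a * b) \<le> (1 - 1 / (t + 1)) * (a + b)\<^sup>2"
proof -
  have t: "t \<noteq> 0" "t + 1 \<noteq> 0" "0 < t * (t + 1)" using assms by auto
  have "(t * (t + 1)) * ((1 - 1 / t) * b\<^sup>2 + 2 * (a * b)) = (t\<^sup>2 - 1) * b\<^sup>2 + 2 * (t * (t + 1)) * (a * b)"
    using t(1) by (simp add: field_simps power2_eq_square)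
  also have "\<dots> \<le> t\<^sup>2 * (a + b)\<^sup>2"
    using zero_le_power2[of "t * a - b"] by (simp add: power2_eq_square algebra_simps)
  also have "\<dots> = (t * (t + 1)) * ((1 - 1 / (t + 1)) * (a + b)\<^sup>2)"
    using t(2) by (simp add: diff_divide_distrib[symmetric] power2_eq_square field_simps)
  finally show ?thesis using t(3) by (simp only: mult_le_cancel_left_pos)
qed

text \<open>Induction through a vertex \<open>x\<close> of maximal degree: its neighbourhood
  \<open>N\<close> has no clique with one vertex fewer, and the rest \<open>U\<close> becomes a new
  colour class. Degrees in \<open>U\<close> are at most \<open>|N|\<close>, so
  \<open>e U N + e U U \<le> |U| |N|\<close>; twice this sum pays for the pairs meeting
  \<open>U\<close> and, a second time, for those inside \<open>U\<close>. Loops of \<open>R\<close>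
  are permitted, and cliques are maps that need not be injective.\<close>

lemma fueredi_stability:
  fixes R :: "'b \<Rightarrow> 'b \<Rightarrow> bool"
  assumes "finite V" and sym: "\<And>x y. R x y \<Longrightarrow> R y x" and "1 \<le> s"
    and "\<not> (\<exists>f. \<forall>i\<le>s. f i \<in> V \<and> (\<forall>j\<le>s. i \<noteq> j \<longrightarrow> R (f i) (f j)))"
  shows "\<exists>col. (\<forall>x\<in>V. col x < s) \<and>
    (\<Sum>x\<in>V. \<Sum>y\<in>V. of_bool (R x y)) + (\<Sum>x\<in>V. \<Sum>y\<in>V. of_bool (R x y \<and> col x = (col y :: nat)))
      \<le> (1 - 1 / real s) * (real (card V))\<^sup>2"
  using \<open>1 \<le> s\<close> assms(1,4)
proof (induction s arbitrary: V rule: nat_induct_at_least)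
  case base
  have no: "\<not> R x y" if "x \<in> V" "y \<in> V" for x y
  proof
    assume "R x y"
    then have "\<exists>f. \<forall>i\<le>1::nat. f i \<in> V \<and> (\<forall>j\<le>1. i \<noteq> j \<longrightarrow> R (f i) (f j))"
      using that sym by (intro exI[of _ "\<lambda>i::nat. if i = 0 then x else y"]) (auto simp: le_Suc_eq)
    with base(2) show False by (rule notE)
  qed
  show ?case by (intro exI[of _ "\<lambda>_. 0"]) (simp add: no)
next
  case (Suc s)
  note finV = Suc.prems(1)
  show ?case
  proof (cases "V = {}")
    case True
    then show ?thesis by simp
  next
    case False
    define e where "e A B = (\<Sum>x\<in>A. \<Sum>y\<in>B. of_bool (R x y) :: real)" for A B
    define dg where "dg x = (\<Sum>y\<in>V. of_bool (R x y) :: real)" for x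
    obtain x where x: "x \<in> V" "\<And>y. y \<in> V \<Longrightarrow> dg y \<le> dg x"
      using Max_in[of "dg ` V"] Max_ge[of "dg ` V"] finV False by (smt (verit) finite_imageI imageE imageI image_is_empty)
    define N where "N = {y \<in> V. R x y}"
    define U where "U = V - N"
    have NV: "N \<subseteq> V" and UV: "U \<subseteq> V" by (auto simp: N_def U_def)
    note finN = finite_subset[OF NV finV] and finU = finite_subset[OF UV finV]
    have "\<not> (\<exists>f. \<forall>i\<le>s. f i \<in> N \<and> (\<forall>j\<le>s. i \<noteq> j \<longrightarrow> R (f i) (f j)))"
    proof
      assume "\<exists>f. \<forall>i\<le>s. f i \<in> N \<and> (\<forall>j\<le>s. i \<noteq> j \<longrightarrow> R (f i) (f j))"
      then obtain f where f: "\<And>i. i \<le> s \<Longrightarrow> f i \<in> N" "\<And>i j. i \<le> s \<Longrightarrow> j \<le> s \<Longrightarrow> i \<noteq> j \<Longrightarrow> R (f i) (f j)"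
        by blast
      have "\<forall>i\<le>Suc s. (f(Suc s := x)) i \<in> V \<and> (\<forall>j\<le>Suc s. i \<noteq> j \<longrightarrow> R ((f(Suc s := x)) i) ((f(Suc s := x)) j))"
        using f x(1) NV sym unfolding N_def by (auto simp: le_Suc_eq)
      then show False using Suc.prems(2) by blast
    qed
    from Suc.IH[OF finN this] obtain col where col: "\<And>x. x \<in> N \<Longrightarrow> col x < s"
      and IH: "e N N + (\<Sum>x\<in>N. \<Sum>y\<in>N. of_bool (R x y \<and> col x = col y)) \<le> (1 - 1 / real s) * (real (card N))\<^sup>2"
      unfolding e_def by blast
    define col' where "col' y = (if y \<in> N then col y else s)" for y
    have split: "(\<Sum>y\<in>V. h y) = (\<Sum>y\<in>N. h y) + (\<Sum>y\<in>U. h y)" for h :: "'b \<Rightarrow> real"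
      using sum.subset_diff[OF NV finV, of h] by (simp add: U_def)
    have e_swap: "e N U = e U N"
      unfolding e_def by (subst sum.swap) (intro sum.cong refl arg_cong[of _ _ of_bool] iffI; erule sym)
    have e_V: "(\<Sum>x\<in>V. \<Sum>y\<in>V. of_bool (R x y)) = e N N + 2 * e U N + e U U"
      unfolding split sum.distrib using e_swap unfolding e_def by simp
    have in_V: "(\<Sum>x\<in>V. \<Sum>y\<in>V. of_bool (R x y \<and> col' x = col' y)) = (\<Sum>x\<in>N. \<Sum>y\<in>N. of_bool (R x y \<and> col x = col y)) + e U U"
    proof -
      have ne: "col' y \<noteq> col' z" if "y \<in> N" "z \<in> U" for y z using that col[of y] by (auto simp: col'_def U_def)
      have "(\<Sum>x\<in>N. \<Sum>y\<in>N. of_bool (R x y \<and> col' x = col' y)) = (\<Sum>x\<in>N. \<Sum>y\<in>N. of_bool (R x y \<and> col x = col y) :: real)"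
        by (intro sum.cong refl) (simp add: col'_def)
      moreover have "(\<Sum>x\<in>N. \<Sum>y\<in>U. of_bool (R x y \<and> col' x = col' y)) = (0::real)"
        using ne by (intro sum.neutral ballI) auto
      moreover have "(\<Sum>x\<in>U. \<Sum>y\<in>N. of_bool (R x y \<and> col' x = col' y)) = (0::real)"
        using ne by (intro sum.neutral ballI) fastforce
      moreover have "(\<Sum>x\<in>U. \<Sum>y\<in>U. of_bool (R x y \<and> col' x = col' y)) = e U U"
        unfolding e_def by (intro sum.cong refl) (simp add: col'_def U_def)
      ultimately show ?thesis unfolding split sum.distrib by simp
    qed
    have dgx: "dg x = real (card N)"
      unfolding dg_def N_def using finV by (simp add: of_bool_def sum.inter_filter[symmetric])
    have "e U N + e U U = (\<Sum>y\<in>U. dg y)"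
      unfolding dg_def split sum.distrib e_def ..
    also have "\<dots> \<le> (\<Sum>y\<in>U. dg x)" using x UV by (intro sum_mono) auto
    finally have U_le: "e U N + e U U \<le> real (card U) * real (card N)" by (simp add: dgx)
    have cV: "real (card V) = real (card U) + real (card N)"
      using split[of "\<lambda>_. 1"] by simp
    define a where "a = real (card U)"
    define b where "b = real (card N)"
    have s1: "1 \<le> real s" using Suc.hyps by simp
    note ineq = turan_step[OF s1, of b a]
    have "(\<Sum>x\<in>V. \<Sum>y\<in>V. of_bool (R x y)) + (\<Sum>x\<in>V. \<Sum>y\<in>V. of_bool (R x y \<and> col' x = col' y))
       \<le> (1 - 1 / real s) * b\<^sup>2 + 2 * (a * b)"
      unfolding e_V in_V using IH U_le by (simp add: a_def b_def)
    also have "\<dots> \<le> (1 - 1 / real (Suc s)) * (real (card V))\<^sup>2"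
      using ineq unfolding cV a_def b_def by (simp add: add.commute)
    finally have "(\<Sum>x\<in>V. \<Sum>y\<in>V. of_bool (R x y)) + (\<Sum>x\<in>V. \<Sum>y\<in>V. of_bool (R x y \<and> col' x = col' y))
       \<le> (1 - 1 / real (Suc s)) * (real (card V))\<^sup>2" .
    moreover have "\<forall>x\<in>V. col' x < Suc s" using col by (auto simp: col'_def less_Suc_eq)
    ultimately show ?thesis by blast
  qed
qed

context jumbled_subgraph
begin

text \<open>The condition is constant on pairs of label classes, so jumbledness can be applied to
  each of the \<open>|L|^2\<close> pairs, with an error of at most \<open>\<beta> |V|\<close>. The
  labels will be atoms, or atoms together with a colour.\<close>

lemma block_count:
  fixes lab :: "'b \<Rightarrow> 'l" and Q :: "'l \<Rightarrow> 'l \<Rightarrow> bool"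
  assumes L: "finite L" "lab ` V \<subseteq> L"
  shows "(\<Sum>x\<in>V. \<Sum>y\<in>V. ga x y * of_bool (Q (lab x) (lab y)))
    \<le> p * (\<Sum>x\<in>V. \<Sum>y\<in>V. of_bool (Q (lab x) (lab y))) + \<beta> * real (card V) * (real (card L))\<^sup>2"
proof -
  let ?C = "\<lambda>a. {x \<in> V. lab x = a}"
  have grp: "(\<Sum>x\<in>V. h x) = (\<Sum>a\<in>L. \<Sum>x\<in>?C a. h x)" for h :: "'b \<Rightarrow> real"
    using sum.group[OF finV L, of h] by simp
  have "(\<Sum>x\<in>V. \<Sum>y\<in>V. (ga x y - p) * of_bool (Q (lab x) (lab y)))
      = (\<Sum>a\<in>L. \<Sum>x\<in>?C a. \<Sum>b\<in>L. \<Sum>y\<in>?C b. (ga x y - p) * of_bool (Q (lab x) (lab y)))"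
    by (simp only: grp)
  also have "\<dots> = (\<Sum>a\<in>L. \<Sum>b\<in>L. \<Sum>x\<in>?C a. \<Sum>y\<in>?C b. (ga x y - p) * of_bool (Q (lab x) (lab y)))"
    by (intro sum.cong[OF refl] sum.swap)
  also have "\<dots> \<le> (\<Sum>a\<in>L. \<Sum>b\<in>L. \<beta> * real (card V))"
  proof (intro sum_mono)
    fix a b
    have "(\<Sum>x\<in>?C a. \<Sum>y\<in>?C b. (ga x y - p) * of_bool (Q (lab x) (lab y))) = of_bool (Q a b) * (\<Sum>x\<in>?C a. \<Sum>y\<in>?C b. ga x y - p)"
      unfolding sum_distrib_left by (intro sum.cong refl) auto
    also have "\<dots> \<le> \<bar>\<Sum>x\<in>?C a. \<Sum>y\<in>?C b. ga x y - p\<bar>" by (cases "Q a b") auto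
    also have "\<dots> \<le> \<beta> * sqrt (real (card (?C a)) * real (card (?C b)))"
      by (rule disc) auto
    also have "\<dots> \<le> \<beta> * sqrt (real (card V) * real (card V))"
      using finV by (intro mult_left_mono real_sqrt_le_mono mult_mono beta_nonneg) (auto intro!: card_mono)
    finally show "(\<Sum>x\<in>?C a. \<Sum>y\<in>?C b. (ga x y - p) * of_bool (Q (lab x) (lab y))) \<le> \<beta> * real (card V)" by simp
  qed
  also have "\<dots> = \<beta> * real (card V) * (real (card L))\<^sup>2" by (simp add: power2_eq_square)
  finally have "(\<Sum>x\<in>V. \<Sum>y\<in>V. (ga x y - p) * of_bool (Q (lab x) (lab y))) \<le> \<beta> * real (card V) * (real (card L))\<^sup>2" .
  then show ?thesis by (simp add: left_diff_distrib sum_subtractf sum_distrib_left)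
qed

text \<open>
  If \<open>p\<close> is small, some vertex has many non-neighbours, and jumbledness is tested on this star;
  otherwise it is tested on a single vertex, which has no loop.
\<close>

lemma large_vertex_set:
  assumes V: "V \<noteq> {}" and loopless: "\<And>x. ga x x = 0" and d: "0 \<le> d" and M: "0 < M"
    and c: "0 < c" "c \<le> 1 / 8" "c \<le> 1 / (2 * M)" "c \<le> (1 / 4) powr (2 * d + 1) / M"
    and beta: "\<beta> \<le> c * p powr (d + 3) * real (card V)"
  shows "M \<le> real (card V) * p powr (2 * d + 1)"
proof (cases "p \<le> 1 / 4")
  case True
  define n where "n = real (card V)"
  have n: "0 < n" using V finV by (simp add: n_def card_gt_0_iff)
  have "p powr (d + 3) \<le> 1" using p_pos p_le d by (simp add: powr_le1)
  then have "c * p powr (d + 3) * n \<le> 1 / 8 * 1 * n"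
    using c n by (intro mult_right_mono mult_mono) auto
  then have beta8: "\<beta> \<le> n / 8" using beta by (simp add: n_def)
  \<comment> \<open>The average degree is at most \<open>(p + 1/8) n\<close>, hence at most
    \<open>3 n / 8\<close>.\<close>
  have "\<exists>x\<in>V. (\<Sum>y\<in>V. ga x y) \<le> n / 2"
  proof (rule ccontr)
    assume "\<not> ?thesis"
    then have "n / 2 \<le> (\<Sum>y\<in>V. ga x y)" if "x \<in> V" for x using that by fastforce
    then have "(\<Sum>x\<in>V. n / 2) \<le> (\<Sum>x\<in>V. \<Sum>y\<in>V. ga x y)" by (rule sum_mono)
    also have "\<dots> \<le> p * n * n + \<beta> * n" using edges_le[of V V] by (simp add: n_def)
    also have "\<dots> \<le> 1 / 4 * n * n + n / 8 * n" using True beta8 n by (intro add_mono mult_right_mono) auto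
    finally have "n * n \<le> 3 / 4 * (n * n)" by (simp add: n_def)
    then show False using n by simp
  qed
  then obtain x where x: "x \<in> V" "(\<Sum>y\<in>V. ga x y) \<le> n / 2" by blast
  define A where "A = {y \<in> V. ga x y = 0}"
  have "n = (\<Sum>y\<in>V. ga x y) + real (card A)"
  proof -
    have "real (card A) = (\<Sum>y\<in>V. 1 - ga x y)"
      using card_01[OF finV, of "\<lambda>y. 1 - ga x y"] ga01[of x] unfolding A_def by fastforce
    then show ?thesis by (simp add: sum_subtractf n_def)
  qed
  then have A: "n / 2 \<le> real (card A)" using x by simp
  have "p * real (card A) = \<bar>\<Sum>x\<in>{x}. \<Sum>y\<in>A. ga x y - p\<bar>"
    using p_pos by (simp add: A_def)
  also have "\<dots> \<le> \<beta> * sqrt (real (card {x}) * real (card A))"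
    using x by (intro disc) (auto simp: A_def)
  finally have "p * real (card A) \<le> \<beta> * sqrt (real (card A))" by simp
  then have "(p * real (card A))\<^sup>2 \<le> (\<beta> * sqrt (real (card A)))\<^sup>2"
    using p_pos by (intro power_mono) auto
  then have "real (card A) * (p\<^sup>2 * real (card A)) \<le> real (card A) * \<beta>\<^sup>2"
    by (simp add: power_mult_distrib) (simp add: power2_eq_square mult_ac)
  then have "p\<^sup>2 * real (card A) \<le> \<beta>\<^sup>2" using A n by simp
  moreover have "p\<^sup>2 * (n / 2) \<le> p\<^sup>2 * real (card A)" using A by (intro mult_left_mono) auto
  moreover have "\<beta>\<^sup>2 \<le> (c * p powr (d + 3) * n)\<^sup>2"
    using beta beta_nonneg by (intro power_mono) (auto simp: n_def)
  ultimately have "p\<^sup>2 * (n / 2) \<le> (c * p powr (d + 3) * n)\<^sup>2" by linarith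
  \<comment> \<open>The star gives \<open>p^2 n / 2 \<le> \<beta>^2\<close>. Splitting this factor
    off the upper bound for \<open>\<beta>^2\<close> leaves \<open>1 \<le> 2 c^2 n p^(2d+4)\<close>,
    which is stronger than the exponent \<open>2d+1\<close> requires.\<close>
  also have "(c * p powr (d + 3) * n)\<^sup>2 = p\<^sup>2 * (n / 2) * (2 * c\<^sup>2 * (n * p powr (2 * d + 4)))"
  proof -
    have "(p powr (d + 3))\<^sup>2 = p powr (2 + (2 * d + 4))"
      unfolding power2_eq_square powr_add[symmetric] by (simp add: algebra_simps)
    also have "\<dots> = p\<^sup>2 * p powr (2 * d + 4)" unfolding powr_add using p_pos by simp
    finally show ?thesis by (simp add: power_mult_distrib) (simp add: power2_eq_square)
  qed
  finally have "p\<^sup>2 * (n / 2) * 1 \<le> p\<^sup>2 * (n / 2) * (2 * c\<^sup>2 * (n * p powr (2 * d + 4)))" by simp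
  moreover have "0 < p\<^sup>2 * (n / 2)" using p_pos n by simp
  ultimately have "1 \<le> 2 * c\<^sup>2 * (n * p powr (2 * d + 4))" by (simp only: mult_le_cancel_left_pos)
  also have "\<dots> \<le> (1 / M) * (n * p powr (2 * d + 1))"
  proof (intro mult_mono)
    have "c\<^sup>2 \<le> c" using c by (simp add: power2_eq_square mult_left_le)
    moreover have "2 * c \<le> 1 / M" using c(3) M by (simp add: field_simps)
    ultimately show "2 * c\<^sup>2 \<le> 1 / M" by linarith
    show "p powr (2 * d + 4) \<le> p powr (2 * d + 1)" using p_pos p_le by (intro powr_mono') auto
  qed (use n M in auto)
  finally show ?thesis using M by (simp add: n_def field_simps)
next
  case False
  define n where "n = real (card V)"
  have n: "0 < n" using V finV by (simp add: n_def card_gt_0_iff)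
  obtain x where x: "x \<in> V" using V by blast
  have "p = \<bar>\<Sum>u\<in>{x}. \<Sum>y\<in>{x}. ga u y - p\<bar>"
    using p_pos loopless by simp
  also have "\<dots> \<le> \<beta> * sqrt (real (card {x}) * real (card {x}))"
    using x by (intro disc) auto
  also have "\<dots> \<le> c * p powr (d + 3) * n" using beta by (simp add: n_def)
  also have "\<dots> \<le> c * p powr 1 * n"
    using c n p_pos p_le d by (intro mult_right_mono mult_left_mono powr_mono') auto
  finally have "p * 1 \<le> p * (c * n)" using p_pos by (simp add: mult_ac)
  then have cn: "1 \<le> c * n" using p_pos by simp
  have "(1 / 4) powr (2 * d + 1) \<le> p powr (2 * d + 1)"
    using False d by (intro powr_mono2) auto
  then have "n * (1 / 4) powr (2 * d + 1) \<le> n * p powr (2 * d + 1)" using n by simp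
  moreover have "M * 1 \<le> M * (c * n)" using cn M by (intro mult_left_mono) auto
  moreover have "M * c * n \<le> (1 / 4) powr (2 * d + 1) * n"
    using c(4) M n by (intro mult_right_mono) (auto simp: field_simps)
  ultimately show ?thesis by (simp add: n_def mult_ac)
qed

end

section \<open>Copy of \<open>H\<close> or nearly partite: the combined statement\<close>

lemma dens_sym:
  assumes "\<And>x y. w x y = w y x"
  shows "dens w A B = dens w B A"
proof -
  have "(\<Sum>x\<in>A. \<Sum>y\<in>B. w x y) = (\<Sum>x\<in>B. \<Sum>y\<in>A. w x y)"
    by (subst sum.swap) (simp add: assms)
  then show ?thesis by (simp add: dens_def mult.commute)
qed

text \<open>
  Cliques of \<open>R\<close> may repeat vertices within an atom: a regular atom that is dense inside itself already
  admits an embedding of \<open>H\<close>. Hence the pairs inside an atom need no separate treatment.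
\<close>

lemma sparse_stability:
  fixes E :: "nat \<Rightarrow> nat \<Rightarrow> bool" and \<chi> :: "nat \<Rightarrow> nat" and d \<epsilon> :: real
  assumes sym: "symp E" and irrefl: "irreflp E"
    and deg: "\<forall>j<m. \<forall>i<j. E i j \<longrightarrow>
      real (card {h. h < i \<and> E h i} + card {h. h < i \<and> E h j}) \<le> 2 * d"
    and d: "0 \<le> d" and s: "1 \<le> s" and eps: "0 < \<epsilon>"
    and chi: "\<forall>j<m. \<chi> j \<le> s" "\<forall>j<m. \<forall>l<m. E j l \<longrightarrow> \<chi> j \<noteq> \<chi> l"
  shows "\<exists>\<delta>>0. \<exists>c>0. \<forall>(V :: 'b set) ga gr p \<beta>. jumbled_subgraph V ga gr p \<beta> \<longrightarrow> V \<noteq> {} \<longrightarrow>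
    (\<forall>x. ga x x = 0) \<longrightarrow> \<beta> \<le> c * p powr (d + 3) * real (card V) \<longrightarrow>
    (1 - 1 / real s - \<delta>) * p * ((real (card V))\<^sup>2 - real (card V)) \<le> (\<Sum>x\<in>V. \<Sum>y\<in>V. gr x y) \<longrightarrow>
    (\<exists>\<phi>. inj_on \<phi> {..<m} \<and> (\<forall>j<m. \<forall>l<m. E j l \<longrightarrow> gr (\<phi> j) (\<phi> l) = 1)) \<or>
    (\<exists>col. (\<forall>x\<in>V. col x < s) \<and>
       (\<Sum>x\<in>V. \<Sum>y\<in>V. gr x y * of_bool (col x = col y)) \<le> \<epsilon> * p * (real (card V))\<^sup>2)"
proof -
  \<comment> \<open>The final count is \<open>14 \<theta>\<close>: 5 for edges outside
    \<open>R\<close>, 8 for monochromatic pairs of \<open>R\<close>, and 1 for the jumbledness error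
    on the latter.\<close>
  define \<theta> where "\<theta> = min 1 (\<epsilon> / 14)"
  have th: "0 < \<theta>" "\<theta> \<le> 1" "14 * \<theta> \<le> \<epsilon>" using eps by (auto simp: \<theta>_def)
  have "\<exists>\<epsilon>e>0. \<forall>\<kappa>>0. \<exists>\<sigma>>0. completable TYPE('b) E m d \<theta> (m - m) \<epsilon>e \<kappa> \<sigma>"
    by (rule embedding[OF _ _ _ d th(1,2) order_refl])
       (use deg in \<open>auto intro: sympD[OF sym] simp: irreflpD[OF irrefl]\<close>)
  then obtain \<epsilon>e where ee: "0 < \<epsilon>e" and emb: "\<forall>\<kappa>>0. \<exists>\<sigma>>0. completable TYPE('b) E m d \<theta> (m - m) \<epsilon>e \<kappa> \<sigma>"
    by blast
  define \<epsilon>r where "\<epsilon>r = min \<epsilon>e \<theta>"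
  have er: "0 < \<epsilon>r" "\<epsilon>r \<le> \<epsilon>e" "\<epsilon>r \<le> \<theta>" using ee th by (auto simp: \<epsilon>r_def)
  obtain N :: nat and c1 where c1: "0 < c1" and regul: "\<forall>(V :: 'b set) ga gr p \<beta>. jumbled_subgraph V ga gr p \<beta> \<longrightarrow> \<beta> \<le> c1 * p * real (card V) \<longrightarrow>
    (\<exists>S. card (atom V S ` V) \<le> N \<and>
      (\<Sum>x\<in>V. \<Sum>y\<in>V. if jumbled_subgraph.irregular gr p \<epsilon>r (atom V S x) (atom V S y) then 1 else 0) \<le> \<epsilon>r * (real (card V))\<^sup>2)"
    using sparse_regularity[OF er(1)] by (elim exE conjE)
  define N' where "N' = real N + 1"
  have N': "1 \<le> N'" "real N \<le> N'" by (auto simp: N'_def)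
  \<comment> \<open>At most \<open>N\<close> atoms are smaller than \<open>\<mu> n\<close>, and
    together they cover at most \<open>\<theta> n\<close> vertices. \<open>N'\<close> is positive
    even if \<open>N\<close> is 0.\<close>
  define \<mu> where "\<mu> = \<theta> / N'"
  have mu: "0 < \<mu>" "real N * \<mu> \<le> \<theta>"
    using th N' by (auto simp: \<mu>_def field_simps)
  obtain \<sigma> where sg: "0 < \<sigma>" and compl: "completable TYPE('b) E m d \<theta> (m - m) \<epsilon>e \<mu> \<sigma>"
    using emb[rule_format, OF mu(1)] by (elim exE conjE)
  define M where "M = max (1 / \<sigma>) (1 / \<theta>)"
  have M: "0 < M" "1 / \<sigma> \<le> M" "1 / \<theta> \<le> M" using sg th by (auto simp: M_def less_max_iff_disj)
  \<comment> \<open>This bounds the squared number of labels in \<open>block_count\<close>, also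
    when a label is an atom together with one of \<open>s\<close> colours.\<close>
  define k where "k = (N' * real s)\<^sup>2"
  have k: "0 < k" using N' s by (simp add: k_def)
  \<comment> \<open>In turn: the regularity lemma, densities at most \<open>2 p\<close> between big
    atoms, the embedding, the errors of \<open>block_count\<close>, and three terms for
    \<open>large_vertex_set\<close>.\<close>
  define c where "c = min (min (min c1 \<mu>) (min \<sigma> (\<theta> / k))) (min (1 / 8) (min (1 / (2 * M)) ((1 / 4) powr (2 * d + 1) / M)))"
  have c: "0 < c" "c \<le> c1" "c \<le> \<mu>" "c \<le> \<sigma>" "c \<le> \<theta> / k" "c \<le> 1 / 8" "c \<le> 1 / (2 * M)" "c \<le> (1 / 4) powr (2 * d + 1) / M"
  proof -
    show "0 < c" unfolding c_def using c1 mu sg th k M by simp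
  qed (unfold c_def, (meson min.cobounded1 min.cobounded2 order_trans)+)
  show ?thesis
  proof (rule exI[of _ \<theta>], rule conjI[OF th(1)], rule exI[of _ c], rule conjI[OF c(1)], intro allI impI)
    fix V :: "'b set" and ga gr p \<beta>
    assume J: "jumbled_subgraph V ga gr p \<beta>" and V: "V \<noteq> {}" and loopless: "\<forall>x. ga x x = 0"
      and beta: "\<beta> \<le> c * p powr (d + 3) * real (card V)"
      and many: "(1 - 1 / real s - \<theta>) * p * ((real (card V))\<^sup>2 - real (card V)) \<le> (\<Sum>x\<in>V. \<Sum>y\<in>V. gr x y)"
    interpret jumbled_subgraph V ga gr p \<beta> by (rule J)
    define n where "n = real (card V)"
    have n: "0 < n" using V finV by (simp add: n_def card_gt_0_iff)
    have large: "M \<le> n * p powr (2 * d + 1)"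
      unfolding n_def using c loopless by (intro large_vertex_set[OF V _ d M(1) c(1) _ _ _ beta]) auto
    have "n * p powr (2 * d + 1) \<le> n * 1"
      using n p_pos p_le d by (intro mult_left_mono powr_le1) auto
    then have "1 / \<theta> \<le> n" using large M(3) by linarith
    then have n_th: "1 \<le> \<theta> * n" using th by (simp add: divide_le_eq mult.commute)
    have beta_le: "\<beta> \<le> c' * p * n" if "c \<le> c'" for c'
    proof -
      have "p powr (d + 3) \<le> p powr 1" using p_pos p_le d by (intro powr_mono') auto
      then have "c * p powr (d + 3) * n \<le> c' * p * n"
        using that c(1) n p_pos by (intro mult_mono) auto
      then show ?thesis using beta by (simp add: n_def)
    qed
    obtain S where N: "card (atom V S ` V) \<le> N"
      and irr: "(\<Sum>x\<in>V. \<Sum>y\<in>V. if irregular \<epsilon>r (atom V S x) (atom V S y) then 1 else 0) \<le> \<epsilon>r * n\<^sup>2"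
      using regul[rule_format, OF J] beta_le[OF c(2)] unfolding n_def by blast
    define P where "P = atom V S"
    define L where "L = P ` V"
    have L: "finite L" "P ` V \<subseteq> L" "real (card L) \<le> N'"
      using finV N N' by (auto simp: L_def P_def)
    define big where "big A \<longleftrightarrow> \<mu> * n \<le> real (card A)" for A :: "'b set"
    define R' where "R' A B \<longleftrightarrow> big A \<and> big B \<and> \<not> irregular \<epsilon>r A B \<and> \<theta> * p \<le> dens gr A B" for A B
    define R where "R x y \<longleftrightarrow> R' (P x) (P y)" for x y
    have R_sym: "R y x" if "R x y" for x y
    proof -
      have "dens gr (P x) (P y) = dens gr (P y) (P x)" by (rule dens_sym[OF gr_sym])
      then show ?thesis using that disc_regular_sym[OF _ gr_sym]
        unfolding R_def R'_def irregular_def by auto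
    qed
    have dens_le: "dens gr A B \<le> 2 * p" if "A \<subseteq> V" "B \<subseteq> V" "big A" "big B" for A B
    proof -
      have AB: "0 < real (card A)" "0 < real (card B)" "(\<mu> * n)\<^sup>2 \<le> real (card A) * real (card B)"
        using that(3,4) mult_pos_pos[OF mu(1) n] unfolding big_def power2_eq_square by (auto intro!: mult_mono)
      have "\<beta> \<le> p * (\<mu> * n)" using beta_le[OF c(3)] by (simp add: mult_ac)
      also have "\<mu> * n \<le> sqrt (real (card A) * real (card B))" by (rule real_le_rsqrt[OF AB(3)])
      finally have "\<beta> \<le> p * sqrt (real (card A) * real (card B))" using p_pos by simp
      then have "(\<Sum>x\<in>A. \<Sum>y\<in>B. ga x y) \<le> 2 * p * real (card A) * real (card B)"
        by (rule edges_le_twice[OF that(1,2)])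
      moreover have "(\<Sum>x\<in>A. \<Sum>y\<in>B. gr x y) \<le> (\<Sum>x\<in>A. \<Sum>y\<in>B. ga x y)"
        by (intro sum_mono gr_le_ga)
      ultimately show ?thesis using AB(1,2) by (simp add: dens_def divide_le_eq mult.assoc)
    qed
    show "(\<exists>\<phi>. inj_on \<phi> {..<m} \<and> (\<forall>j<m. \<forall>l<m. E j l \<longrightarrow> gr (\<phi> j) (\<phi> l) = 1)) \<or>
      (\<exists>col. (\<forall>x\<in>V. col x < s) \<and> (\<Sum>x\<in>V. \<Sum>y\<in>V. gr x y * of_bool (col x = col y)) \<le> \<epsilon> * p * (real (card V))\<^sup>2)"
    proof (cases "\<exists>f. \<forall>i\<le>s. f i \<in> V \<and> (\<forall>j\<le>s. i \<noteq> j \<longrightarrow> R (f i) (f j))")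
      case True
      then obtain f where f: "\<And>i. i \<le> s \<Longrightarrow> f i \<in> V" "\<And>i j. i \<le> s \<Longrightarrow> j \<le> s \<Longrightarrow> i \<noteq> j \<Longrightarrow> R (f i) (f j)"
        by blast
      define W where "W j = P (f (\<chi> j))" for j
      have W_V: "W j \<subseteq> V" for j unfolding W_def P_def by (rule atom_subset)
      \<comment> \<open>Isolated vertices of \<open>H\<close> need a large cell as well. As
        \<open>s \<ge> 1\<close>, the clique has a second vertex, and being \<open>R\<close>-related
        to it forces the cell to be big.\<close>
      have W_big: "big (W j)" if "j < m" for j
      proof -
        define i where "i = (if \<chi> j = 0 then 1 else 0 :: nat)"
        have "i \<le> s" "\<chi> j \<noteq> i" using s by (auto simp: i_def)
        then have "R (f (\<chi> j)) (f i)" using f(2) chi(1) that by blast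
        then show ?thesis by (simp add: R_def R'_def W_def)
      qed
      have reg: "\<exists>q. \<theta> \<le> q \<and> q \<le> 2 \<and> disc_regular gr p \<epsilon>e q (W j) (W l)" if jl: "j < m" "l < m" "E j l" for j l
      proof -
        have "R' (W j) (W l)"
          using f(2)[of "\<chi> j" "\<chi> l"] chi jl by (simp add: R_def W_def)
        then have "\<theta> \<le> dens gr (W j) (W l) / p" "disc_regular gr p \<epsilon>r (dens gr (W j) (W l) / p) (W j) (W l)"
          using p_pos by (auto simp: R'_def irregular_def le_divide_eq)
        moreover have "dens gr (W j) (W l) / p \<le> 2"
          using dens_le[OF W_V W_V W_big[OF jl(1)] W_big[OF jl(2)]] p_pos by (simp add: divide_le_eq)
        ultimately show ?thesis
          using disc_regular_mono[OF _ er(2)] p_pos by (meson less_imp_le)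
      qed
      have "\<exists>\<phi>. inj_on \<phi> {m - m..<m} \<and> (\<forall>j\<in>{m - m..<m}. \<phi> j \<in> W j - {}) \<and>
        (\<forall>j\<in>{m - m..<m}. \<forall>l\<in>{m - m..<m}. E j l \<longrightarrow> gr (\<phi> j) (\<phi> l) = 1)"
      proof (rule compl[unfolded completable_def, rule_format, OF J])
        show "\<beta> \<le> \<sigma> * p powr (d + 3) * real (card V)"
          using beta c(4) n mult_right_mono[OF c(4), of "p powr (d + 3) * n"] by (simp add: n_def mult.assoc)
        show "1 / \<sigma> \<le> real (card V) * p powr (2 * d + 1)"
          using large M(2) by (simp add: n_def)
      qed (use W_V W_big reg in \<open>auto simp: big_def n_def\<close>)
      then show ?thesis by (auto simp: atLeast0LessThan)
    next
      case False
      from fueredi_stability[OF finV R_sym s False]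
      obtain col where col: "\<forall>x\<in>V. col x < s"
        and fue: "(\<Sum>x\<in>V. \<Sum>y\<in>V. of_bool (R x y)) + (\<Sum>x\<in>V. \<Sum>y\<in>V. of_bool (R x y \<and> col x = col y)) \<le> (1 - 1 / real s) * n\<^sup>2"
        unfolding n_def by blast
      define eR where "eR = (\<Sum>x\<in>V. \<Sum>y\<in>V. of_bool (R x y) :: real)"
      define inR where "inR = (\<Sum>x\<in>V. \<Sum>y\<in>V. of_bool (R x y \<and> col x = col y) :: real)"
      have beta_k: "\<beta> * n * k \<le> \<theta> * p * n\<^sup>2"
      proof -
        have "\<beta> * n * k \<le> (\<theta> / k * p * n) * n * k"
          using beta_le[OF c(5)] n k by (intro mult_right_mono) auto
        then show ?thesis using k by (simp add: power2_eq_square)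
      qed
      have beta_L: "\<beta> * n * (real (card L))\<^sup>2 \<le> \<theta> * p * n\<^sup>2"
      proof -
        have "N' * 1 \<le> N' * real s" using N' s by (intro mult_left_mono) auto
        then have "real (card L) \<le> N' * real s" using L(3) by simp
        then have "\<beta> * n * (real (card L))\<^sup>2 \<le> \<beta> * n * k"
          unfolding k_def using n beta_nonneg by (intro mult_left_mono power_mono) auto
        then show ?thesis using beta_k by simp
      qed
      have small: "(\<Sum>x\<in>V. of_bool (\<not> big (P x))) \<le> \<theta> * n"
      proof -
        have "(\<Sum>x\<in>V. of_bool (\<not> big (P x))) = (\<Sum>A\<in>L. \<Sum>x\<in>A. of_bool (\<not> big (P x)) :: real)"
          unfolding L_def P_def by (rule sum_atoms[OF finV])
        also have "\<dots> \<le> (\<Sum>A\<in>L. \<mu> * n)"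
        proof (rule sum_mono)
          fix A assume "A \<in> L"
          then have "P x = A" if "x \<in> A" for x using that atom_fibre[of A V S] unfolding L_def P_def by blast
          then have "(\<Sum>x\<in>A. of_bool (\<not> big (P x)) :: real) = (\<Sum>x\<in>A. of_bool (\<not> big A))" by (intro sum.cong) auto
          then show "(\<Sum>x\<in>A. of_bool (\<not> big (P x))) \<le> \<mu> * n"
            using mu n by (cases "big A") (auto simp: big_def)
        qed
        also have "\<dots> = real (card L) * \<mu> * n" by simp
        also have "\<dots> \<le> real N * \<mu> * n"
          using N mu n by (intro mult_right_mono) (auto simp: L_def P_def)
        also have "\<dots> \<le> \<theta> * n" using mu n by (intro mult_right_mono) auto
        finally show ?thesis .
      qed
      define Bad where "Bad A B \<longleftrightarrow> \<not> big A \<or> \<not> big B \<or> irregular \<epsilon>r A B" for A B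
      have "(\<Sum>x\<in>V. \<Sum>y\<in>V. of_bool (Bad (P x) (P y)))
         \<le> (\<Sum>x\<in>V. \<Sum>y\<in>V. of_bool (\<not> big (P x)) + of_bool (\<not> big (P y)) + (if irregular \<epsilon>r (P x) (P y) then 1 else 0 :: real))"
        by (intro sum_mono) (auto simp: Bad_def)
      also have "\<dots> = 2 * n * (\<Sum>x\<in>V. of_bool (\<not> big (P x))) + (\<Sum>x\<in>V. \<Sum>y\<in>V. if irregular \<epsilon>r (P x) (P y) then 1 else 0)"
        by (simp add: sum.distrib n_def sum_distrib_left[symmetric])
      also have "\<dots> \<le> 2 * n * (\<theta> * n) + \<theta> * n\<^sup>2"
        using small irr n er(3) unfolding P_def[symmetric]
        by (intro add_mono mult_left_mono order_trans[OF irr[folded P_def]] mult_right_mono) auto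
      finally have bad: "(\<Sum>x\<in>V. \<Sum>y\<in>V. of_bool (Bad (P x) (P y))) \<le> 3 * \<theta> * n\<^sup>2"
        by (simp add: power2_eq_square)
      have bad_edges: "(\<Sum>x\<in>V. \<Sum>y\<in>V. ga x y * of_bool (Bad (P x) (P y))) \<le> 4 * \<theta> * p * n\<^sup>2"
      proof -
        have "p * (\<Sum>x\<in>V. \<Sum>y\<in>V. of_bool (Bad (P x) (P y))) \<le> p * (3 * \<theta> * n\<^sup>2)"
          using bad p_pos by (intro mult_left_mono) auto
        then show ?thesis using block_count[OF L(1,2), of Bad] beta_L unfolding n_def[symmetric]
          by (simp add: mult_ac)
      qed
      \<comment> \<open>The indicator of a sparse pair is constant on pairs of atoms, so
        \<open>gr\<close> may be replaced by its density, which is below \<open>\<theta> p\<close>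
        wherever the indicator is 1.\<close>
      have sparse_edges: "(\<Sum>x\<in>V. \<Sum>y\<in>V. gr x y * of_bool (dens gr (P x) (P y) < \<theta> * p)) \<le> \<theta> * p * n\<^sup>2"
      proof -
        have "(\<Sum>x\<in>V. \<Sum>y\<in>V. gr x y * of_bool (dens gr (P x) (P y) < \<theta> * p))
          = (\<Sum>x\<in>V. \<Sum>y\<in>V. dens gr (P x) (P y) * of_bool (dens gr (P x) (P y) < \<theta> * p))"
          unfolding P_def by (rule dens_adjoint[OF finV, symmetric]) (simp_all add: atom_eq)
        also have "\<dots> \<le> (\<Sum>x\<in>V. \<Sum>y\<in>V. \<theta> * p)"
          using th p_pos by (intro sum_mono) auto
        finally show ?thesis by (simp add: n_def power2_eq_square mult_ac)
      qed
      have notR: "gr x y * of_bool (\<not> R x y) \<le> ga x y * of_bool (Bad (P x) (P y)) + gr x y * of_bool (dens gr (P x) (P y) < \<theta> * p)" for x y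
        using gr_le_ga[of x y] gr_bounds[of x y] by (auto simp: R_def R'_def Bad_def not_le)
      have notR_edges: "(\<Sum>x\<in>V. \<Sum>y\<in>V. gr x y * of_bool (\<not> R x y)) \<le> 5 * \<theta> * p * n\<^sup>2"
      proof -
        have "(\<Sum>x\<in>V. \<Sum>y\<in>V. gr x y * of_bool (\<not> R x y))
          \<le> (\<Sum>x\<in>V. \<Sum>y\<in>V. ga x y * of_bool (Bad (P x) (P y)) + gr x y * of_bool (dens gr (P x) (P y) < \<theta> * p))"
          by (intro sum_mono notR)
        then show ?thesis using bad_edges sparse_edges by (simp add: sum.distrib)
      qed
      have R_edges: "(\<Sum>x\<in>V. \<Sum>y\<in>V. ga x y * of_bool (R x y)) \<le> p * eR + \<theta> * p * n\<^sup>2"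
        using block_count[OF L(1,2), of R'] beta_L unfolding n_def[symmetric] R_def[symmetric] eR_def by linarith
      have col_edges: "(\<Sum>x\<in>V. \<Sum>y\<in>V. ga x y * of_bool (R x y \<and> col x = col y)) \<le> p * inR + \<theta> * p * n\<^sup>2"
      proof -
        have "finite (L \<times> {..<s})" "(\<lambda>x. (P x, col x)) ` V \<subseteq> L \<times> {..<s}"
          using L col by auto
        from block_count[OF this, of "\<lambda>u v. R' (fst u) (fst v) \<and> snd u = snd v"]
        have "(\<Sum>x\<in>V. \<Sum>y\<in>V. ga x y * of_bool (R x y \<and> col x = col y)) \<le> p * inR + \<beta> * n * (real (card (L \<times> {..<s})))\<^sup>2"
          by (simp only: fst_conv snd_conv R_def inR_def n_def)
        also have "\<dots> \<le> p * inR + \<beta> * n * k"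
          unfolding k_def using n beta_nonneg L(3) N'
          by (intro add_left_mono mult_left_mono power_mono) (auto simp: card_cartesian_product intro!: mult_right_mono)
        finally show ?thesis using beta_k by simp
      qed
      have "(\<Sum>x\<in>V. \<Sum>y\<in>V. gr x y) \<le> (\<Sum>x\<in>V. \<Sum>y\<in>V. gr x y * of_bool (\<not> R x y) + ga x y * of_bool (R x y))"
        using gr_le_ga by (intro sum_mono) auto
      also have "\<dots> \<le> 5 * \<theta> * p * n\<^sup>2 + (p * eR + \<theta> * p * n\<^sup>2)"
        unfolding sum.distrib by (intro add_mono notR_edges R_edges)
      finally have "p * ((1 - 1 / real s - \<theta>) * (n\<^sup>2 - n)) \<le> p * (6 * \<theta> * n\<^sup>2 + eR)"
        using many unfolding n_def[symmetric] by (simp add: algebra_simps)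
      then have e1: "(1 - 1 / real s - \<theta>) * (n\<^sup>2 - n) \<le> 6 * \<theta> * n\<^sup>2 + eR"
        using p_pos by simp
      \<comment> \<open>The 6 becomes 8: one \<open>\<theta>\<close> because
        \<open>\<delta> = \<theta>\<close>, and one because \<open>n^2 - n\<close> replaces
        \<open>n^2\<close>, a loss absorbed by \<open>n \<le> \<theta> n^2\<close>. With the
        inequality \<open>fue\<close>, the near-extremal number of pairs in \<open>R\<close> leaves
        at most \<open>8 \<theta> n^2\<close> monochromatic ones.\<close>
      have "n \<le> \<theta> * n\<^sup>2" using mult_right_mono[OF n_th, of n] n by (simp add: power2_eq_square mult_ac)
      moreover have "(1 - 1 / real s) * n \<le> 1 * n"
        using n s by (intro mult_right_mono) auto
      moreover have "0 \<le> \<theta> * n" using th n by simp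
      moreover have "(1 - 1 / real s - \<theta>) * (n\<^sup>2 - n) = (1 - 1 / real s) * n\<^sup>2 - (1 - 1 / real s) * n - \<theta> * n\<^sup>2 + \<theta> * n"
        by (simp add: algebra_simps)
      ultimately have "(1 - 1 / real s) * n\<^sup>2 \<le> 8 * (\<theta> * n\<^sup>2) + eR" using e1 by linarith
      then have "inR \<le> 8 * (\<theta> * n\<^sup>2)" using fue unfolding eR_def[symmetric] inR_def[symmetric] by linarith
      then have "p * inR \<le> p * (8 * (\<theta> * n\<^sup>2))" using p_pos by (intro mult_left_mono) auto
      then have "p * inR \<le> 8 * (\<theta> * p * n\<^sup>2)" by (simp add: mult_ac)
      moreover have "(\<Sum>x\<in>V. \<Sum>y\<in>V. gr x y * of_bool (col x = col y))
         \<le> (\<Sum>x\<in>V. \<Sum>y\<in>V. gr x y * of_bool (\<not> R x y) + ga x y * of_bool (R x y \<and> col x = col y))"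
        using gr_le_ga gr_bounds by (intro sum_mono) auto
      ultimately have "(\<Sum>x\<in>V. \<Sum>y\<in>V. gr x y * of_bool (col x = col y)) \<le> 14 * \<theta> * p * n\<^sup>2"
        using notR_edges col_edges by (simp add: sum.distrib)
      also have "\<dots> \<le> \<epsilon> * p * n\<^sup>2" using th p_pos by (intro mult_right_mono) auto
      finally show ?thesis using col unfolding n_def by blast
    qed
  qed
qed

section \<open>Graphs\<close>

lemma adjacent_sym: "adjacent G u v \<Longrightarrow> adjacent G v u"
  by (simp add: adjacent_def insert_commute)

lemma adjacent_simple:
  assumes "simple_graph G" "adjacent G u v"
  shows "u \<in> vertices G" "v \<in> vertices G" "u \<noteq> v"
  using assms by (force simp: simple_graph_def adjacent_def)+

lemma edge_adjacent:
  assumes "simple_graph G" "e \<in> edges G"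
  shows "\<exists>u v. e = {u, v} \<and> u \<noteq> v \<and> adjacent G u v"
  using assms unfolding simple_graph_def adjacent_def by (metis card_2_iff)

lemma finite_edges:
  assumes "simple_graph G"
  shows "finite (edges G)"
  by (rule finite_subset[of _ "Pow (vertices G)"]) (use assms in \<open>auto simp: simple_graph_def\<close>)

lemma e_pairs_sum:
  assumes "finite X" "finite Y"
  shows "real (e_pairs G X Y) = (\<Sum>x\<in>X. \<Sum>y\<in>Y. of_bool (adjacent G x y))"
proof -
  have "real (card {u \<in> X \<times> Y. of_bool (adjacent G (fst u) (snd u)) = (1::real)}) = (\<Sum>u\<in>X \<times> Y. of_bool (adjacent G (fst u) (snd u)))"
    by (rule card_01) (use assms in auto)
  moreover have "{u \<in> X \<times> Y. of_bool (adjacent G (fst u) (snd u)) = (1::real)} = {(x, y) \<in> X \<times> Y. adjacent G x y}"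
    by (auto simp: of_bool_def split: if_splits)
  ultimately show ?thesis by (simp add: e_pairs_def sum.cartesian_product split_def)
qed

lemma sum_adjacent:
  assumes G: "simple_graph G" and V: "finite V" "vertices G \<subseteq> V"
  shows "(\<Sum>x\<in>V. \<Sum>y\<in>V. of_bool (adjacent G x y)) = 2 * real (card (edges G))"
proof -
  let ?P = "{(x, y) \<in> V \<times> V. adjacent G x y}"
  let ?g = "\<lambda>(x, y). {x, y}"
  have fin: "finite ?P" by (rule finite_subset[of _ "V \<times> V"]) (use V in auto)
  have "?g ` ?P \<subseteq> edges G" by (auto simp: adjacent_def)
  from sum.group[OF fin finite_edges[OF G] this, of "\<lambda>_. 1::nat"]
  have "card ?P = (\<Sum>e\<in>edges G. card {u \<in> ?P. ?g u = e})" by (simp only: card_eq_sum)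
  also have "\<dots> = (\<Sum>e\<in>edges G. 2)"
  proof (rule sum.cong[OF refl])
    fix e assume "e \<in> edges G"
    then obtain u v where e: "e = {u, v}" "u \<noteq> v" "adjacent G u v" using edge_adjacent[OF G] by blast
    have "u \<in> V" "v \<in> V" using adjacent_simple[OF G e(3)] V(2) by auto
    then have "{u \<in> ?P. ?g u = e} = {(u, v), (v, u)}"
      using e adjacent_sym[OF e(3)] by (auto simp: doubleton_eq_iff)
    then show "card {u \<in> ?P. ?g u = e} = 2" using e(2) by simp
  qed
  finally have "e_pairs G V V = 2 * card (edges G)" by (simp add: e_pairs_def)
  then show ?thesis using e_pairs_sum[OF V(1) V(1), of G] by simp
qed

lemma chromatic_colouring:
  assumes "simple_graph H"
  shows "r_partite (chromatic_number H) H"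
  unfolding chromatic_number_def
proof (rule LeastI)
  have fin: "finite (vertices H)" using assms by (simp add: simple_graph_def)
  obtain f where f: "bij_betw f (vertices H) {0..<card (vertices H)}"
    using ex_bij_betw_finite_nat[OF fin] by blast
  show "r_partite (card (vertices H)) H"
    unfolding r_partite_def
  proof (intro exI[of _ f] conjI ballI impI)
    fix v assume "v \<in> vertices H"
    then show "f v < card (vertices H)" using f by (auto dest: bij_betwE)
  next
    fix u v assume uv: "u \<in> vertices H" "v \<in> vertices H" "adjacent H u v"
    then show "f u \<noteq> f v"
      using adjacent_simple(3)[OF assms uv(3)] bij_betw_imp_inj_on[OF f] by (auto simp: inj_on_def)
  qed
qed

text \<open>
  Isolated vertices of \<open>H\<close> may be mapped outside \<open>vertices G\<close> by \<open>\<phi>\<close>; they are moved to unused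
  vertices of \<open>G\<close>.
\<close>

lemma homomorphic_copy_not_free:
  assumes H: "simple_graph H" and G: "simple_graph G"
    and vs: "distinct vs" "set vs = vertices H" "length vs \<le> card (vertices G)"
    and inj: "inj_on \<phi> {..<length vs}"
    and hom: "\<And>j l. j < length vs \<Longrightarrow> l < length vs \<Longrightarrow> adjacent H (vs ! j) (vs ! l) \<Longrightarrow> adjacent G (\<phi> j) (\<phi> l)"
  shows "\<not> free_of H G"
proof -
  let ?m = "length vs"
  have finG: "finite (vertices G)" using G by (simp add: simple_graph_def)
  define I where "I = {j. j < ?m \<and> (\<exists>l<?m. adjacent H (vs ! j) (vs ! l))}"
  have I: "I \<subseteq> {..<?m}" by (auto simp: I_def)
  have phiI: "\<phi> ` I \<subseteq> vertices G"
    using hom adjacent_simple(1)[OF G] unfolding I_def by blast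
  have cI: "card (\<phi> ` I) = card I"
    by (rule card_image) (rule inj_on_subset[OF inj I])
  have "card ({..<?m} - I) = ?m - card I"
    using I by (simp add: card_Diff_subset finite_subset)
  also have "\<dots> \<le> card (vertices G) - card (\<phi> ` I)"
    using vs(3) cI by simp
  also have "\<dots> = card (vertices G - \<phi> ` I)"
    using phiI finG by (simp add: card_Diff_subset finite_subset)
  finally obtain g where g: "g ` ({..<?m} - I) \<subseteq> vertices G - \<phi> ` I" "inj_on g ({..<?m} - I)"
    using card_le_inj[of "{..<?m} - I" "vertices G - \<phi> ` I"] finG by auto
  define \<psi> where "\<psi> j = (if j \<in> I then \<phi> j else g j)" for j
  have inj_psi: "inj_on \<psi> {..<?m}"
  proof (rule inj_onI)
    fix j l assume jl: "j \<in> {..<?m}" "l \<in> {..<?m}" "\<psi> j = \<psi> l"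
    have out: "g k \<notin> \<phi> ` I" if "k \<in> {..<?m}" "k \<notin> I" for k using g(1) that by blast
    show "j = l"
    proof (cases "j \<in> I"; cases "l \<in> I")
      assume "j \<in> I" "l \<in> I"
      then show ?thesis using jl inj by (simp add: \<psi>_def inj_on_def)
    next
      assume "j \<in> I" "l \<notin> I"
      then show ?thesis using jl out[of l] by (simp add: \<psi>_def) (metis imageI)
    next
      assume "j \<notin> I" "l \<in> I"
      then show ?thesis using jl out[of j] by (simp add: \<psi>_def)
    next
      assume "j \<notin> I" "l \<notin> I"
      then show ?thesis using jl g(2) by (simp add: \<psi>_def inj_on_def)
    qed
  qed
  have psi_G: "\<psi> j \<in> vertices G" if "j < ?m" for j
    using that g(1) phiI by (auto simp: \<psi>_def)
  have psi_hom: "adjacent G (\<psi> j) (\<psi> l)" if "j < ?m" "l < ?m" "adjacent H (vs ! j) (vs ! l)" for j l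
  proof -
    have "j \<in> I" "l \<in> I" using that adjacent_sym[OF that(3)] by (auto simp: I_def)
    then show ?thesis using hom[OF that] by (simp add: \<psi>_def)
  qed
  have bij: "bij_betw ((!) vs) {..<?m} (vertices H)"
    by (rule bij_betw_nth) (use vs in auto)
  define h where "h = \<psi> \<circ> inv_into {..<?m} ((!) vs)"
  define idx where "idx = inv_into {..<?m} ((!) vs)"
  have idx: "idx v < ?m" "vs ! idx v = v" if "v \<in> vertices H" for v
    using bij_betw_inv_into_right[OF bij that] bij_betwE[OF bij_betw_inv_into[OF bij]] that
    by (auto simp: idx_def)
  have h_idx: "h v = \<psi> (idx v)" for v by (simp add: h_def idx_def)
  have inj_h: "inj_on h (vertices H)"
    unfolding h_def using inj_psi bij_betw_inv_into[OF bij]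
    by (intro comp_inj_on) (auto simp: bij_betw_def)
  have h_hom: "adjacent G (h u) (h v)" if "adjacent H u v" for u v
    using psi_hom[of "idx u" "idx v"] idx[of u] idx[of v] adjacent_simple[OF H that] that by (simp add: h_idx)
  define K where "K = \<lparr>vertices = h ` vertices H, edges = {{h u, h v} | u v. adjacent H u v}\<rparr>"
  have "is_subgraph K G"
    unfolding is_subgraph_def simple_graph_def
  proof (intro conjI ballI)
    show "finite (vertices K)" using H by (simp add: K_def simple_graph_def)
    show "vertices K \<subseteq> vertices G" using psi_G idx by (auto simp: K_def h_idx)
    show "edges K \<subseteq> edges G" using h_hom by (auto simp: K_def adjacent_def)
    fix e assume "e \<in> edges K"
    then obtain u v where e: "e = {h u, h v}" "adjacent H u v" by (auto simp: K_def)
    note uv = adjacent_simple[OF H e(2)]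
    show "e \<subseteq> vertices K" using e uv by (simp add: K_def)
    show "card e = 2" using e uv inj_h by (simp add: inj_on_eq_iff)
  qed
  moreover have "isomorphic_graphs H K"
    unfolding isomorphic_graphs_def
  proof (intro exI[of _ h] conjI ballI iffI)
    show "bij_betw h (vertices H) (vertices K)" using inj_h by (simp add: bij_betw_def K_def)
    fix u v assume uv: "u \<in> vertices H" "v \<in> vertices H"
    show "adjacent K (h u) (h v)" if "adjacent H u v" using that by (auto simp: K_def adjacent_def)
    assume "adjacent K (h u) (h v)"
    then obtain u' v' where e: "{h u, h v} = {h u', h v'}" "adjacent H u' v'" by (auto simp: K_def adjacent_def)
    note uv' = adjacent_simple[OF H e(2)]
    have "u = u' \<and> v = v' \<or> u = v' \<and> v = u'"
      using e(1) uv uv' inj_h by (auto simp: doubleton_eq_iff inj_on_eq_iff)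
    then show "adjacent H u v" using e(2) adjacent_sym[OF e(2)] by auto
  qed
  ultimately show ?thesis unfolding free_of_def by blast
qed

lemma jumbled_subgraph_of_graphs:
  assumes Ga: "simple_graph \<Gamma>" and G: "is_subgraph G \<Gamma>" and p: "0 < p" "p \<le> 1"
    and jumb: "jumbled p \<beta> \<Gamma>" and ne: "vertices \<Gamma> \<noteq> {}"
  shows "jumbled_subgraph (vertices \<Gamma>) (\<lambda>x y. of_bool (adjacent \<Gamma> x y)) (\<lambda>x y. of_bool (adjacent G x y)) p \<beta>"
proof -
  have fin: "finite (vertices \<Gamma>)" using Ga by (simp add: simple_graph_def)
  have disc: "\<bar>\<Sum>x\<in>X. \<Sum>y\<in>Y. of_bool (adjacent \<Gamma> x y) - p\<bar> \<le> \<beta> * sqrt (real (card X) * real (card Y))"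
    if XY: "X \<subseteq> vertices \<Gamma>" "Y \<subseteq> vertices \<Gamma>" for X Y
  proof -
    have "(\<Sum>x\<in>X. \<Sum>y\<in>Y. of_bool (adjacent \<Gamma> x y) - p) = real (e_pairs \<Gamma> X Y) - p * real (card X) * real (card Y)"
      using e_pairs_sum[of X Y \<Gamma>] XY finite_subset[OF _ fin] by (simp add: sum_subtractf mult_ac)
    then show ?thesis using jumb XY unfolding jumbled_def by simp
  qed
  obtain v where "v \<in> vertices \<Gamma>" using ne by blast
  \<comment> \<open>On a pair of singletons the square root is 1, so \<open>\<beta>\<close> bounds
    an absolute value.\<close>
  then have "0 \<le> \<beta>" using disc[of "{v}" "{v}"] by simp
  moreover have "adjacent G x y \<Longrightarrow> adjacent \<Gamma> x y" for x y
    using G by (auto simp: is_subgraph_def adjacent_def)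
  moreover have "adjacent F x y = adjacent F y x" for F :: "'a ugraph" and x y
    using adjacent_sym by metis
  ultimately show ?thesis
    using fin p disc by unfold_locales (auto simp: of_bool_def)
qed

theorem theorem1p5:
  fixes H :: "'a ugraph" and \<epsilon> :: real
  assumes "simple_graph H" and "edges H \<noteq> {}" and "\<epsilon> > 0"
  shows "\<exists>\<delta> > 0. \<exists>c > 0. \<forall>(p::real) (\<beta>::real) (n::nat) (\<Gamma> :: 'b ugraph) (G :: 'b ugraph).
    0 < p \<longrightarrow> p \<le> 1 \<longrightarrow>
    \<beta> \<le> c * p powr (two_degeneracy H + 3) * real n \<longrightarrow>
    simple_graph \<Gamma> \<longrightarrow> card (vertices \<Gamma>) = n \<longrightarrow> jumbled p \<beta> \<Gamma> \<longrightarrow>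
    is_subgraph G \<Gamma> \<longrightarrow> free_of H G \<longrightarrow>
    real (card (edges G)) \<ge>
      (1 - 1 / (real (chromatic_number H) - 1) - \<delta>) * p * real (n choose 2) \<longrightarrow>
    (\<exists>R \<subseteq> edges G. real (card R) \<le> \<epsilon> * p * (real n)\<^sup>2 \<and>
       r_partite (chromatic_number H - 1) (remove_edges G R))"
proof -
  note H = assms(1)
  define d where "d = two_degeneracy H"
  have d: "0 \<le> d" unfolding d_def by (rule two_degeneracy_attained(1)[OF H])
  obtain vs where vs: "distinct vs" "set vs = vertices H" "ordering_2_bounded H vs d"
    using two_degeneracy_attained(2)[OF H] unfolding d_def vertex_ordering_def by blast
  define m where "m = length vs"
  define E where "E j l \<longleftrightarrow> j < m \<and> l < m \<and> adjacent H (vs ! j) (vs ! l)" for j l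
  have E_sym: "symp E" by (rule sympI) (use adjacent_sym in \<open>auto simp: E_def\<close>)
  have E_irrefl: "irreflp E" by (rule irreflpI) (use adjacent_simple(3)[OF H] in \<open>auto simp: E_def\<close>)
  have "real (card {h. h < i \<and> E h i} + card {h. h < i \<and> E h j}) \<le> 2 * d" if ij: "i < j" "j < m" "E i j" for i j
  proof -
    have "{h. h < i \<and> E h k} = {h. h < i \<and> adjacent H (vs ! h) (vs ! k)}" if "k < m" for k
      using that ij by (auto simp: E_def)
    then show ?thesis
      using vs(3) ij unfolding ordering_2_bounded_def earlier_nbrs_def m_def[symmetric] E_def by auto
  qed
  then have deg: "\<forall>j<m. \<forall>i<j. E i j \<longrightarrow> real (card {h. h < i \<and> E h i} + card {h. h < i \<and> E h j}) \<le> 2 * d"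
    by blast
  \<comment> \<open>The number of parts. An edge of \<open>H\<close> forces two colours, so
    \<open>s \<ge> 1\<close> and the subtraction is exact; colours of \<open>H\<close> range over
    \<open>0..s\<close>, the vertices of a clique in \<open>R\<close>.\<close>
  define s where "s = chromatic_number H - 1"
  obtain f where f: "\<And>v. v \<in> vertices H \<Longrightarrow> f v < chromatic_number H"
    "\<And>u v. u \<in> vertices H \<Longrightarrow> v \<in> vertices H \<Longrightarrow> adjacent H u v \<Longrightarrow> f u \<noteq> f v"
    using chromatic_colouring[OF H] unfolding r_partite_def by blast
  obtain u v where uv: "adjacent H u v" using assms(2) edge_adjacent[OF H] by blast
  note uv' = adjacent_simple[OF H uv]
  have s: "1 \<le> s" "real s = real (chromatic_number H) - 1"
    using f(1)[OF uv'(1)] f(1)[OF uv'(2)] f(2)[OF uv'(1,2) uv] by (auto simp: s_def)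
  have m: "0 < m" using uv'(1) vs(2) by (auto simp: m_def)
  have in_H: "vs ! j \<in> vertices H" if "j < m" for j using that vs(2) by (auto simp: m_def)
  have colours: "\<forall>j<m. f (vs ! j) \<le> s" using f(1) in_H by (fastforce simp: s_def)
  have proper: "\<forall>j<m. \<forall>l<m. E j l \<longrightarrow> f (vs ! j) \<noteq> f (vs ! l)" using f(2) in_H by (auto simp: E_def)
  obtain \<delta> c1 where \<delta>: "0 < \<delta>" and c1: "0 < c1" and stab: "\<forall>(V :: 'b set) ga gr p \<beta>. jumbled_subgraph V ga gr p \<beta> \<longrightarrow> V \<noteq> {} \<longrightarrow>
    (\<forall>x. ga x x = 0) \<longrightarrow> \<beta> \<le> c1 * p powr (d + 3) * real (card V) \<longrightarrow>
    (1 - 1 / real s - \<delta>) * p * ((real (card V))\<^sup>2 - real (card V)) \<le> (\<Sum>x\<in>V. \<Sum>y\<in>V. gr x y) \<longrightarrow>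
    (\<exists>\<phi>. inj_on \<phi> {..<m} \<and> (\<forall>j<m. \<forall>l<m. E j l \<longrightarrow> gr (\<phi> j) (\<phi> l) = 1)) \<or>
    (\<exists>col. (\<forall>x\<in>V. col x < s) \<and>
       (\<Sum>x\<in>V. \<Sum>y\<in>V. gr x y * of_bool (col x = col y)) \<le> \<epsilon> * p * (real (card V))\<^sup>2)"
    using sparse_stability[where \<chi> = "\<lambda>j. f (vs ! j)", OF E_sym E_irrefl deg d s(1) assms(3) colours proper]
    by (elim exE conjE)
  \<comment> \<open>A graph on fewer than \<open>m\<close> vertices has at most
    \<open>m^2 = \<epsilon> M\<close> edges, and \<open>large_vertex_set\<close> bounds
    \<open>M\<close> by \<open>n p^(2d+1)\<close>.\<close>
  define M where "M = (real m)\<^sup>2 / \<epsilon>"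
  have M: "0 < M" using m assms(3) by (simp add: M_def)
  define c where "c = min (min c1 (1 / 8)) (min (1 / (2 * M)) ((1 / 4) powr (2 * d + 1) / M))"
  have c: "0 < c" "c \<le> c1" "c \<le> 1 / 8" "c \<le> 1 / (2 * M)" "c \<le> (1 / 4) powr (2 * d + 1) / M"
  proof -
    show "0 < c" unfolding c_def using c1 M by simp
  qed (unfold c_def, (meson min.cobounded1 min.cobounded2 order_trans)+)
  show ?thesis
    unfolding d_def[symmetric] s_def[symmetric] s(2)[symmetric]
  proof (rule exI[of _ \<delta>], rule conjI[OF \<delta>], rule exI[of _ c], rule conjI[OF c(1)], intro allI impI)
    fix p \<beta> :: real and n :: nat and \<Gamma> G :: "'b ugraph"
    assume p: "0 < p" "p \<le> 1" and beta: "\<beta> \<le> c * p powr (d + 3) * real n"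
      and Ga: "simple_graph \<Gamma>" and n: "card (vertices \<Gamma>) = n" and jumb: "jumbled p \<beta> \<Gamma>"
      and sub: "is_subgraph G \<Gamma>" and free: "free_of H G"
      and many: "(1 - 1 / real s - \<delta>) * p * real (n choose 2) \<le> real (card (edges G))"
    let ?V = "vertices \<Gamma>"
    have G: "simple_graph G" and GV: "vertices G \<subseteq> ?V" using sub by (auto simp: is_subgraph_def)
    have finV: "finite ?V" and finG: "finite (vertices G)" using Ga G by (auto simp: simple_graph_def)
    show "\<exists>R\<subseteq>edges G. real (card R) \<le> \<epsilon> * p * (real n)\<^sup>2 \<and> r_partite s (remove_edges G R)"
    proof (cases "?V = {}")
      case True
      then have "r_partite s (remove_edges G {})"
        using GV by (simp add: r_partite_def remove_edges_def)
      then show ?thesis using p assms(3) by (intro exI[of _ "{}"]) simp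
    next
      case ne: False
      interpret jumbled_subgraph ?V "\<lambda>x y. of_bool (adjacent \<Gamma> x y)" "\<lambda>x y. of_bool (adjacent G x y)" p \<beta>
        by (rule jumbled_subgraph_of_graphs[OF Ga sub p jumb ne])
      have loopless: "of_bool (adjacent \<Gamma> x x) = (0::real)" for x
        using adjacent_simple(3)[OF Ga, of x x] by auto
      show ?thesis
      proof (cases "card (vertices G) < m")
        case True
        \<comment> \<open>\<open>G\<close> is \<open>H\<close>-free for lack of vertices, but has few enough edges to remove them all.\<close>
        have "2 * real (card (edges G)) = (\<Sum>x\<in>vertices G. \<Sum>y\<in>vertices G. of_bool (adjacent G x y))"
          by (rule sum_adjacent[OF G finG order_refl, symmetric])
        also have "\<dots> \<le> (\<Sum>x\<in>vertices G. \<Sum>y\<in>vertices G. 1)" by (intro sum_mono) auto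
        also have "\<dots> = (real (card (vertices G)))\<^sup>2" by (simp add: power2_eq_square)
        also have "\<dots> \<le> (real m)\<^sup>2" using True by (intro power_mono) auto
        also have "\<dots> = \<epsilon> * M" using assms(3) by (simp add: M_def)
        finally have "real (card (edges G)) \<le> \<epsilon> * M"
          using of_nat_0_le_iff[of "card (edges G)"] by linarith
        also have "\<dots> \<le> \<epsilon> * (real n * p powr (2 * d + 1))"
          using large_vertex_set[OF ne loopless d M c(1,3,4,5)] beta assms(3) by (simp add: n)
        also have "\<dots> \<le> \<epsilon> * ((real n)\<^sup>2 * p powr 1)"
        proof -
          have "real n * 1 \<le> real n * real n"
            using ne finV n by (intro mult_left_mono) (auto simp: Suc_le_eq card_gt_0_iff)
          then show ?thesis using p d assms(3)
            by (intro mult_left_mono mult_mono powr_mono') (auto simp: power2_eq_square)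
        qed
        finally have "real (card (edges G)) \<le> \<epsilon> * p * (real n)\<^sup>2" using p by (simp add: mult_ac)
        moreover have "r_partite s (remove_edges G (edges G))"
          unfolding r_partite_def by (intro exI[of _ "\<lambda>_. 0"]) (use s(1) in \<open>simp add: remove_edges_def adjacent_def\<close>)
        ultimately show ?thesis by blast
      next
        case False
        \<comment> \<open>Sums over the locale count ordered pairs, so both the edges and
          \<open>n choose 2\<close> appear doubled; the factor 2 cancels from the density
          hypothesis.\<close>
        have two: "(\<Sum>x\<in>?V. \<Sum>y\<in>?V. of_bool (adjacent G x y)) = 2 * real (card (edges G))"
          by (rule sum_adjacent[OF G finV GV])
        have "even (n * (n - 1))" by (cases n) auto
        then have "2 * (n choose 2) = n * (n - 1)"
          unfolding choose_two by (rule dvd_mult_div_cancel)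
        then have "2 * real (n choose 2) = real (n * (n - 1))"
          by (metis of_nat_mult of_nat_numeral)
        then have ch: "(real n)\<^sup>2 - real n = 2 * real (n choose 2)"
          by (cases n) (simp_all add: power2_eq_square algebra_simps)
        have "\<beta> \<le> c1 * p powr (d + 3) * real n"
          using beta mult_right_mono[OF c(2), of "p powr (d + 3) * real n"] by (simp add: mult.assoc)
        moreover have "(1 - 1 / real s - \<delta>) * p * ((real n)\<^sup>2 - real n) \<le> (\<Sum>x\<in>?V. \<Sum>y\<in>?V. of_bool (adjacent G x y))"
          unfolding two ch using many by simp
        ultimately consider \<phi> where "inj_on \<phi> {..<m}" "\<forall>j<m. \<forall>l<m. E j l \<longrightarrow> of_bool (adjacent G (\<phi> j) (\<phi> l)) = (1::real)"
          | col where "\<forall>x\<in>?V. col x < s" "(\<Sum>x\<in>?V. \<Sum>y\<in>?V. of_bool (adjacent G x y) * of_bool (col x = col y)) \<le> \<epsilon> * p * (real n)\<^sup>2"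
          using stab[rule_format, OF jumbled_subgraph_axioms ne loopless] unfolding n by blast
        then show ?thesis
        proof cases
          case 1
          have "adjacent G (\<phi> j) (\<phi> l)" if "j < m" "l < m" "adjacent H (vs ! j) (vs ! l)" for j l
            using 1(2) that by (auto simp: E_def)
          then have "\<not> free_of H G"
            using 1(1) False vs(1,2) unfolding m_def by (intro homomorphic_copy_not_free[OF H G]) auto
          then show ?thesis using free by blast
        next
          case 2
          \<comment> \<open>These are ordered monochromatic pairs, at least as many as the edges in
            \<open>R\<close>, and their number is the sum bounded by \<open>stab\<close>.\<close>
          let ?S = "{u \<in> ?V \<times> ?V. of_bool (adjacent G (fst u) (snd u)) * of_bool (col (fst u) = col (snd u)) = (1::real)}"
          define R where "R = (\<lambda>u. {fst u, snd u}) ` ?S"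
          have "R \<subseteq> edges G" unfolding R_def by (auto simp: adjacent_def)
          moreover have "real (card R) \<le> \<epsilon> * p * (real n)\<^sup>2"
          proof -
            have "card R \<le> card ?S"
              unfolding R_def by (rule card_image_le) (use finV in simp)
            then have "real (card R) \<le> real (card ?S)" by simp
            also have "\<dots> = (\<Sum>u\<in>?V \<times> ?V. of_bool (adjacent G (fst u) (snd u)) * of_bool (col (fst u) = col (snd u)))"
              by (rule card_01) (use finV in auto)
            also have "\<dots> = (\<Sum>x\<in>?V. \<Sum>y\<in>?V. of_bool (adjacent G x y) * of_bool (col x = col y))"
              by (simp add: sum.cartesian_product split_def)
            finally show ?thesis using 2(2) by linarith
          qed
          moreover have "r_partite s (remove_edges G R)"
            unfolding r_partite_def
          proof (intro exI[of _ col] conjI ballI impI notI)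
            fix x assume "x \<in> vertices (remove_edges G R)"
            then show "col x < s" using 2(1) GV by (auto simp: remove_edges_def)
          next
            fix x y assume xy: "x \<in> vertices (remove_edges G R)" "y \<in> vertices (remove_edges G R)"
              "adjacent (remove_edges G R) x y" "col x = col y"
            then have "adjacent G x y" "{x, y} \<notin> R" "x \<in> ?V" "y \<in> ?V"
              using GV by (auto simp: remove_edges_def adjacent_def)
            then have "(x, y) \<in> ?S" using xy(4) by simp
            then have "{x, y} \<in> R" unfolding R_def by (intro image_eqI[where x = "(x, y)"]) simp_all
            then show False using \<open>{x, y} \<notin> R\<close> by blast
          qed
          ultimately show ?thesis by blast
        qed
      qed
    qed
  qed
qed

end
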